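(* Let $v=v_n\ge 0$ be integers such that the limit $\alpha=\lim_{n\to\infty} v/n\in[0,\infty]$ exists. For each $n$ let $(\zeta_1,\dots,\zeta_n)$ be a random vector in $\{z\in\mathbb{C}:\operatorname{Re} z>0\}^n$ whose joint density with respect to Lebesgue measure on $\mathbb{C}^n$ is $$f(z_1,\dots,z_n)=C\prod_{1\le j<k\le n}|z_j^2-z_k^2|^2\prod_{j=1}^n|z_j|^{2(v+1)}K_v(2n|z_j|^2),\qquad \operatorname{Re}(z_j)>0 \text{ for all } j.$$ Let $x>0$. Then $$\lim_{n\to\infty}\frac{1}{n\,l_n^2}\log\mathbb{P}\left(\left(\frac{n}{n+v}\right)^{1/2}\max_{1\le i\le n}|\zeta_i|^2\ge 1+l_n x\right)=-\frac{2(1+\alpha)}{2+\alpha}x^2$$ for any positive sequence $(l_n)$ satisfying $\frac{\log n}{n}\ll l_n^2\ll 1$, and $$\lim_{n\to\infty}\frac{1}{n^2\,l_n^3}\log\mathbb{P}\left(\left(\frac{n}{n+v}\right)^{1/2}\max_{1\le i\le n}|\zeta_i|^2\le 1-l_n x\right)=-\frac{4(1+\alpha)^2}{3(2+\alpha)^2}x^3$$ for any positive sequence $(l_n)$ satisfying $\frac{\log n}{n}\ll l_n^3\ll 1$. For $\alpha=+\infty$ the right-hand sides are understood as their limits as $\alpha\to+\infty$.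
   Context: $K_v$ denotes the modified Bessel function of the second kind of order $v$; $C=C_{n,v}$ is the normalizing constant making $f$ a probability density. The notation $x_n\ll y_n$ means $\lim_{n\to\infty}x_n/y_n=0$. *)

theory Defs
  imports "HOL-Probability.Probability"
begin

definition much_smaller :: "(nat \<Rightarrow> real) \<Rightarrow> (nat \<Rightarrow> real) \<Rightarrow> bool"  (infix "\<lless>" 50) where
  "a \<lless> b \<longleftrightarrow> (\<lambda>n. a n / b n) \<longlonglongrightarrow> 0"

(* The modified Bessel function of the second kind, defined by its standard integral
   representation, which is valid for every real order v and every x > 0.  For x <= 0 the
   integral diverges and the value carries no meaning. *)
definition bessel_K :: "real \<Rightarrow> real \<Rightarrow> real" where
  "bessel_K v x = (LBINT t:{0<..}. exp (- x * cosh t) * cosh (v * t))"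

(* A point of C^n is an extensional function on {1..n}. *)
definition lebesgue_Cn :: "nat \<Rightarrow> (nat \<Rightarrow> complex) measure" where
  "lebesgue_Cn n = (\<Pi>\<^sub>M i\<in>{1..n}. lborel)"

definition unnormalized_density :: "nat \<Rightarrow> nat \<Rightarrow> (nat \<Rightarrow> complex) \<Rightarrow> real" where
  "unnormalized_density n v z =
     (if \<forall>j\<in>{1..n}. Re (z j) > 0
      then (\<Prod>k\<in>{1..n}. \<Prod>j\<in>{1..<k}. (cmod ((z j)\<^sup>2 - (z k)\<^sup>2))\<^sup>2)
           * (\<Prod>j\<in>{1..n}. cmod (z j) ^ (2 * (v + 1))
                * bessel_K (real v) (2 * real n * (cmod (z j))\<^sup>2))
      else 0)"

definition norm_const :: "nat \<Rightarrow> nat \<Rightarrow> real" where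
  "norm_const n v = 1 / (\<integral>z. unnormalized_density n v z \<partial>lebesgue_Cn n)"

definition joint_density :: "nat \<Rightarrow> nat \<Rightarrow> (nat \<Rightarrow> complex) \<Rightarrow> real" where
  "joint_density n v z = norm_const n v * unnormalized_density n v z"

(* The value at \<alpha> of a function h on [0, \<infinity>), with h(\<infinity>) read as the limit of h at infinity. *)
definition eval_ext :: "(real \<Rightarrow> real) \<Rightarrow> ennreal \<Rightarrow> real" where
  "eval_ext h \<alpha> = (if \<alpha> = \<infinity> then Lim at_top h else h (enn2real \<alpha>))"

end

theory Submission
  imports Defs "HOL-Real_Asymp.Real_Asymp"
begin

text \<open>The density depends on the points only through a squared Vandermonde product in the \<open>z\<^sub>j\<^sup>2\<close>
and a rotation invariant weight. Expanding both Vandermonde factors into alternating sums and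
integrating over the arguments leaves only the diagonal terms (\<open>angular_orthogonality\<close>), so for
every Borel set \<open>B\<close> the probability that all \<open>\<bar>\<zeta>\<^sub>i\<bar>\<^sup>2\<close> lie in \<open>B\<close> is a product over \<open>j = 1, \<dots>, n\<close> of
probabilities \<open>P(Y\<^sub>j \<in> B)\<close>, where \<open>Y\<^sub>j\<close> has density proportional to
\<open>s^(2 j + v - 1) K\<^sub>v(2 n s)\<close> on \<open>s > 0\<close> (\<open>prob_all_moduli\<close>). In particular the maximal squared modulus
has the distribution of the maximum of independent \<open>Y\<^sub>1, \<dots>, Y\<^sub>n\<close>.

The variable \<open>(n Y\<^sub>j)\<^sup>2\<close> has mean \<open>D(j) = j (j + v)\<close>; this is an integration by parts
(\<open>cosh_moment_rec\<close>, \<open>radial_mass_UNIV_rec\<close>). Weighting the law of \<open>(n Y\<^sub>j)\<^sup>2\<close> by the variable itself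
gives the law of \<open>(n Y\<^sub>j\<^sub>+\<^sub>1)\<^sup>2\<close>. Hence exponential tilting, the usual tool of large deviations, is
here just a shift of the index, and everything needed about the laws is contained in the locale
\<open>size_biased_chain\<close>. On the event \<open>u \<ge> t\<close> passing from \<open>j\<close> to \<open>j + 1\<close> multiplies probabilities by
at least \<open>t / D(j)\<close>, on \<open>u \<le> t\<close> by at most this factor. Iterating gives upper bounds for tail
probabilities. For matching lower bounds one shifts until the mean sits just inside the event,
where Chebyshev's inequality yields probability at least one half.

Write \<open>s = 1/n + 1/(n + v)\<close>, so that \<open>ln (D(n + i) / D(n))\<close> is about \<open>i s\<close>, and let the threshold be
\<open>D(n) (1 \<plusminus> l x)\<^sup>2\<close>, whose logarithm differs from \<open>ln (D(n))\<close> by about \<open>\<plusminus> 2 l x\<close>. For the upper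
tail, \<open>\<theta>\<close> shifts cost \<open>s \<theta>\<^sup>2 / 2 - 2 l x \<theta>\<close>, which is minimal at \<open>\<theta> = 2 l x / s\<close> with value
\<open>- 2 l\<^sup>2 x\<^sup>2 / s\<close>; the union bound over the \<open>n\<close> variables only costs \<open>ln n\<close>, which is negligible against
\<open>n l\<^sup>2\<close>. For the lower tail about \<open>K = 2 l x / s\<close> of the variables have to be displaced, and the
shifts that move \<open>Y\<^sub>n\<^sub>-\<^sub>k\<close> down to index \<open>n - K\<close>, taken together for all \<open>k < K\<close>, contribute
\<open>\<Sum>m\<le>K. m (m s - 2 l x)\<close>, which is about \<open>K\<^sup>3 s / 3 - l x K\<^sup>2 = - 4 l\<^sup>3 x\<^sup>3 / (3 s\<^sup>2)\<close>; the remaining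
factors are at least one half and cost at most \<open>n ln 2\<close>, which is negligible against \<open>n\<^sup>2 l\<^sup>3\<close>. As
\<open>n s\<close> tends to \<open>(2 + \<alpha>) / (1 + \<alpha>)\<close>, these are the claimed rates.\<close>

section \<open>Moments of the Bessel function\<close>

text \<open>Up to a factorial and a power, these numbers are the moments of \<open>K\<^sub>v\<close>; see \<open>bessel_K_mellin\<close>.\<close>

definition cosh_moment :: "nat \<Rightarrow> nat \<Rightarrow> real" where
  "cosh_moment v m = (LBINT t:{0<..}. cosh (real v * t) / cosh t ^ m)"

lemma cosh_ratio_le:
  fixes t :: real
  assumes "v < m" "t \<ge> 0"
  shows "cosh (real v * t) / cosh t ^ m \<le> 2 ^ m * exp (- t)"
proof -
  have c: "exp t / 2 \<le> cosh t" by (simp add: cosh_def)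
  have "cosh (real v * t) \<le> exp (real v * t)"
    using assms by (simp add: cosh_def mult_nonneg_nonneg)
  also have "\<dots> \<le> exp ((real m - 1) * t)"
    using assms by (auto intro!: mult_right_mono)
  also have "\<dots> = exp t ^ m * exp (- t)"
    by (simp add: exp_of_nat_mult[symmetric] exp_add[symmetric] algebra_simps)
  also have "\<dots> = 2 ^ m * exp (- t) * (exp t / 2) ^ m"
    by (simp add: power_divide)
  also have "\<dots> \<le> 2 ^ m * exp (- t) * cosh t ^ m"
    using c by (intro mult_left_mono power_mono) auto
  finally show ?thesis
    by (simp add: divide_le_eq cosh_real_pos)
qed

lemma exp_minus_set_integrable: "set_integrable lborel {0<..} (\<lambda>t::real. exp (- t))"
  using has_bochner_integral_I0i_power_exp_m[of 0]
  by (auto simp: set_integrable_def has_bochner_integral_iff mult.commute)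

lemma cosh_ratio_integrable:
  assumes "v < m"
  shows "set_integrable lborel {0<..} (\<lambda>t. cosh (real v * t) / cosh t ^ m)"
proof (rule set_integrable_bound)
  show "set_integrable lborel {0<..} (\<lambda>t::real. 2 ^ m * exp (- t))"
    using exp_minus_set_integrable by (rule set_integrable_mult_right)
  show "set_borel_measurable lborel {0<..} (\<lambda>t. cosh (real v * t) / cosh t ^ m)"
    unfolding set_borel_measurable_def cosh_def by measurable
  show "AE t in lborel. t \<in> {0<..} \<longrightarrow>
          norm (cosh (real v * t) / cosh t ^ m) \<le> norm (2 ^ m * exp (- t))"
    using cosh_ratio_le[OF assms] by auto
qed

lemma cosh_moment_pos:
  assumes "v < m"
  shows "cosh_moment v m > 0"
proof -
  let ?f = "\<lambda>t::real. indicator {0<..} t *\<^sub>R (cosh (real v * t) / cosh t ^ m)"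
  have int: "integrable lborel ?f"
    using cosh_ratio_integrable[OF assms] by (simp add: set_integrable_def)
  have nn: "AE t in lborel. 0 \<le> ?f t" by (auto simp: indicator_def)
  have "integral\<^sup>L lborel ?f \<noteq> 0"
  proof
    assume "integral\<^sup>L lborel ?f = 0"
    then have "AE t in lborel. ?f t = 0"
      using integral_nonneg_eq_0_iff_AE[OF int nn] by simp
    then have "AE t in lborel. t \<notin> {0<..<1::real}"
      by eventually_elim (auto simp: indicator_def split: if_splits)
    then have "emeasure lborel {0<..<1::real} = 0"
      by (subst (asm) AE_iff_measurable[where N = "{0<..<1}"]) auto
    then show False by simp
  qed
  moreover have "integral\<^sup>L lborel ?f \<ge> 0" by (rule integral_nonneg_AE[OF nn])
  ultimately have "integral\<^sup>L lborel ?f > 0" by linarith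
  then show ?thesis
    unfolding cosh_moment_def set_lebesgue_integral_def .
qed

text \<open>Put \<open>f = 1 / cosh^m\<close>. Since \<open>f'' = m\<^sup>2 f - m (m + 1) / cosh^(m + 2)\<close>, the function
\<open>F = cosh (v t) f' - v sinh (v t) f\<close> has as its derivative the difference of the two integrands, and
\<open>F\<close> vanishes at \<open>0\<close> and, because \<open>v < m\<close>, at infinity.\<close>

lemma cosh_moment_rec:
  assumes "v < m"
  shows "real m * (real m + 1) * cosh_moment v (m + 2) = ((real m)\<^sup>2 - (real v)\<^sup>2) * cosh_moment v m"
proof -
  let ?g = "\<lambda>k t. cosh (real v * t) / cosh t ^ k :: real"
  let ?F = "\<lambda>t::real. - (cosh (real v * t) * real m * sinh t / cosh t ^ (m + 1))
                  - real v * sinh (real v * t) / cosh t ^ m"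
  let ?f = "\<lambda>t::real. ((real m)\<^sup>2 - (real v)\<^sup>2) * ?g m t - real m * (real m + 1) * ?g (m + 2) t"
  have cp: "cosh t > 0" for t :: real by (rule cosh_real_pos)
  have F: "(?F has_real_derivative ?f t) (at t)" for t
  proof -
    have *: "(sinh t)\<^sup>2 = (cosh t)\<^sup>2 - 1" by (rule sinh_square_eq)
    have m: "m > 0" using assms by simp
    then obtain k where k: "m = Suc k" by (cases m) auto
    \<comment> \<open>As opaque reals, related only by \<open>s * s = c * c - 1\<close>, the hyperbolic functions leave an identity
of rational functions.\<close>
    define c s C S where "c = cosh t" "s = sinh t" "C = cosh (real v * t)" "S = sinh (real v * t)"
    have dcosh: "(cosh has_real_derivative s) (at t)"
      by (auto intro!: derivative_eq_intros simp: c_s_C_S_def)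
    have pow: "((\<lambda>t::real. cosh t ^ Suc j) has_real_derivative (1 + real j) * (s * c ^ j)) (at t)" for j
      using DERIV_power_Suc[OF dcosh, of j] by (simp add: c_s_C_S_def)
    have n1: "((\<lambda>t. cosh (real v * t) * real m * sinh t) has_real_derivative
        (real v * S * s + C * c) * real m) (at t)"
      by (auto intro!: derivative_eq_intros simp: c_s_C_S_def algebra_simps)
    have n2: "((\<lambda>t. real v * sinh (real v * t)) has_real_derivative real v * (real v * C)) (at t)"
      by (auto intro!: derivative_eq_intros simp: c_s_C_S_def algebra_simps)
    have c: "c \<noteq> 0" "cosh t ^ Suc k \<noteq> 0" "cosh t ^ Suc (Suc k) \<noteq> 0"
      using cp[of t] by (auto simp: c_s_C_S_def)
    have ss: "s * s = c * c - 1" using * by (simp add: c_s_C_S_def power2_eq_square)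
    define P where "P = c ^ k"
    have P: "P \<noteq> 0" using c by (simp add: P_def)
    define V where "V = real v"
    define N where "N = real k"
    have "- (((V * S * s + C * c) * (1 + N) * (c * (c * P)) - C * (1 + N) * s * ((1 + (1 + N)) * (s * (c * P)))) / (c * (c * P) * (c * (c * P))))
          - (V * (V * C) * (c * P) - V * S * ((1 + N) * (s * P))) / (c * P * (c * P))
         = ((1 + N)\<^sup>2 - V\<^sup>2) * (C / (c * P)) - (1 + N) * (1 + N + 1) * (C / (c * (c * (c * P))))"
    proof -
      have "C * (1 + N) * s * ((1 + (1 + N)) * (s * (c * P))) = C * (1 + N) * (1 + (1 + N)) * c * P * (s * s)"
        by (simp add: ac_simps)
      then have e: "C * (1 + N) * s * ((1 + (1 + N)) * (s * (c * P))) = C * (1 + N) * (1 + (1 + N)) * c * P * (c * c - 1)"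
        unfolding ss .
      show ?thesis unfolding e using c P
        by (simp add: divide_simps) (simp add: algebra_simps power2_eq_square)
    qed
    then show ?thesis unfolding k
      using DERIV_diff[OF DERIV_minus[OF DERIV_divide[OF n1 pow[of "Suc k"] c(3)]] DERIV_divide[OF n2 pow[of k] c(2)]]
      by (simp add: c_s_C_S_def P_def V_def N_def k)
  qed
  have i1: "set_integrable lborel {0<..} (?g m)" "set_integrable lborel {0<..} (?g (m + 2))"
    by (rule cosh_ratio_integrable, use assms in simp)+
  have int: "set_integrable lborel {0<..} ?f"
    by (intro set_integral_diff(1) set_integrable_mult_right i1)
  have lim0: "(?g m \<longlongrightarrow> 0) at_top"
  proof (rule tendsto_sandwich[OF _ _ tendsto_const])
    show "((\<lambda>t::real. 2 ^ m * exp (- t)) \<longlongrightarrow> 0) at_top" by real_asymp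
    show "eventually (\<lambda>t. ?g m t \<le> 2 ^ m * exp (- t)) at_top"
      using eventually_ge_at_top[of 0] by eventually_elim (rule cosh_ratio_le[OF assms])
  qed auto
  have lim: "(?F \<longlongrightarrow> 0) at_top"
  proof (rule Lim_null_comparison)
    show "((\<lambda>t. (real m + real v) * ?g m t) \<longlongrightarrow> 0) at_top"
      using tendsto_mult_left[OF lim0, of "real m + real v"] by simp
    show "eventually (\<lambda>t. norm (?F t) \<le> (real m + real v) * ?g m t) at_top"
      using eventually_ge_at_top[of 0]
    proof eventually_elim
      case (elim t)
      have s: "0 \<le> sinh t" "sinh t \<le> cosh t" "0 \<le> sinh (real v * t)" "sinh (real v * t) \<le> cosh (real v * t)"
        using elim by (auto simp: sinh_le_cosh_real mult_nonneg_nonneg)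
      have "cosh (real v * t) * real m * sinh t / cosh t ^ (m + 1)
           \<le> cosh (real v * t) * real m * cosh t / cosh t ^ (m + 1)"
        using s by (intro divide_right_mono mult_left_mono) auto
      also have "\<dots> = real m * ?g m t" using cp[of t] by (simp add: field_simps)
      finally have 1: "cosh (real v * t) * real m * sinh t / cosh t ^ (m + 1) \<le> real m * ?g m t" .
      have 2: "real v * sinh (real v * t) / cosh t ^ m \<le> real v * ?g m t"
        using s cp[of t] by (simp add: divide_right_mono mult_left_mono)
      have "cosh (real v * t) * real m * sinh t / cosh t ^ (m + 1) \<ge> 0"
        "real v * sinh (real v * t) / cosh t ^ m \<ge> 0" using s by auto
      with 1 2 show ?case unfolding real_norm_def ring_distribs by linarith
    qed
  qed
  have cont: "isCont ?F 0" using F[of 0] by (rule DERIV_isCont)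
  have "(LBINT t=ereal 0..\<infinity>. ?f t) = 0 - 0"
  proof (rule interval_integral_FTC_integrable[where F = ?F])
    show "(?F has_vector_derivative ?f t) (at t)" for t
      using F[of t] by (simp add: has_real_derivative_iff_has_vector_derivative)
    show "isCont ?f t" for t
      using cp by (intro continuous_intros) (auto simp: less_imp_neq[symmetric])
    show "set_integrable lborel (einterval (ereal 0) \<infinity>) ?f" using int by simp
    show "((?F \<circ> real_of_ereal) \<longlongrightarrow> 0) (at_right (ereal 0))"
      using cont unfolding ereal_tendsto_simps by (auto simp: isCont_def intro: filterlim_at_split[THEN iffD1, THEN conjunct2])
    show "((?F \<circ> real_of_ereal) \<longlongrightarrow> 0) (at_left \<infinity>)"
      using lim unfolding ereal_tendsto_simps .
  qed simp
  then have "(LBINT t:{0<..}. ?f t) = 0"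
    by (simp add: interval_integral_to_infinity_eq)
  also have "(LBINT t:{0<..}. ?f t) = ((real m)\<^sup>2 - (real v)\<^sup>2) * cosh_moment v m
      - real m * (real m + 1) * cosh_moment v (m + 2)"
    unfolding cosh_moment_def
    by (subst set_integral_diff(2)[OF set_integrable_mult_right set_integrable_mult_right, OF i1])
       (simp only: set_integral_mult_right)
  finally show ?thesis by simp
qed

lemma bessel_K_nonneg: "bessel_K w x \<ge> 0"
  unfolding bessel_K_def set_lebesgue_integral_def
  by (rule integral_nonneg_AE) (auto simp: indicator_def)

lemma borel_measurable_bessel_K [measurable]: "bessel_K w \<in> borel_measurable borel"
  unfolding bessel_K_def[abs_def] set_lebesgue_integral_def cosh_def by measurable

lemma nn_integral_power_exp:
  fixes b :: real
  assumes b: "b > 0"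
  shows "(\<integral>\<^sup>+s. ennreal (s ^ k * exp (- (b * s))) * indicator {0<..} s \<partial>lborel) = ennreal (fact k / b ^ (k + 1))"
proof -
  have "(\<integral>\<^sup>+s. ennreal (s ^ k * exp (- (b * s))) * indicator {0<..} s \<partial>lborel)
      = (\<integral>\<^sup>+s. ennreal (fact k / b ^ (k + 1)) * ennreal (erlang_density k b s) \<partial>lborel)"
  proof (rule nn_integral_cong_AE)
    show "AE s in lborel. ennreal (s ^ k * exp (- (b * s))) * indicator {0<..} s
        = ennreal (fact k / b ^ (k + 1)) * ennreal (erlang_density k b s)"
      using AE_lborel_singleton[of 0]
      by eventually_elim
        (use b in \<open>auto simp: erlang_density_def ennreal_mult'[symmetric] field_simps split: split_indicator\<close>)
  qed
  also have "\<dots> = ennreal (fact k / b ^ (k + 1)) * (\<integral>\<^sup>+s. ennreal (erlang_density k b s) \<partial>lborel)"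
    by (rule nn_integral_cmult) auto
  also have "(\<integral>\<^sup>+s. ennreal (erlang_density k b s) \<partial>lborel) = 1"
    using nn_integral_erlang_ith_moment[OF b, of k 0] by simp
  finally show ?thesis by simp
qed

text \<open>Inserting the integral representation of \<open>K\<^sub>v\<close> and exchanging the integrals leaves a Gamma
integral in \<open>s\<close>. The representation is a Bochner integral, whose value is \<open>0\<close> by convention when the
integrand is not integrable; finiteness of the double integral shows that this happens for almost
no \<open>s\<close>.\<close>

lemma bessel_K_mellin:
  fixes c :: real
  assumes c: "c > 0" and k: "v < k + 1"
  shows "(\<integral>\<^sup>+s. ennreal (s ^ k * bessel_K (real v) (c * s)) * indicator {0<..} s \<partial>lborel)
         = ennreal (fact k / c ^ (k + 1) * cosh_moment v (k + 1))"
proof -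
  let ?h = "\<lambda>s t::real. ennreal (exp (- (c * s) * cosh t) * cosh (real v * t)) * indicator {0<..} t"
  let ?in = "\<lambda>s. \<integral>\<^sup>+t. ?h s t \<partial>lborel"
  have [measurable]: "(cosh :: real \<Rightarrow> real) \<in> borel_measurable borel"
    unfolding cosh_def[abs_def] by measurable
  have K: "bessel_K (real v) (c * s) = enn2real (?in s)" for s
    unfolding bessel_K_def set_lebesgue_integral_def
    by (subst integral_eq_nn_integral)
       (auto simp: indicator_def intro!: arg_cong[where f = enn2real] nn_integral_cong)
  have swap: "(\<integral>\<^sup>+s. ennreal (s ^ k) * indicator {0<..} s * ?in s \<partial>lborel)
     = ennreal (fact k / c ^ (k + 1) * cosh_moment v (k + 1))"
  proof -
    have "(\<integral>\<^sup>+s. ennreal (s ^ k) * indicator {0<..} s * ?in s \<partial>lborel)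
        = (\<integral>\<^sup>+s. \<integral>\<^sup>+t. ennreal (s ^ k) * indicator {0<..} s * ?h s t \<partial>lborel \<partial>lborel)"
      by (intro nn_integral_cong nn_integral_cmult[symmetric]) measurable
    also have "\<dots> = (\<integral>\<^sup>+t. \<integral>\<^sup>+s. ennreal (s ^ k) * indicator {0<..} s * ?h s t \<partial>lborel \<partial>lborel)"
      by (rule lborel_pair.Fubini') measurable
    also have "\<dots> = (\<integral>\<^sup>+t. ennreal (cosh (real v * t)) * indicator {0<..} t *
         (\<integral>\<^sup>+s. ennreal (s ^ k * exp (- ((c * cosh t) * s))) * indicator {0<..} s \<partial>lborel) \<partial>lborel)"
      by (subst nn_integral_cmult[symmetric])
         (auto intro!: nn_integral_cong simp: ennreal_mult'[symmetric] ac_simps split: split_indicator)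
    also have "\<dots> = (\<integral>\<^sup>+t. ennreal (fact k / c ^ (k + 1)) *
         ennreal (indicator {0<..} t *\<^sub>R (cosh (real v * t) / cosh t ^ (k + 1))) \<partial>lborel)"
      using c by (intro nn_integral_cong, subst nn_integral_power_exp)
        (auto simp: ennreal_mult'[symmetric] power_mult_distrib cosh_real_pos ac_simps split: split_indicator)
    also have "\<dots> = ennreal (fact k / c ^ (k + 1)) *
         (\<integral>\<^sup>+t. ennreal (indicator {0<..} t *\<^sub>R (cosh (real v * t) / cosh t ^ (k + 1))) \<partial>lborel)"
      by (rule nn_integral_cmult) measurable
    also have "(\<integral>\<^sup>+t. ennreal (indicator {0<..} t *\<^sub>R (cosh (real v * t) / cosh t ^ (k + 1))) \<partial>lborel)
        = ennreal (cosh_moment v (k + 1))"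
      unfolding cosh_moment_def set_lebesgue_integral_def
      by (rule nn_integral_eq_integral) (use cosh_ratio_integrable[OF k] in \<open>auto simp: set_integrable_def indicator_def\<close>)
    also have "ennreal (fact k / c ^ (k + 1)) * ennreal (cosh_moment v (k + 1))
        = ennreal (fact k / c ^ (k + 1) * cosh_moment v (k + 1))"
      using c by (subst ennreal_mult') (auto intro!: divide_nonneg_nonneg)
    finally show ?thesis .
  qed
  have "AE s in lborel. ennreal (s ^ k) * indicator {0<..} s * ?in s \<noteq> \<infinity>"
    by (rule nn_integral_noteq_infinite) (measurable, unfold swap, simp)
  then have "(\<integral>\<^sup>+s. ennreal (s ^ k * bessel_K (real v) (c * s)) * indicator {0<..} s \<partial>lborel)
      = (\<integral>\<^sup>+s. ennreal (s ^ k) * indicator {0<..} s * ?in s \<partial>lborel)"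
  proof (intro nn_integral_cong_AE, elim AE_mp, intro AE_I2 impI)
    fix s :: real
    assume fin: "ennreal (s ^ k) * indicator {0<..} s * ?in s \<noteq> \<infinity>"
    show "ennreal (s ^ k * bessel_K (real v) (c * s)) * indicator {0<..} s
        = ennreal (s ^ k) * indicator {0<..} s * ?in s"
    proof (cases "s > 0")
      case True
      then have "?in s \<noteq> \<infinity>"
        using fin by (auto simp: ennreal_mult_eq_top_iff ennreal_eq_0_iff not_le)
      then have "ennreal (bessel_K (real v) (c * s)) = ?in s"
        by (simp add: K less_top)
      then show ?thesis using True by (simp add: ennreal_mult')
    qed simp
  qed
  then show ?thesis unfolding swap .
qed

section \<open>Lebesgue measure on the complex plane\<close>

lemma borel_measurable_Complex [measurable]:
  assumes [measurable]: "f \<in> borel_measurable M" "g \<in> borel_measurable M"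
  shows "(\<lambda>w. Complex (f w) (g w)) \<in> borel_measurable M"
  unfolding Complex_eq by measurable

text \<open>Transfers Fubini's theorem from the product of two real lines to the complex plane.\<close>

lemma lborel_complex_eq_distr_pair:
  "(lborel :: complex measure) = distr (lborel \<Otimes>\<^sub>M lborel) borel (\<lambda>(x, y). Complex x y)"
proof (rule lborel_eqI)
  fix l u :: complex
  assume lu: "\<And>b. b \<in> Basis \<Longrightarrow> l \<bullet> b \<le> u \<bullet> b"
  have le: "Re l \<le> Re u" "Im l \<le> Im u"
    using lu[of 1] lu[of \<i>] by (auto simp: Basis_complex_def)
  have "emeasure (distr (lborel \<Otimes>\<^sub>M lborel) borel (\<lambda>(x, y). Complex x y)) (box l u)
      = emeasure (lborel \<Otimes>\<^sub>M lborel) ({Re l<..<Re u} \<times> {Im l<..<Im u})"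
    by (subst emeasure_distr)
       (auto intro!: arg_cong[where f = "emeasure _"] simp: box_def Basis_complex_def space_pair_measure)
  also have "\<dots> = ennreal (Re u - Re l) * ennreal (Im u - Im l)"
    using le by (subst lborel.emeasure_pair_measure_Times) auto
  also have "\<dots> = (\<Prod>b\<in>Basis. (u - l) \<bullet> b)"
    using le by (simp add: Basis_complex_def ennreal_mult')
  finally show "emeasure (distr (lborel \<Otimes>\<^sub>M lborel) borel (\<lambda>(x, y). Complex x y)) (box l u)
      = (\<Prod>b\<in>Basis. (u - l) \<bullet> b)" .
qed simp

lemma nn_integral_lborel_complex:
  fixes f :: "complex \<Rightarrow> ennreal"
  assumes [measurable]: "f \<in> borel_measurable borel"
  shows "(\<integral>\<^sup>+z. f z \<partial>lborel) = (\<integral>\<^sup>+x. \<integral>\<^sup>+y. f (Complex x y) \<partial>lborel \<partial>lborel)"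
    and "(\<integral>\<^sup>+z. f z \<partial>lborel) = (\<integral>\<^sup>+y. \<integral>\<^sup>+x. f (Complex x y) \<partial>lborel \<partial>lborel)"
proof -
  show 1: "(\<integral>\<^sup>+z. f z \<partial>lborel) = (\<integral>\<^sup>+x. \<integral>\<^sup>+y. f (Complex x y) \<partial>lborel \<partial>lborel)"
    by (subst lborel_complex_eq_distr_pair, subst nn_integral_distr)
       (auto simp: lborel.nn_integral_fst[symmetric])
  also have "\<dots> = (\<integral>\<^sup>+y. \<integral>\<^sup>+x. f (Complex x y) \<partial>lborel \<partial>lborel)"
    by (rule lborel_pair.Fubini') measurable
  finally show "(\<integral>\<^sup>+z. f z \<partial>lborel) = (\<integral>\<^sup>+y. \<integral>\<^sup>+x. f (Complex x y) \<partial>lborel \<partial>lborel)" .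
qed

lemma nn_integral_shear:
  fixes f :: "complex \<Rightarrow> ennreal"
  assumes [measurable]: "f \<in> borel_measurable borel"
  shows "(\<integral>\<^sup>+z. f (Complex (Re z + a * Im z) (Im z)) \<partial>lborel) = (\<integral>\<^sup>+z. f z \<partial>lborel)"
    and "(\<integral>\<^sup>+z. f (Complex (Re z) (Im z + a * Re z)) \<partial>lborel) = (\<integral>\<^sup>+z. f z \<partial>lborel)"
proof -
  have "(\<integral>\<^sup>+x. f (Complex (x + a * y) y) \<partial>lborel) = (\<integral>\<^sup>+x. f (Complex x y) \<partial>lborel)" for y
    using nn_integral_real_affine[of "\<lambda>x. f (Complex x y)" 1 "a * y"] by (simp add: add.commute)
  then show "(\<integral>\<^sup>+z. f (Complex (Re z + a * Im z) (Im z)) \<partial>lborel) = (\<integral>\<^sup>+z. f z \<partial>lborel)"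
    by (simp add: nn_integral_lborel_complex(2))
  have "(\<integral>\<^sup>+y. f (Complex x (y + a * x)) \<partial>lborel) = (\<integral>\<^sup>+y. f (Complex x y) \<partial>lborel)" for x
    using nn_integral_real_affine[of "\<lambda>y. f (Complex x y)" 1 "a * x"] by (simp add: add.commute)
  then show "(\<integral>\<^sup>+z. f (Complex (Re z) (Im z + a * Re z)) \<partial>lborel) = (\<integral>\<^sup>+z. f z \<partial>lborel)"
    by (simp add: nn_integral_lborel_complex(1))
qed

text \<open>Such a rotation is a horizontal, a vertical and again a horizontal shear, and shears preserve
Lebesgue measure by Fubini and translation invariance. The first shear has coefficient
\<open>(Re c - 1) / Im c\<close>, hence the condition on \<open>Im c\<close>.\<close>

lemma lborel_distr_rotation:
  assumes c: "cmod c = 1" "Im c \<noteq> 0"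
  shows "distr lborel borel (\<lambda>z. c * z) = lborel"
proof (rule measure_eqI)
  fix X assume "X \<in> sets (distr lborel borel (\<lambda>z. c * z))"
  then have [measurable]: "X \<in> sets borel" by simp
  define b where "b = Im c"
  define a where "a = (Re c - 1) / Im c"
  have ab: "a * b = Re c - 1" using c by (simp add: a_def b_def)
  have "(Re c)\<^sup>2 + (Im c)\<^sup>2 = 1" using c(1) by (simp add: cmod_def)
  then have sq: "(Re c - 1) * (Re c + 1) = - (Im c * Im c)" by (simp add: power2_eq_square algebra_simps)
  have "a * (Re c + 1) = (Re c - 1) * (Re c + 1) / Im c" by (simp add: a_def)
  also have "\<dots> = - Im c" unfolding sq using c by simp
  finally have a2: "a * (Re c + 1) = - Im c" .
  let ?S = "\<lambda>z. Complex (Re z + a * Im z) (Im z)"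
  let ?T = "\<lambda>z. Complex (Re z) (Im z + b * Re z)"
  have rot: "?S (?T (?S z)) = c * z" for z
  proof (rule complex_eqI)
    have "Re (?S (?T (?S z))) = Re z * (1 + a * b) + a * (1 + (a * b + 1)) * Im z"
      by (simp add: algebra_simps)
    also have "\<dots> = Re z * Re c + a * (Re c + 1) * Im z" unfolding ab by (simp add: algebra_simps)
    finally show "Re (?S (?T (?S z))) = Re (c * z)" unfolding a2 by (simp add: algebra_simps)
    have "Im (?S (?T (?S z))) = b * Re z + (1 + a * b) * Im z"
      by (simp add: algebra_simps)
    then show "Im (?S (?T (?S z))) = Im (c * z)" unfolding ab by (simp add: b_def)
  qed
  have "emeasure (distr lborel borel (\<lambda>z. c * z)) X = (\<integral>\<^sup>+z. indicator X (c * z) \<partial>lborel)"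
    by (subst nn_integral_indicator[symmetric], simp, subst nn_integral_distr) auto
  also have "\<dots> = (\<integral>\<^sup>+z. indicator X (?S (?T (?S z))) \<partial>lborel)" unfolding rot ..
  also have "\<dots> = (\<integral>\<^sup>+z. indicator X (?S (?T z)) \<partial>lborel)"
    by (rule nn_integral_shear(1)[of "\<lambda>z. indicator X (?S (?T z))"]) measurable
  also have "\<dots> = (\<integral>\<^sup>+z. indicator X (?S z) \<partial>lborel)"
    by (rule nn_integral_shear(2)[of "\<lambda>z. indicator X (?S z)"]) measurable
  also have "\<dots> = (\<integral>\<^sup>+z. indicator X z \<partial>lborel)"
    by (rule nn_integral_shear(1)) measurable
  finally show "emeasure (distr lborel borel (\<lambda>z. c * z)) X = emeasure lborel X" by simp
qed simp

text \<open>Rotating by the angle \<open>\<pi> / (2 (a - b))\<close> changes the sign of the integrand and preserves the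
integral.\<close>

lemma angular_orthogonality:
  fixes g :: "real \<Rightarrow> real"
  assumes [measurable]: "g \<in> borel_measurable borel" and ab: "a \<noteq> b"
  shows "(\<integral>z. z ^ (2 * a) * cnj z ^ (2 * b) * of_real (g (cmod z)) \<partial>lborel) = 0"
proof -
  define \<theta> where "\<theta> = pi / (2 * (real a - real b))"
  define c where "c = cis \<theta>"
  have "c ^ (2 * a) * cnj c ^ (2 * b) = cis (2 * (real a - real b) * \<theta>)"
    unfolding c_def cis_cnj Complex.DeMoivre cis_mult by (intro arg_cong[where f = cis]) (simp add: algebra_simps)
  also have "2 * (real a - real b) * \<theta> = pi" using ab by (simp add: \<theta>_def)
  finally have m1: "c ^ (2 * a) * cnj c ^ (2 * b) = -1" by simp
  have nc: "cmod c = 1" by (simp add: c_def)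
  have "Im c \<noteq> 0"
  proof
    assume im: "Im c = 0"
    then have "cnj c = c" "c = of_real (Re c)" by (auto simp: complex_eq_iff)
    moreover have "\<bar>Re c\<bar> = 1" using nc im by (simp add: cmod_def)
    then have "Re c = 1 \<or> Re c = -1" by arith
    ultimately have "cnj c = c" "c ^ 2 = 1" by (metis of_real_1 power2_eq_1_iff of_real_minus)+
    then have "c ^ (2 * a) * cnj c ^ (2 * b) = 1" by (simp only: power_mult power_one mult_1)
    with m1 show False by simp
  qed
  note rot = lborel_distr_rotation[OF nc this]
  let ?h = "\<lambda>z. z ^ (2 * a) * cnj z ^ (2 * b) * of_real (g (cmod z))"
  have [measurable]: "cnj \<in> borel_measurable borel"
    by (intro borel_measurable_continuous_onI continuous_on_cnj continuous_on_id)
  have "(\<integral>z. ?h z \<partial>lborel) = (\<integral>z. ?h z \<partial>(distr lborel borel (\<lambda>z. c * z)))" unfolding rot ..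
  also have "\<dots> = (\<integral>z. ?h (c * z) \<partial>lborel)" by (rule integral_distr) measurable
  also have "\<dots> = (\<integral>z. - ?h z \<partial>lborel)"
  proof (rule Bochner_Integration.integral_cong[OF refl])
    fix z
    have "?h (c * z) = (c ^ (2 * a) * cnj c ^ (2 * b)) * ?h z"
      using nc by (simp add: power_mult_distrib norm_mult mult_ac)
    then show "?h (c * z) = - ?h z" unfolding m1 by simp
  qed
  finally have "(\<integral>z. ?h z \<partial>lborel) = - (\<integral>z. ?h z \<partial>lborel)" by simp
  then have "(\<integral>z. ?h z \<partial>lborel) + (\<integral>z. ?h z \<partial>lborel) = 0" by (simp only: eq_neg_iff_add_eq_0)
  then show ?thesis by (simp only: mult_2[symmetric]) simp
qed

text \<open>The half-plane is not invariant under rotations. The integrands below are even in \<open>z\<close>, which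
allows replacing it by the whole plane.\<close>

lemma integral_half_plane_even:
  fixes h :: "complex \<Rightarrow> complex"
  assumes int: "integrable lborel h" and even: "\<And>z. h (- z) = h z"
  shows "(\<integral>z. indicator {z. Re z > 0} z *\<^sub>R h z \<partial>lborel) = (1 / 2) * (\<integral>z. h z \<partial>lborel)"
proof -
  let ?P = "{z. Re z > 0}" and ?N = "{z. Re z < 0}"
  have [measurable]: "h \<in> borel_measurable borel" using int by auto
  have [measurable]: "?P \<in> sets borel" "?N \<in> sets borel" by measurable
  have "negligible {z::complex. z \<bullet> 1 = 0}" by (rule negligible_standard_hyperplane) (simp add: Basis_complex_def)
  then have "{z. Re z = 0} \<in> null_sets lebesgue" by (simp add: negligible_iff_null_sets)
  then have "AE z in lebesgue. Re z \<noteq> 0" by (auto dest!: AE_not_in)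
  then have AE: "AE z in lborel. Re z \<noteq> (0::real)"
    by (subst (asm) AE_completion_iff) auto
  have i: "integrable lborel (\<lambda>z. indicator ?P z *\<^sub>R h z)" "integrable lborel (\<lambda>z. indicator ?N z *\<^sub>R h z)"
    by (auto intro!: integrable_mult_indicator int)
  have neg: "distr lborel borel (\<lambda>z. - z) = (lborel :: complex measure)"
    using lborel_affine[of "-1" "0::complex"] by (simp add: density_1)
  have "(\<integral>z. h z \<partial>lborel) = (\<integral>z. indicator ?P z *\<^sub>R h z + indicator ?N z *\<^sub>R h z \<partial>lborel)"
    by (rule integral_cong_AE) (use AE in \<open>auto simp: indicator_def not_less_iff_gr_or_eq\<close>)
  also have "\<dots> = (\<integral>z. indicator ?P z *\<^sub>R h z \<partial>lborel) + (\<integral>z. indicator ?N z *\<^sub>R h z \<partial>lborel)"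
    by (rule Bochner_Integration.integral_add[OF i])
  also have "(\<integral>z. indicator ?N z *\<^sub>R h z \<partial>lborel)
      = (\<integral>z. indicator ?N z *\<^sub>R h z \<partial>(distr lborel borel (\<lambda>z. - z)))" unfolding neg ..
  also have "\<dots> = (\<integral>z. indicator ?N (- z) *\<^sub>R h (- z) \<partial>lborel)"
    by (rule integral_distr) measurable
  also have "\<dots> = (\<integral>z. indicator ?P z *\<^sub>R h z \<partial>lborel)"
    by (rule Bochner_Integration.integral_cong) (auto simp: even indicator_def)
  finally show ?thesis by simp
qed

text \<open>Polar coordinates in the form needed here: a disc of squared radius \<open>a\<close> has area \<open>\<pi> a\<close>.\<close>

lemma distr_cmod_square:
  "distr lborel borel (\<lambda>z. (cmod z)\<^sup>2) = density lborel (\<lambda>s. ennreal pi * indicator {0<..} s)"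
proof (rule measure_eqI_generator_eq)
  let ?E = "range (\<lambda>a::real. {..a})"
  have E: "sets borel = sigma_sets UNIV ?E" 
    by (subst borel_eq_atMost) (rule sets_measure_of, simp)
  show "Int_stable ?E" by (auto simp: Int_stable_def)
  show "?E \<subseteq> Pow UNIV" by simp
  show "sets (distr lborel borel (\<lambda>z. (cmod z)\<^sup>2)) = sigma_sets UNIV ?E"
    "sets (density lborel (\<lambda>s. ennreal pi * indicator {0<..} s)) = sigma_sets UNIV ?E"
    using E by auto
  have *: "emeasure (distr lborel borel (\<lambda>z. (cmod z)\<^sup>2)) {..a} = ennreal (pi * max 0 a)" for a :: real
  proof (cases "a \<ge> 0")
    case True
    have "emeasure (distr lborel borel (\<lambda>z. (cmod z)\<^sup>2)) {..a} = emeasure lborel (cball (0::complex) (sqrt a))"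
    proof (subst emeasure_distr)
      have "(cmod z)\<^sup>2 \<le> a \<longleftrightarrow> cmod z \<le> sqrt a" for z
        using True real_sqrt_le_iff[of "(cmod z)\<^sup>2" a] by simp
      then have "(\<lambda>z. (cmod z)\<^sup>2) -` {..a} = cball 0 (sqrt a)" by (auto simp: dist_norm)
      then show "emeasure lborel ((\<lambda>z. (cmod z)\<^sup>2) -` {..a} \<inter> space lborel) = emeasure lborel (cball (0::complex) (sqrt a))"
        by simp
    qed simp_all
    then show ?thesis using True by (simp add: emeasure_cball unit_ball_vol_2)
  next
    case False
    then have "(\<lambda>z. (cmod z)\<^sup>2) -` {..a} = {}"
      by (auto simp: not_le) (smt (verit) zero_le_power2)
    then show ?thesis using False by (simp add: emeasure_distr)
  qed
  have **: "emeasure (density lborel (\<lambda>s. ennreal pi * indicator {0<..} s)) {..a} = ennreal (pi * max 0 a)" for a :: real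
  proof -
    have "emeasure (density lborel (\<lambda>s. ennreal pi * indicator {0<..} s)) {..a}
        = (\<integral>\<^sup>+s. ennreal pi * indicator {0<..a} s \<partial>lborel)"
      by (subst emeasure_density) (auto intro!: nn_integral_cong simp: indicator_def)
    also have "\<dots> = ennreal pi * emeasure lborel {0<..a}"
      by (rule nn_integral_cmult_indicator) simp
    also have "\<dots> = ennreal (pi * max 0 a)"
      by (cases "a \<ge> 0") (auto simp: ennreal_mult' max_def)
    finally show ?thesis .
  qed
  show "emeasure (distr lborel borel (\<lambda>z. (cmod z)\<^sup>2)) X
      = emeasure (density lborel (\<lambda>s. ennreal pi * indicator {0<..} s)) X" if "X \<in> ?E" for X
    using that * ** by auto
  show "range (\<lambda>i::nat. {..real i}) \<subseteq> ?E" by auto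
  show "(\<Union>i::nat. {..real i}) = UNIV" by (auto simp: real_arch_simple)
  show "emeasure (distr lborel borel (\<lambda>z. (cmod z)\<^sup>2)) {..real i} \<noteq> \<infinity>" for i unfolding * by simp
qed

lemma nn_integral_cmod_square:
  fixes f :: "real \<Rightarrow> ennreal"
  assumes [measurable]: "f \<in> borel_measurable borel"
  shows "(\<integral>\<^sup>+z. f ((cmod z)\<^sup>2) \<partial>lborel) = ennreal pi * (\<integral>\<^sup>+s. f s * indicator {0<..} s \<partial>lborel)"
proof -
  have "(\<integral>\<^sup>+z. f ((cmod z)\<^sup>2) \<partial>lborel) = (\<integral>\<^sup>+s. f s \<partial>(distr lborel borel (\<lambda>z. (cmod z)\<^sup>2)))"
    by (rule nn_integral_distr[symmetric]) measurable
  also have "\<dots> = (\<integral>\<^sup>+s. ennreal pi * (f s * indicator {0<..} s) \<partial>lborel)"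
    unfolding distr_cmod_square by (subst nn_integral_density) (auto intro!: nn_integral_cong simp: mult_ac)
  also have "\<dots> = ennreal pi * (\<integral>\<^sup>+s. f s * indicator {0<..} s \<partial>lborel)"
    by (rule nn_integral_cmult) measurable
  finally show ?thesis .
qed

section \<open>Vandermonde products as alternating sums\<close>

text \<open>The Leibniz expansion of the determinant with entries \<open>x\<^sub>i^(j - 1)\<close>, where \<open>i\<close> and \<open>j\<close> run from \<open>1\<close>
to \<open>n\<close>.\<close>

definition alternant :: "nat \<Rightarrow> (nat \<Rightarrow> 'a) \<Rightarrow> 'a :: {idom, ring_char_0}" where
  "alternant n x = (\<Sum>\<sigma> | \<sigma> permutes {1..n}. of_int (sign \<sigma>) * (\<Prod>i\<in>{1..n}. x i ^ (\<sigma> i - 1)))"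

text \<open>Composing with the transposition of \<open>a\<close> and \<open>b\<close> flips every sign and leaves every monomial
unchanged, so the sum equals its own negative.\<close>

lemma alternant_eq_0:
  assumes ab: "a \<in> {1..n}" "b \<in> {1..n}" "a \<noteq> b" and x: "x a = x b"
  shows "alternant n x = 0"
proof -
  let ?t = "Transposition.transpose a b"
  let ?f = "\<lambda>\<sigma>. of_int (sign \<sigma>) * (\<Prod>i\<in>{1..n}. x i ^ (\<sigma> i - 1))"
  have t: "?t permutes {1..n}" using ab by (intro permutes_swap_id)
  have "?f (\<sigma> \<circ> ?t) = - ?f \<sigma>" if \<sigma>: "\<sigma> permutes {1..n}" for \<sigma>
  proof -
    have "sign (\<sigma> \<circ> ?t) = - sign \<sigma>"
      using ab sign_compose[OF permutes_imp_permutation[OF _ \<sigma>] permutes_imp_permutation[OF _ t]]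
      by (simp add: sign_swap_id)
    moreover have "(\<Prod>i\<in>{1..n}. x i ^ ((\<sigma> \<circ> ?t) i - 1)) = (\<Prod>i\<in>{1..n}. x i ^ (\<sigma> i - 1))"
    proof -
      have "(\<Prod>i\<in>{1..n}. x i ^ ((\<sigma> \<circ> ?t) i - 1)) = (\<Prod>i\<in>{1..n}. x (?t i) ^ ((\<sigma> \<circ> ?t) (?t i) - 1))"
        using prod.permute[OF t, of "\<lambda>i. x i ^ ((\<sigma> \<circ> ?t) i - 1)"] by (simp add: o_def)
      also have "\<dots> = (\<Prod>i\<in>{1..n}. x i ^ (\<sigma> i - 1))"
      proof (rule prod.cong[OF refl])
        fix i
        have "x (?t i) = x i" using x by (auto simp: Transposition.transpose_def)
        then show "x (?t i) ^ ((\<sigma> \<circ> ?t) (?t i) - 1) = x i ^ (\<sigma> i - 1)" by simp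
      qed
      finally show ?thesis .
    qed
    ultimately show ?thesis by simp
  qed
  note f_swap = this
  have "alternant n x = (\<Sum>\<sigma> | \<sigma> permutes {1..n}. - ?f (\<sigma> \<circ> ?t))"
    unfolding alternant_def by (rule sum.cong[OF refl]) (simp only: mem_Collect_eq f_swap minus_minus)
  also have "\<dots> = (\<Sum>\<sigma> | \<sigma> permutes {1..n}. - ?f \<sigma>)"
    by (rule sum.reindex_bij_witness[where i = "\<lambda>\<sigma>. \<sigma> \<circ> ?t" and j = "\<lambda>\<sigma>. \<sigma> \<circ> ?t"])
       (use permutes_compose[OF t] in \<open>simp_all add: comp_assoc\<close>)
  also have "\<dots> = - alternant n x" by (simp add: alternant_def sum_negf)
  finally have "alternant n x + alternant n x = 0" by (simp only: eq_neg_iff_add_eq_0)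
  then show ?thesis by (simp only: mult_2[symmetric]) simp
qed

text \<open>By induction: as a polynomial in the last variable the alternant has degree at most \<open>n\<close>, vanishes
at the \<open>n\<close> earlier points, and its top coefficient is the alternant of the earlier points. If two of
these coincide, both sides are zero.\<close>

lemma vandermonde_alternant:
  fixes x :: "nat \<Rightarrow> 'a :: {idom, ring_char_0}"
  shows "(\<Prod>k\<in>{1..n}. \<Prod>j\<in>{1..<k}. x k - x j) = alternant n x"
proof (induction n)
  case 0
  show ?case by (simp add: alternant_def)
next
  case (Suc n)
  let ?V = "\<lambda>n. \<Prod>k\<in>{1..n}. \<Prod>j\<in>{1..<k}. x k - x j"
  show ?case
  proof (cases "inj_on x {1..n}")
    case False
    then obtain a b where ab: "a \<in> {1..n}" "b \<in> {1..n}" "a < b" "x a = x b"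
      unfolding inj_on_def by (metis nat_neq_iff)
    then have z: "(\<Prod>j\<in>{1..<b}. x b - x j) = 0" by (auto intro!: prod_zero bexI[of _ a])
    have "?V (Suc n) = 0"
      by (rule prod_zero, simp, rule bexI[of _ b], rule z) (use ab in simp)
    moreover have "alternant (Suc n) x = 0" using ab by (intro alternant_eq_0[of a _ b]) auto
    ultimately show ?thesis by simp
  next
    case inj: True
    let ?S = "{\<sigma>. \<sigma> permutes {1..Suc n}}"
    have fin: "finite ?S" by (simp add: finite_permutations)
    let ?c = "\<lambda>\<sigma>. of_int (sign \<sigma>) * (\<Prod>i\<in>{1..n}. x i ^ (\<sigma> i - 1))"
    define p where "p = (\<Sum>\<sigma>\<in>?S. monom (?c \<sigma>) (\<sigma> (Suc n) - 1))"
    have le: "\<sigma> (Suc n) \<in> {1..Suc n}" if "\<sigma> \<in> ?S" for \<sigma>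
      using that permutes_in_image[of \<sigma> "{1..Suc n}" "Suc n"] by simp
    have p: "poly p y = alternant (Suc n) (x(Suc n := y))" for y
      unfolding p_def alternant_def poly_sum
      by (intro sum.cong) (auto simp: poly_monom atLeastAtMostSuc_conv mult_ac intro!: arg_cong2[where f = "(*)"] prod.cong)
    have degp: "degree p \<le> n"
      unfolding p_def using le by (intro degree_sum_le fin) (fastforce intro!: order_trans[OF degree_monom_le])
    have "{\<sigma>\<in>?S. \<sigma> (Suc n) = Suc n} = {\<sigma>. \<sigma> permutes {1..n}}"
    proof (intro set_eqI iffI; clarsimp)
      fix \<sigma> assume "\<sigma> permutes {Suc 0..Suc n}" "\<sigma> (Suc n) = Suc n"
      then show "\<sigma> permutes {Suc 0..n}" by (auto intro!: permutes_superset[of \<sigma> "{Suc 0..Suc n}"] simp: le_Suc_eq)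
    next
      fix \<sigma> assume \<sigma>: "\<sigma> permutes {Suc 0..n}"
      then show "\<sigma> permutes {Suc 0..Suc n} \<and> \<sigma> (Suc n) = Suc n"
        by (auto intro: permutes_subset[OF \<sigma>] permutes_not_in[OF \<sigma>])
    qed
    then have "alternant n x = (\<Sum>\<sigma>\<in>{\<sigma>\<in>?S. \<sigma> (Suc n) = Suc n}. ?c \<sigma>)"
      unfolding alternant_def by simp
    also have "\<dots> = (\<Sum>\<sigma>\<in>?S. if \<sigma> (Suc n) = Suc n then ?c \<sigma> else 0)"
      by (rule sum.inter_filter[OF fin])
    also have "\<dots> = coeff p n"
      unfolding p_def coeff_sum using le by (intro sum.cong) (fastforce simp: coeff_monom)+
    finally have cp: "coeff p n = ?V n" using Suc.IH by simp
    define r where "r = (\<Prod>j\<in>{1..n}. [:- x j, 1:])"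
    have degr: "degree r = n" unfolding r_def by (subst degree_prod_eq_sum_degree) auto
    have "lead_coeff r = 1" unfolding r_def lead_coeff_prod by simp
    then have cr: "coeff r n = 1" by (simp add: degr)
    \<comment> \<open>A polynomial of degree below \<open>n\<close> with \<open>n\<close> distinct roots.\<close>
    define q where "q = p - smult (?V n) r"
    have "q = 0"
    proof (rule ccontr)
      assume q: "q \<noteq> 0"
      have "degree q \<le> n" unfolding q_def using degp degr by (intro degree_diff_le) (auto intro: order_trans[OF degree_smult_le])
      moreover have "coeff q n = 0" by (simp add: q_def cp cr)
      ultimately have "degree q < n \<or> n = 0 \<and> degree q = 0"
        using q by (metis leading_coeff_0_iff le_neq_implies_less)
      with \<open>coeff q n = 0\<close> have dq: "degree q < n" using q by (metis leading_coeff_0_iff)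
      have "x ` {1..n} \<subseteq> {y. poly q y = 0}"
      proof clarsimp
        fix i assume i: "Suc 0 \<le> i" "i \<le> n"
        have "poly p (x i) = 0" unfolding p using i by (intro alternant_eq_0[of i _ "Suc n"]) auto
        moreover have "poly r (x i) = 0" unfolding r_def poly_prod using i by (auto intro!: prod_zero bexI[of _ i])
        ultimately show "poly q (x i) = 0" by (simp add: q_def)
      qed
      then have "card (x ` {1..n}) \<le> card {y. poly q y = 0}"
        using poly_roots_finite[OF q] by (intro card_mono)
      also have "\<dots> \<le> degree q" using q by (rule card_poly_roots_bound)
      finally show False using dq card_image[OF inj] by simp
    qed
    then have "poly p (x (Suc n)) = ?V n * poly r (x (Suc n))" by (simp add: q_def)
    also have "poly r (x (Suc n)) = (\<Prod>j\<in>{1..n}. x (Suc n) - x j)" by (simp add: r_def poly_prod)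
    finally have "alternant (Suc n) x = ?V n * (\<Prod>j\<in>{1..n}. x (Suc n) - x j)" unfolding p by simp
    then show ?thesis by (simp add: atLeastLessThanSuc_atLeastAtMost)
  qed
qed

section \<open>Independence of the moduli\<close>

text \<open>The weight of a single particle in terms of \<open>s = \<bar>z\<bar>\<^sup>2\<close>.\<close>

definition radial_weight :: "nat \<Rightarrow> nat \<Rightarrow> real \<Rightarrow> real" where
  "radial_weight n v s = s ^ (v + 1) * bessel_K (real v) (2 * real n * s)"

text \<open>For \<open>k = 2 (j - 1)\<close> this is the unnormalised law of the \<open>j\<close>-th of the independent variables
that replace the squared moduli. Two powers of \<open>s\<close> separate consecutive indices, because the Vandermonde product is formed from
the \<open>z\<^sub>j\<^sup>2\<close>.\<close>

definition radial_mass :: "nat \<Rightarrow> nat \<Rightarrow> nat \<Rightarrow> real set \<Rightarrow> real" where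
  "radial_mass n v k B = (LBINT s:{0<..}. indicator B s * (s ^ k * radial_weight n v s))"

lemma borel_measurable_radial_weight [measurable]: "radial_weight n v \<in> borel_measurable borel"
  unfolding radial_weight_def[abs_def] by measurable

lemma radial_weight_nonneg: "s \<ge> 0 \<Longrightarrow> radial_weight n v s \<ge> 0"
  unfolding radial_weight_def by (intro mult_nonneg_nonneg bessel_K_nonneg) auto

lemma nn_integral_radial_weight:
  assumes "n \<ge> 1"
  shows "(\<integral>\<^sup>+s. ennreal (s ^ k * radial_weight n v s) * indicator {0<..} s \<partial>lborel)
     = ennreal (fact (k + v + 1) / (2 * real n) ^ (k + v + 2) * cosh_moment v (k + v + 2))"
  using bessel_K_mellin[of "2 * real n" v "k + v + 1"] assms
  by (simp add: radial_weight_def power_add mult_ac)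

lemma radial_integrable:
  assumes n: "n \<ge> 1" and [measurable]: "B \<in> sets borel"
  shows "set_integrable lborel {0<..} (\<lambda>s. indicator B s * (s ^ k * radial_weight n v s))"
proof -
  have "set_integrable lborel {0<..} (\<lambda>s. s ^ k * radial_weight n v s)"
    unfolding set_integrable_def
  proof (rule integrableI_nonneg)
    have "(\<integral>\<^sup>+s. ennreal (indicator {0<..} s *\<^sub>R (s ^ k * radial_weight n v s)) \<partial>lborel)
        = (\<integral>\<^sup>+s. ennreal (s ^ k * radial_weight n v s) * indicator {0<..} s \<partial>lborel)"
      by (intro nn_integral_cong) (auto simp: indicator_def)
    also have "\<dots> < \<infinity>" unfolding nn_integral_radial_weight[OF n] by simp
    finally show "(\<integral>\<^sup>+s. ennreal (indicator {0<..} s *\<^sub>R (s ^ k * radial_weight n v s)) \<partial>lborel) < \<infinity>" .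
  qed (auto simp: indicator_def radial_weight_nonneg)
  then show ?thesis
    by (rule set_integrable_bound)
       (auto simp: set_borel_measurable_def indicator_def)
qed

lemma nn_integral_radial_mass:
  assumes n: "n \<ge> 1" and [measurable]: "B \<in> sets borel"
  shows "(\<integral>\<^sup>+s. ennreal (indicator B s * (s ^ k * radial_weight n v s)) * indicator {0<..} s \<partial>lborel)
     = ennreal (radial_mass n v k B)"
proof -
  have "(\<integral>\<^sup>+s. ennreal (indicator B s * (s ^ k * radial_weight n v s)) * indicator {0<..} s \<partial>lborel)
      = (\<integral>\<^sup>+s. ennreal (indicator {0<..} s *\<^sub>R (indicator B s * (s ^ k * radial_weight n v s))) \<partial>lborel)"
    by (intro nn_integral_cong) (auto simp: indicator_def)
  also have "\<dots> = ennreal (radial_mass n v k B)"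
    unfolding radial_mass_def set_lebesgue_integral_def
    by (rule nn_integral_eq_integral)
       (use radial_integrable[OF assms] in \<open>auto simp: set_integrable_def indicator_def radial_weight_nonneg\<close>)
  finally show ?thesis .
qed

lemma radial_mass_nonneg: "radial_mass n v k B \<ge> 0"
  unfolding radial_mass_def set_lebesgue_integral_def
  by (rule integral_nonneg_AE) (auto simp: indicator_def radial_weight_nonneg)

lemma radial_mass_UNIV:
  assumes n: "n \<ge> 1"
  shows "radial_mass n v k UNIV
     = fact (k + v + 1) / (2 * real n) ^ (k + v + 2) * cosh_moment v (k + v + 2)"
proof -
  have "cosh_moment v (k + v + 2) > 0" by (rule cosh_moment_pos) simp
  then show ?thesis
    using nn_integral_radial_mass[OF n, of UNIV k v] nn_integral_radial_weight[OF n, of k v] radial_mass_nonneg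
    by simp
qed

lemma radial_mass_UNIV_pos: "n \<ge> 1 \<Longrightarrow> radial_mass n v k UNIV > 0"
  unfolding radial_mass_UNIV using cosh_moment_pos[of v "k + v + 2"] by simp

text \<open>The recursion for \<open>cosh_moment\<close> at \<open>m = 2 j + v\<close>, where \<open>m\<^sup>2 - v\<^sup>2 = 4 j (j + v)\<close>: the mean of
\<open>(n s)\<^sup>2\<close> under the \<open>j\<close>-th law is \<open>j (j + v)\<close>.\<close>

lemma radial_mass_UNIV_rec:
  assumes n: "n \<ge> 1" and j: "j \<ge> 1"
  shows "(real n)\<^sup>2 * radial_mass n v (2 * j) UNIV = real j * real (j + v) * radial_mass n v (2 * (j - 1)) UNIV"
proof -
  obtain i where i: "j = Suc i" using j by (cases j) auto
  define m where "m = 2 * i + v + 2"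
  define J where "J = cosh_moment v"
  have rec: "real m * (real m + 1) * J (m + 2) = ((real m)\<^sup>2 - (real v)\<^sup>2) * J m"
    unfolding J_def by (rule cosh_moment_rec) (simp add: m_def)
  have mv: "(real m)\<^sup>2 - (real v)\<^sup>2 = 4 * (real j * real (j + v))"
    by (simp add: m_def i power2_eq_square algebra_simps)
  have m1: "m \<ge> 1" by (simp add: m_def)
  have f: "fact (m + 1) = (real m + 1) * real m * fact (m - 1)"
    using m1 by (cases m) (auto simp: algebra_simps)
  have e: "2 * j + v + 1 = m + 1" "2 * j + v + 2 = m + 2" "2 * (j - 1) + v + 1 = m - 1" "2 * (j - 1) + v + 2 = m"
    by (auto simp: m_def i)
  have "(real n)\<^sup>2 * (fact (m + 1) / (2 * real n) ^ (m + 2) * J (m + 2))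
     = fact (m - 1) / (2 * real n) ^ m * (real m * (real m + 1) * J (m + 2)) / 4"
    using n unfolding f by (simp add: power_add field_simps power2_eq_square)
  also have "\<dots> = real j * real (j + v) * (fact (m - 1) / (2 * real n) ^ m * J m)"
    unfolding rec mv by simp
  finally show ?thesis unfolding radial_mass_UNIV[OF n] e J_def .
qed

context
  fixes n v :: nat and B :: "real set"
  assumes n: "n \<ge> 1" and B [measurable]: "B \<in> sets borel"
begin

private definition window_weight :: "real \<Rightarrow> real" where
  "window_weight r = indicator B (r\<^sup>2) * radial_weight n v (r\<^sup>2)"

private lemma window_weight_measurable [measurable]: "window_weight \<in> borel_measurable borel"
  unfolding window_weight_def[abs_def] by measurable

private definition plane_term :: "nat \<Rightarrow> nat \<Rightarrow> complex \<Rightarrow> complex" where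
  "plane_term a b z = z ^ (2 * a) * cnj z ^ (2 * b) * of_real (window_weight (cmod z))"

private lemma plane_term_measurable [measurable]: "plane_term a b \<in> borel_measurable borel"
proof -
  have [measurable]: "cnj \<in> borel_measurable borel"
    by (intro borel_measurable_continuous_onI continuous_on_cnj continuous_on_id)
  show ?thesis unfolding plane_term_def[abs_def] by measurable
qed

private lemma nn_integral_window_weight:
  "(\<integral>\<^sup>+z. ennreal (((cmod z)\<^sup>2) ^ k * window_weight (cmod z)) \<partial>lborel) = ennreal (pi * radial_mass n v k B)"
proof -
  have "(\<integral>\<^sup>+z. ennreal (((cmod z)\<^sup>2) ^ k * window_weight (cmod z)) \<partial>lborel)
      = (\<integral>\<^sup>+z. (\<lambda>s. ennreal (indicator B s * (s ^ k * radial_weight n v s))) ((cmod z)\<^sup>2) \<partial>lborel)"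
    by (simp add: window_weight_def mult_ac)
  also have "\<dots> = ennreal pi * ennreal (radial_mass n v k B)"
    by (subst nn_integral_cmod_square) (simp_all add: nn_integral_radial_mass[OF n])
  finally show ?thesis using radial_mass_nonneg by (simp add: ennreal_mult)
qed

private lemma window_weight_nonneg: "window_weight r \<ge> 0"
  by (simp add: window_weight_def radial_weight_nonneg indicator_def)

private lemma plane_term_integrable: "integrable lborel (plane_term a b)"
proof (rule integrableI_bounded)
  have "(\<integral>\<^sup>+z. ennreal (norm (plane_term a b z)) \<partial>lborel)
      = (\<integral>\<^sup>+z. ennreal (((cmod z)\<^sup>2) ^ (a + b) * window_weight (cmod z)) \<partial>lborel)"
    by (intro nn_integral_cong)
       (simp add: plane_term_def norm_mult norm_power window_weight_nonneg power_mult[symmetric] power_add[symmetric] distrib_left)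
  then show "(\<integral>\<^sup>+z. ennreal (norm (plane_term a b z)) \<partial>lborel) < \<infinity>"
    unfolding nn_integral_window_weight by simp
qed simp

private lemma integral_plane_term:
  "(\<integral>z. plane_term a b z \<partial>lborel) = (if a = b then of_real (pi * radial_mass n v (2 * a) B) else 0)"
proof (cases "a = b")
  case True
  have "plane_term a a z = of_real (((cmod z)\<^sup>2) ^ (2 * a) * window_weight (cmod z))" for z
  proof -
    have "z ^ (2 * a) * cnj z ^ (2 * a) = (z * cnj z) ^ (2 * a)" by (simp add: power_mult_distrib)
    also have "z * cnj z = of_real ((cmod z)\<^sup>2)" by (rule complex_norm_square[symmetric])
    finally show ?thesis by (simp add: plane_term_def)
  qed
  then have "(\<integral>z. plane_term a a z \<partial>lborel) = of_real (\<integral>z. ((cmod z)\<^sup>2) ^ (2 * a) * window_weight (cmod z) \<partial>lborel)"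
    by (simp only: integral_complex_of_real)
  also have "(\<integral>z. ((cmod z)\<^sup>2) ^ (2 * a) * window_weight (cmod z) \<partial>lborel) = pi * radial_mass n v (2 * a) B"
    by (subst integral_eq_nn_integral) (auto simp: nn_integral_window_weight window_weight_nonneg radial_mass_nonneg)
  finally show ?thesis using True by simp
next
  case False
  then show ?thesis unfolding plane_term_def by (simp add: angular_orthogonality)
qed

private definition half_plane_term :: "nat \<Rightarrow> nat \<Rightarrow> complex \<Rightarrow> complex" where
  "half_plane_term a b z = indicator {z. Re z > 0} z *\<^sub>R plane_term a b z"

private lemma half_plane_term_integrable: "integrable lborel (half_plane_term a b)"
  unfolding half_plane_term_def[abs_def] by (rule integrable_mult_indicator[OF _ plane_term_integrable]) measurable

private lemma integral_half_plane_term: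
  "(\<integral>z. half_plane_term a b z \<partial>lborel) = (if a = b then of_real (pi / 2 * radial_mass n v (2 * a) B) else 0)"
proof -
  have "(\<integral>z. half_plane_term a b z \<partial>lborel) = (1 / 2) * (\<integral>z. plane_term a b z \<partial>lborel)"
    unfolding half_plane_term_def by (rule integral_half_plane_even[OF plane_term_integrable]) (simp add: plane_term_def)
  also have "\<dots> = (if a = b then of_real (pi / 2 * radial_mass n v (2 * a) B) else 0)"
    unfolding integral_plane_term by simp
  finally show ?thesis .
qed

private abbreviation window_density :: "(nat \<Rightarrow> complex) \<Rightarrow> real" where
  "window_density z \<equiv> unnormalized_density n v z * (\<Prod>i\<in>{1..n}. indicator B ((cmod (z i))\<^sup>2))"

private abbreviation perms :: "(nat \<Rightarrow> nat) set" where
  "perms \<equiv> {\<sigma>. \<sigma> permutes {1..n}}"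

text \<open>Both Vandermonde factors are expanded, and all remaining factors are distributed over the
particles.\<close>

private lemma window_density_expand:
  "complex_of_real (window_density z) =
     (\<Sum>\<sigma>\<in>perms. \<Sum>\<tau>\<in>perms. of_int (sign \<sigma>) * of_int (sign \<tau>) * (\<Prod>i\<in>{1..n}. half_plane_term (\<sigma> i - 1) (\<tau> i - 1) (z i)))"
proof -
  let ?x = "\<lambda>i. (z i)\<^sup>2"
  let ?I = "\<lambda>i. indicator {z. Re z > 0} (z i) * window_weight (cmod (z i))"
  have 1: "window_density z = (\<Prod>k\<in>{1..n}. \<Prod>j\<in>{1..<k}. (cmod (?x k - ?x j))\<^sup>2) * (\<Prod>i\<in>{1..n}. ?I i)"
  proof (cases "\<forall>j\<in>{1..n}. Re (z j) > 0")
    case True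
    have pow: "cmod (z i) ^ (2 * (v + 1)) = ((cmod (z i))\<^sup>2) ^ (v + 1)" for i by (rule power_mult)
    from True have "(\<Prod>i\<in>{1..n}. ?I i) = (\<Prod>i\<in>{1..n}. cmod (z i) ^ (2 * (v + 1)) * bessel_K (real v) (2 * real n * (cmod (z i))\<^sup>2))
        * (\<Prod>i\<in>{1..n}. indicator B ((cmod (z i))\<^sup>2))"
      unfolding prod.distrib[symmetric] pow
      by (intro prod.cong) (auto simp: window_weight_def radial_weight_def)
    then show ?thesis using True unfolding unnormalized_density_def by (simp add: norm_minus_commute)
  next
    case False
    then obtain j where j: "j \<in> {1..n}" "\<not> Re (z j) > 0" by blast
    then have 0: "(\<Prod>i\<in>{1..n}. ?I i) = 0" by (intro prod_zero bexI[of _ j]) auto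
    show ?thesis unfolding unnormalized_density_def if_not_P[OF False] 0 by simp
  qed
  have "complex_of_real (\<Prod>k\<in>{1..n}. \<Prod>j\<in>{1..<k}. (cmod (?x k - ?x j))\<^sup>2)
      = alternant n ?x * cnj (alternant n ?x)"
    unfolding vandermonde_alternant[symmetric] cnj_prod of_real_prod prod.distrib[symmetric]
    by (simp only: complex_norm_square)
  also have "\<dots> = (\<Sum>\<sigma>\<in>perms. \<Sum>\<tau>\<in>perms. of_int (sign \<sigma>) * of_int (sign \<tau>) *
       (\<Prod>i\<in>{1..n}. ?x i ^ (\<sigma> i - 1) * cnj (?x i) ^ (\<tau> i - 1)))"
    unfolding alternant_def cnj_sum sum_product
    by (intro sum.cong refl) (simp add: prod.distrib mult_ac)
  finally have 2: "complex_of_real (\<Prod>k\<in>{1..n}. \<Prod>j\<in>{1..<k}. (cmod (?x k - ?x j))\<^sup>2) = \<dots>" .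
  show ?thesis
    unfolding 1 of_real_mult 2 sum_distrib_right
  proof (intro sum.cong refl)
    fix \<sigma> \<tau>
    have "(\<Prod>i\<in>{1..n}. ?x i ^ (\<sigma> i - 1) * cnj (?x i) ^ (\<tau> i - 1)) * complex_of_real (\<Prod>i\<in>{1..n}. ?I i)
        = (\<Prod>i\<in>{1..n}. half_plane_term (\<sigma> i - 1) (\<tau> i - 1) (z i))"
      unfolding of_real_prod prod.distrib[symmetric]
      by (intro prod.cong refl) (simp add: half_plane_term_def plane_term_def power_mult scaleR_conv_of_real mult_ac)
    then show "of_int (sign \<sigma>) * of_int (sign \<tau>) * (\<Prod>i\<in>{1..n}. ?x i ^ (\<sigma> i - 1) * cnj (?x i) ^ (\<tau> i - 1)) *
          complex_of_real (\<Prod>i\<in>{1..n}. ?I i)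
        = of_int (sign \<sigma>) * of_int (sign \<tau>) * (\<Prod>i\<in>{1..n}. half_plane_term (\<sigma> i - 1) (\<tau> i - 1) (z i))"
      by (simp only: mult.assoc)
  qed
qed

text \<open>Expanding the Vandermonde product and its conjugate gives a double sum over permutations \<open>\<sigma>\<close> and
\<open>\<tau>\<close> of products of one-particle integrals. If \<open>\<sigma> i \<noteq> \<tau> i\<close> for some \<open>i\<close>, the factor at \<open>i\<close> vanishes
by orthogonality. Each of the \<open>n!\<close> diagonal terms is the same product in a different order.\<close>

lemma integral_unnormalized_density:
  shows "integrable (lebesgue_Cn n) window_density"
    and "(\<integral>z. window_density z \<partial>lebesgue_Cn n) = fact n * (\<Prod>i\<in>{1..n}. pi / 2 * radial_mass n v (2 * (i - 1)) B)"
proof -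
  interpret product_sigma_finite "\<lambda>_::nat. lborel :: complex measure" by standard
  let ?C = "\<lambda>a. pi / 2 * radial_mass n v (2 * a) B"
  let ?T = "\<lambda>\<sigma> \<tau> z. of_int (sign \<sigma>) * of_int (sign \<tau>) * (\<Prod>i\<in>{1..n}. half_plane_term (\<sigma> i - 1) (\<tau> i - 1) (z i))"
  have Tint: "integrable (lebesgue_Cn n) (?T \<sigma> \<tau>)" for \<sigma> \<tau>
    unfolding lebesgue_Cn_def
    by (intro integrable_mult_right product_integrable_prod finite_atLeastAtMost half_plane_term_integrable)
  have int: "integrable (lebesgue_Cn n) (\<lambda>z. complex_of_real (window_density z))"
    unfolding window_density_expand by (intro Bochner_Integration.integrable_sum Tint)
  then show "integrable (lebesgue_Cn n) window_density"
    using integrable_Re[OF int] by (simp only: Re_complex_of_real)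
  have T: "(\<integral>z. ?T \<sigma> \<tau> z \<partial>lebesgue_Cn n) = (if \<tau> = \<sigma> then of_real (\<Prod>i\<in>{1..n}. ?C (i - 1)) else 0)"
    if \<sigma>: "\<sigma> \<in> perms" and \<tau>: "\<tau> \<in> perms" for \<sigma> \<tau>
  proof -
    have "(\<integral>z. ?T \<sigma> \<tau> z \<partial>lebesgue_Cn n)
        = of_int (sign \<sigma>) * of_int (sign \<tau>) * (\<Prod>i\<in>{1..n}. \<integral>z. half_plane_term (\<sigma> i - 1) (\<tau> i - 1) z \<partial>lborel)"
      unfolding lebesgue_Cn_def integral_mult_right_zero
      by (subst product_integral_prod) (auto intro: half_plane_term_integrable)
    also have "\<dots> = (if \<tau> = \<sigma> then of_real (\<Prod>i\<in>{1..n}. ?C (i - 1)) else 0)"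
    proof (cases "\<tau> = \<sigma>")
      case True
      have "of_int (sign \<sigma>) * of_int (sign \<sigma>) = (1::complex)"
        by (simp add: sign_def)
      moreover have "(\<Prod>i\<in>{1..n}. ?C (\<sigma> i - 1)) = (\<Prod>i\<in>{1..n}. ?C (i - 1))"
        using prod.permute[of \<sigma> "{1..n}" "\<lambda>i. ?C (i - 1)"] \<sigma> by (simp add: o_def)
      ultimately show ?thesis unfolding True integral_half_plane_term
        by (simp only: if_True simp_thms of_real_prod[symmetric] mult_1)
    next
      case False
      then obtain i where i: "\<sigma> i \<noteq> \<tau> i" by (metis ext)
      have iS: "i \<in> {1..n}"
      proof (rule ccontr)
        assume i': "i \<notin> {1..n}"
        have perm: "\<sigma> permutes {1..n}" "\<tau> permutes {1..n}" using \<sigma> \<tau> by simp_all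
        show False using i unfolding permutes_not_in[OF perm(1) i'] permutes_not_in[OF perm(2) i'] by (rule notE) (rule refl)
      qed
      have "\<sigma> i \<in> {1..n}" "\<tau> i \<in> {1..n}"
        using \<sigma> \<tau> iS by (simp_all only: mem_Collect_eq permutes_in_image)
      then have "\<sigma> i - 1 \<noteq> \<tau> i - 1" using i by auto
      then have "(\<Prod>i\<in>{1..n}. \<integral>z. half_plane_term (\<sigma> i - 1) (\<tau> i - 1) z \<partial>lborel) = 0"
        using iS by (intro prod_zero bexI[of _ i]) (auto simp: integral_half_plane_term)
      then show ?thesis using False by simp
    qed
    finally show ?thesis .
  qed
  have finS: "finite perms" by (simp add: finite_permutations)
  have "complex_of_real (\<integral>z. window_density z \<partial>lebesgue_Cn n) = (\<integral>z. complex_of_real (window_density z) \<partial>lebesgue_Cn n)"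
    by (rule integral_complex_of_real[symmetric])
  also have "\<dots> = (\<Sum>\<sigma>\<in>perms. \<integral>z. (\<Sum>\<tau>\<in>perms. ?T \<sigma> \<tau> z) \<partial>lebesgue_Cn n)"
    unfolding window_density_expand by (rule Bochner_Integration.integral_sum) (intro Bochner_Integration.integrable_sum Tint)
  also have "\<dots> = (\<Sum>\<sigma>\<in>perms. of_real (\<Prod>i\<in>{1..n}. ?C (i - 1)))"
  proof (rule sum.cong[OF refl])
    fix \<sigma> assume \<sigma>: "\<sigma> \<in> perms"
    have "(\<integral>z. (\<Sum>\<tau>\<in>perms. ?T \<sigma> \<tau> z) \<partial>lebesgue_Cn n) = (\<Sum>\<tau>\<in>perms. \<integral>z. ?T \<sigma> \<tau> z \<partial>lebesgue_Cn n)"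
      by (rule Bochner_Integration.integral_sum) (rule Tint)
    also have "\<dots> = (\<Sum>\<tau>\<in>perms. if \<tau> = \<sigma> then of_real (\<Prod>i\<in>{1..n}. ?C (i - 1)) else 0)"
      by (rule sum.cong[OF refl]) (rule T[OF \<sigma>])
    also have "\<dots> = of_real (\<Prod>i\<in>{1..n}. ?C (i - 1))"
      unfolding sum.delta[OF finS] using \<sigma> by (simp only: if_True)
    finally show "(\<integral>z. (\<Sum>\<tau>\<in>perms. ?T \<sigma> \<tau> z) \<partial>lebesgue_Cn n) = of_real (\<Prod>i\<in>{1..n}. ?C (i - 1))" .
  qed
  also have "\<dots> = of_real (fact n * (\<Prod>i\<in>{1..n}. ?C (i - 1)))"
  proof -
    have "card perms = fact n" by (rule card_permutations) simp_all
    then show ?thesis by (simp only: sum_constant of_real_mult of_real_fact of_nat_fact)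
  qed
  finally show "(\<integral>z. window_density z \<partial>lebesgue_Cn n) = fact n * (\<Prod>i\<in>{1..n}. ?C (i - 1))"
    by (simp only: of_real_eq_iff)
qed

end

text \<open>The case \<open>B = UNIV\<close> of the preceding integral computes the normalising constant, and the
combinatorial factors cancel.\<close>

lemma prob_all_moduli:
  assumes n: "n \<ge> 1"
    and dist: "distributed M (lebesgue_Cn n) (\<lambda>\<omega>. \<lambda>i\<in>{1..n}. \<zeta> i \<omega>) (\<lambda>z. ennreal (joint_density n v z))"
    and B [measurable]: "B \<in> sets borel"
  shows "{\<omega> \<in> space M. \<forall>i\<in>{1..n}. (cmod (\<zeta> i \<omega>))\<^sup>2 \<in> B} \<in> sets M"
    and "measure M {\<omega> \<in> space M. \<forall>i\<in>{1..n}. (cmod (\<zeta> i \<omega>))\<^sup>2 \<in> B}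
       = (\<Prod>i\<in>{1..n}. radial_mass n v (2 * (i - 1)) B / radial_mass n v (2 * (i - 1)) UNIV)"
proof -
  let ?X = "\<lambda>\<omega>. \<lambda>i\<in>{1..n}. \<zeta> i \<omega>"
  let ?A = "{z \<in> space (lebesgue_Cn n). \<forall>i\<in>{1..n}. (cmod (z i))\<^sup>2 \<in> B}"
  let ?ind = "\<lambda>z. \<Prod>i\<in>{1..n}. indicator B ((cmod (z i))\<^sup>2) :: real"
  let ?m = "\<lambda>B i. radial_mass n v (2 * (i - 1)) B"
  let ?N = "fact n * (\<Prod>i\<in>{1..n}. pi / 2 * ?m UNIV i)"
  have N: "norm_const n v = 1 / ?N"
    using integral_unnormalized_density(2)[OF n, of UNIV v] by (simp add: norm_const_def)
  have Npos: "?N > 0" using radial_mass_UNIV_pos[OF n] by (intro mult_pos_pos prod_pos) auto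
  have A: "?A \<in> sets (lebesgue_Cn n)" unfolding lebesgue_Cn_def by measurable
  have X: "?X \<in> measurable M (lebesgue_Cn n)" using dist by (rule distributed_measurable)
  have ind: "?ind z = indicator ?A z" if zs: "z \<in> space (lebesgue_Cn n)" for z
  proof (cases "z \<in> ?A")
    case True then show ?thesis by (auto simp: indicator_def)
  next
    case False
    then obtain i where "i \<in> {1..n}" "(cmod (z i))\<^sup>2 \<notin> B" using zs by blast
    then have "?ind z = 0" by (intro prod_zero bexI[of _ i]) auto
    then show ?thesis using False by simp
  qed
  have ev: "{\<omega> \<in> space M. \<forall>i\<in>{1..n}. (cmod (\<zeta> i \<omega>))\<^sup>2 \<in> B} = ?X -` ?A \<inter> space M"
    using measurable_space[OF X] by auto
  show "{\<omega> \<in> space M. \<forall>i\<in>{1..n}. (cmod (\<zeta> i \<omega>))\<^sup>2 \<in> B} \<in> sets M"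
    unfolding ev by (rule measurable_sets[OF X A])
  have "emeasure M {\<omega> \<in> space M. \<forall>i\<in>{1..n}. (cmod (\<zeta> i \<omega>))\<^sup>2 \<in> B}
      = (\<integral>\<^sup>+z. ennreal (joint_density n v z) * indicator ?A z \<partial>lebesgue_Cn n)"
    unfolding ev by (rule distributed_emeasure[OF dist A])
  also have "\<dots> = (\<integral>\<^sup>+z. ennreal (norm_const n v * (unnormalized_density n v z * ?ind z)) \<partial>lebesgue_Cn n)"
  proof (rule nn_integral_cong)
    fix z assume zs: "z \<in> space (lebesgue_Cn n)"
    show "ennreal (joint_density n v z) * indicator ?A z
        = ennreal (norm_const n v * (unnormalized_density n v z * ?ind z))"
      unfolding joint_density_def ind[OF zs] by (auto simp: indicator_def)
  qed
  also have "\<dots> = ennreal (norm_const n v * (\<integral>z. unnormalized_density n v z * ?ind z \<partial>lebesgue_Cn n))"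
  proof (subst nn_integral_eq_integral)
    show "integrable (lebesgue_Cn n) (\<lambda>z. norm_const n v * (unnormalized_density n v z * ?ind z))"
      by (intro integrable_mult_right integral_unnormalized_density(1) n B)
    have "unnormalized_density n v z \<ge> 0" for z
      by (auto simp: unnormalized_density_def intro!: mult_nonneg_nonneg prod_nonneg bessel_K_nonneg)
    then show "AE z in lebesgue_Cn n. 0 \<le> norm_const n v * (unnormalized_density n v z * ?ind z)"
      using N Npos by (intro AE_I2 mult_nonneg_nonneg prod_nonneg) auto
  qed simp
  also have "(\<integral>z. unnormalized_density n v z * ?ind z \<partial>lebesgue_Cn n) = fact n * (\<Prod>i\<in>{1..n}. pi / 2 * ?m B i)"
    by (rule integral_unnormalized_density(2)[OF n B])
  also have "norm_const n v * (fact n * (\<Prod>i\<in>{1..n}. pi / 2 * ?m B i)) = (\<Prod>i\<in>{1..n}. ?m B i / ?m UNIV i)"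
  proof -
    have "norm_const n v * (fact n * (\<Prod>i\<in>{1..n}. pi / 2 * ?m B i))
        = (\<Prod>i\<in>{1..n}. pi / 2 * ?m B i) / (\<Prod>i\<in>{1..n}. pi / 2 * ?m UNIV i)"
      unfolding N by simp
    also have "\<dots> = (\<Prod>i\<in>{1..n}. ?m B i / ?m UNIV i)"
      unfolding prod_dividef[symmetric] by (intro prod.cong) auto
    finally show ?thesis .
  qed
  finally show "measure M {\<omega> \<in> space M. \<forall>i\<in>{1..n}. (cmod (\<zeta> i \<omega>))\<^sup>2 \<in> B} = (\<Prod>i\<in>{1..n}. ?m B i / ?m UNIV i)"
    by (simp add: measure_def prod_nonneg radial_mass_nonneg)
qed

section \<open>Chains of size-biased laws\<close>

lemma one_minus_prod_le_sum:
  fixes p :: "'b \<Rightarrow> real"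
  assumes "finite A" "\<And>j. j \<in> A \<Longrightarrow> 0 \<le> p j \<and> p j \<le> 1"
  shows "1 - (\<Prod>j\<in>A. p j) \<le> (\<Sum>j\<in>A. 1 - p j)"
  using assms
proof (induction A rule: finite_induct)
  case (insert a A)
  have "prod p A \<le> 1" using insert by (intro prod_le_1) auto
  then have "p a * (1 - prod p A) \<le> 1 * (1 - prod p A)"
    using insert by (intro mult_right_mono) auto
  moreover have "1 - prod p A \<le> (\<Sum>j\<in>A. 1 - p j)" using insert by auto
  ultimately show ?case using insert by (simp add: algebra_simps)
qed simp

text \<open>Each law is the previous one weighted by the observable \<open>u\<close>, and \<open>D j\<close> is the mean of \<open>u\<close> under the
\<open>j\<close>-th law. Tilting by \<open>u^\<theta>\<close> is then the same as advancing the index by \<open>\<theta>\<close>.\<close>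

locale size_biased_chain =
  fixes P :: "nat \<Rightarrow> 'a measure" and u :: "'a \<Rightarrow> real" and D :: "nat \<Rightarrow> real"
  assumes prob: "j \<ge> 1 \<Longrightarrow> prob_space (P j)"
    and measurable_u [measurable]: "j \<ge> 1 \<Longrightarrow> u \<in> borel_measurable (P j)"
    and u_nonneg: "u x \<ge> 0"
    and D_pos: "j \<ge> 1 \<Longrightarrow> D j > 0"
    and size_bias: "j \<ge> 1 \<Longrightarrow> P (Suc j) = density (P j) (\<lambda>x. ennreal (u x / D j))"
begin

definition law :: "nat \<Rightarrow> real set \<Rightarrow> real" where
  "law j B = measure (P j) {x \<in> space (P j). u x \<in> B}"

lemma law_nonneg: "law j B \<ge> 0" by (simp add: law_def)

lemma law_le_1: "j \<ge> 1 \<Longrightarrow> law j B \<le> 1"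
  unfolding law_def using prob[of j] by (simp add: prob_space.prob_le_1)

lemma law_mono:
  assumes j: "j \<ge> 1" and [measurable]: "B' \<in> sets borel" and "B \<subseteq> B'"
  shows "law j B \<le> law j B'"
proof -
  interpret prob_space "P j" by (rule prob[OF j])
  note measurable_u[OF j, measurable]
  show ?thesis unfolding law_def using assms(3) by (intro finite_measure_mono) auto
qed

lemma law_Compl:
  assumes j: "j \<ge> 1" and [measurable]: "B \<in> sets borel"
  shows "law j (- B) = 1 - law j B"
proof -
  interpret prob_space "P j" by (rule prob[OF j])
  note measurable_u[OF j, measurable]
  have "law j (- B) = prob (space (P j) - {x \<in> space (P j). u x \<in> B})"
    unfolding law_def by (intro arg_cong[where f = prob]) auto
  then show ?thesis by (subst (asm) prob_compl) (auto simp: law_def)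
qed

lemma law_Suc:
  assumes j: "j \<ge> 1" and [measurable]: "B \<in> sets borel"
  shows "ennreal (law (Suc j) B)
       = (\<integral>\<^sup>+x. ennreal (u x / D j) * indicator {x \<in> space (P j). u x \<in> B} x \<partial>P j)"
proof -
  note measurable_u[OF j, measurable]
  interpret P': prob_space "P (Suc j)" by (rule prob) simp
  have "ennreal (law (Suc j) B) = emeasure (P (Suc j)) {x \<in> space (P j). u x \<in> B}"
    unfolding law_def P'.emeasure_eq_measure by (simp add: size_bias[OF j])
  also have "\<dots> = (\<integral>\<^sup>+x. ennreal (u x / D j) * indicator {x \<in> space (P j). u x \<in> B} x \<partial>P j)"
    unfolding size_bias[OF j] by (rule emeasure_density) measurable
  finally show ?thesis .
qed

lemma law_Suc_ge:
  assumes j: "j \<ge> 1" and [measurable]: "B \<in> sets borel" and B: "B \<subseteq> {t..}" and t: "t \<ge> 0"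
  shows "t / D j * law j B \<le> law (Suc j) B"
proof -
  note measurable_u[OF j, measurable]
  interpret prob_space "P j" by (rule prob[OF j])
  have "ennreal (t / D j * law j B) = (\<integral>\<^sup>+x. ennreal (t / D j) * indicator {x \<in> space (P j). u x \<in> B} x \<partial>P j)"
    using t D_pos[OF j]
    by (subst nn_integral_cmult_indicator) (auto simp: law_def emeasure_eq_measure ennreal_mult'[symmetric])
  also have "\<dots> \<le> ennreal (law (Suc j) B)"
    unfolding law_Suc[OF assms(1,2)] using B D_pos[OF j]
    by (intro nn_integral_mono) (auto simp: indicator_def intro!: ennreal_leI divide_right_mono)
  finally show ?thesis by (simp add: law_nonneg)
qed

lemma law_Suc_le:
  assumes j: "j \<ge> 1" and [measurable]: "B \<in> sets borel" and B: "B \<subseteq> {..t}" and t: "t \<ge> 0"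
  shows "law (Suc j) B \<le> t / D j * law j B"
proof -
  note measurable_u[OF j, measurable]
  interpret prob_space "P j" by (rule prob[OF j])
  have "ennreal (law (Suc j) B) \<le> (\<integral>\<^sup>+x. ennreal (t / D j) * indicator {x \<in> space (P j). u x \<in> B} x \<partial>P j)"
    unfolding law_Suc[OF assms(1,2)] using B D_pos[OF j]
    by (intro nn_integral_mono) (auto simp: indicator_def intro!: ennreal_leI divide_right_mono)
  also have "\<dots> = ennreal (t / D j * law j B)"
    using t D_pos[OF j]
    by (subst nn_integral_cmult_indicator) (auto simp: law_def emeasure_eq_measure ennreal_mult'[symmetric])
  finally show ?thesis using t D_pos[OF j] by (simp add: law_nonneg)
qed

text \<open>Iterates \<open>law_Suc_ge\<close>: on \<open>B\<close> each step of the chain multiplies the probability by at least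
\<open>t / D\<close>. With the trivial bound for the last law this is a Chernoff bound.\<close>

lemma law_shift_ge:
  assumes j: "j \<ge> 1" and B: "B \<in> sets borel" "B \<subseteq> {t..}" and t: "t > 0"
  shows "law j B \<le> (\<Prod>i<\<theta>. D (j + i) / t) * law (j + \<theta>) B"
proof (induction \<theta>)
  case (Suc \<theta>)
  have D: "D (j + \<theta>) > 0" using j by (intro D_pos) simp
  have "t / D (j + \<theta>) * law (j + \<theta>) B \<le> law (Suc (j + \<theta>)) B"
    using j t by (intro law_Suc_ge B) auto
  then have "law (j + \<theta>) B \<le> D (j + \<theta>) / t * law (j + Suc \<theta>) B"
    using t D by (simp add: field_simps)
  moreover have "(\<Prod>i<\<theta>. D (j + i) / t) \<ge> 0"
    using t j by (intro prod_nonneg) (auto intro!: divide_nonneg_pos less_imp_le[OF D_pos])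
  ultimately have "(\<Prod>i<\<theta>. D (j + i) / t) * law (j + \<theta>) B
      \<le> (\<Prod>i<\<theta>. D (j + i) / t) * (D (j + \<theta>) / t * law (j + Suc \<theta>) B)"
    by (rule mult_left_mono)
  with Suc.IH show ?case by (simp add: mult.assoc)
qed simp

lemma law_shift_le:
  assumes j: "j \<ge> 1" and B: "B \<in> sets borel" "B \<subseteq> {..t}" and t: "t > 0"
  shows "(\<Prod>i<\<theta>. D (j + i) / t) * law (j + \<theta>) B \<le> law j B"
proof (induction \<theta>)
  case (Suc \<theta>)
  have D: "D (j + \<theta>) > 0" using j by (intro D_pos) simp
  have "law (Suc (j + \<theta>)) B \<le> t / D (j + \<theta>) * law (j + \<theta>) B"
    using j t by (intro law_Suc_le B) auto
  then have "D (j + \<theta>) / t * law (j + Suc \<theta>) B \<le> law (j + \<theta>) B"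
    using t D by (simp add: field_simps)
  moreover have "(\<Prod>i<\<theta>. D (j + i) / t) \<ge> 0"
    using t j by (intro prod_nonneg) (auto intro!: divide_nonneg_pos less_imp_le[OF D_pos])
  ultimately have "(\<Prod>i<\<theta>. D (j + i) / t) * (D (j + \<theta>) / t * law (j + Suc \<theta>) B)
      \<le> (\<Prod>i<\<theta>. D (j + i) / t) * law (j + \<theta>) B"
    by (rule mult_left_mono)
  with Suc.IH show ?case by (simp add: mult.assoc)
qed simp

text \<open>Both moments are total masses: \<open>u\<close> weights the \<open>j\<close>-th law into \<open>D j\<close> times the next one, and \<open>u\<^sup>2\<close>
does so twice.\<close>

lemma moments:
  assumes j: "j \<ge> 1"
  shows "has_bochner_integral (P j) u (D j)"
    and "has_bochner_integral (P j) (\<lambda>x. (u x)\<^sup>2) (D j * D (Suc j))"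
proof -
  note measurable_u[OF j, measurable]
  have mass: "(\<integral>\<^sup>+x. ennreal (u x) \<partial>P i) = ennreal (D i)" if i: "i \<ge> 1" for i
  proof -
    note measurable_u[OF i, measurable]
    interpret P': prob_space "P (Suc i)" by (rule prob) simp
    have "emeasure (P (Suc i)) (space (P i)) = 1" using P'.emeasure_space_1 by (simp add: size_bias[OF i])
    moreover have "(\<integral>\<^sup>+x. ennreal (u x / D i) \<partial>P i)
        = (\<integral>\<^sup>+x. ennreal (u x / D i) * indicator (space (P i)) x \<partial>P i)"
      by (intro nn_integral_cong) simp
    then have "(\<integral>\<^sup>+x. ennreal (u x / D i) \<partial>P i) = emeasure (P (Suc i)) (space (P i))"
      unfolding size_bias[OF i] by (subst emeasure_density) auto
    ultimately have "(\<integral>\<^sup>+x. ennreal (u x / D i) \<partial>P i) = 1" by simp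
    then have "ennreal (D i) * (\<integral>\<^sup>+x. ennreal (u x / D i) \<partial>P i) = ennreal (D i)" by simp
    also have "ennreal (D i) * (\<integral>\<^sup>+x. ennreal (u x / D i) \<partial>P i) = (\<integral>\<^sup>+x. ennreal (u x) \<partial>P i)"
      using D_pos[OF i]
      by (subst nn_integral_cmult[symmetric])
         (auto intro!: nn_integral_cong simp: ennreal_mult'[symmetric])
    finally show ?thesis .
  qed
  show "has_bochner_integral (P j) u (D j)"
    using mass[OF j] D_pos[OF j] u_nonneg by (intro has_bochner_integral_nn_integral) auto
  have "(\<integral>\<^sup>+x. ennreal ((u x)\<^sup>2) \<partial>P j) = ennreal (D j) * (\<integral>\<^sup>+x. ennreal (u x / D j) * ennreal (u x) \<partial>P j)"
    using D_pos[OF j] u_nonneg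
    by (subst nn_integral_cmult[symmetric])
       (auto intro!: nn_integral_cong simp: ennreal_mult'[symmetric] power2_eq_square)
  also have "(\<integral>\<^sup>+x. ennreal (u x / D j) * ennreal (u x) \<partial>P j) = (\<integral>\<^sup>+x. ennreal (u x) \<partial>P (Suc j))"
    unfolding size_bias[OF j] by (subst nn_integral_density) auto
  also have "\<dots> = ennreal (D (Suc j))" by (rule mass) simp
  finally have "(\<integral>\<^sup>+x. ennreal ((u x)\<^sup>2) \<partial>P j) = ennreal (D j * D (Suc j))"
    using D_pos[OF j] by (simp add: ennreal_mult')
  then show "has_bochner_integral (P j) (\<lambda>x. (u x)\<^sup>2) (D j * D (Suc j))"
    using D_pos[OF j] D_pos[of "Suc j"] by (intro has_bochner_integral_nn_integral) auto
qed

text \<open>Chebyshev's inequality; by \<open>moments\<close> the variance is \<open>D j (D (j + 1) - D j)\<close>.\<close>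

lemma concentration:
  assumes j: "j \<ge> 1" and \<delta>: "\<delta> > 0" and [measurable]: "B \<in> sets borel"
    and B: "{D j - \<delta><..<D j + \<delta>} \<subseteq> B"
  shows "law j B \<ge> 1 - D j * (D (Suc j) - D j) / \<delta>\<^sup>2"
proof -
  note measurable_u[OF j, measurable]
  interpret prob_space "P j" by (rule prob[OF j])
  have int: "integrable (P j) (\<lambda>x. (u x)\<^sup>2)" "integrable (P j) u" and E: "expectation u = D j"
    and E2: "expectation (\<lambda>x. (u x)\<^sup>2) = D j * D (Suc j)"
    using moments[OF j] by (auto simp: has_bochner_integral_iff)
  have var: "variance u = D j * (D (Suc j) - D j)"
    using variance_eq[OF int(2,1)] unfolding E E2 by (simp only: power2_eq_square right_diff_distrib)
  have "law j (- B) \<le> prob {x \<in> space (P j). \<delta> \<le> \<bar>u x - expectation u\<bar>}"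
  proof -
    have "\<delta> \<le> \<bar>y - D j\<bar>" if "y \<notin> B" for y
    proof (rule ccontr)
      assume "\<not> \<delta> \<le> \<bar>y - D j\<bar>"
      then have "y \<in> {D j - \<delta><..<D j + \<delta>}" by auto
      with B that show False by blast
    qed
    then show ?thesis unfolding law_def E by (intro finite_measure_mono) auto
  qed
  also have "\<dots> \<le> variance u / \<delta>\<^sup>2"
    by (rule Chebyshev_inequality[OF _ int(1) \<delta>]) simp
  finally show ?thesis unfolding var law_Compl[OF assms(1,3)] by simp
qed

text \<open>The same shifts read downwards from a top index \<open>n\<close>, as needed for lower tails. The index \<open>m\<close>
counts the distance from the top.\<close>

lemma law_descend_le:
  assumes B: "B \<in> sets borel" "B \<subseteq> {..t}" and t: "t > 0" and K: "k \<le> K" "K < n"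
  shows "law (n - k) B \<le> (\<Prod>m\<in>{k<..K}. t / D (n - m)) * law (n - K) B"
  using K
proof (induction K rule: dec_induct)
  case (step K)
  have S: "Suc (n - Suc K) = n - K" using step by simp
  have "law (n - K) B \<le> t / D (n - Suc K) * law (n - Suc K) B"
    using law_Suc_le[of "n - Suc K" B t] B t step unfolding S by simp
  moreover have "(\<Prod>m\<in>{k<..K}. t / D (n - m)) \<ge> 0"
    using t step by (intro prod_nonneg) (auto intro!: divide_nonneg_pos D_pos)
  ultimately have "(\<Prod>m\<in>{k<..K}. t / D (n - m)) * law (n - K) B
      \<le> (\<Prod>m\<in>{k<..K}. t / D (n - m)) * (t / D (n - Suc K) * law (n - Suc K) B)"
    by (rule mult_left_mono)
  moreover have "{k<..Suc K} = insert (Suc K) {k<..K}" using step by auto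
  ultimately show ?case using step by (simp add: mult_ac)
qed simp

lemma law_descend_ge:
  assumes B: "B \<in> sets borel" "B \<subseteq> {t..}" and t: "t > 0" and K: "k \<le> K" "K < n"
  shows "(\<Prod>m\<in>{k<..K}. t / D (n - m)) * law (n - K) B \<le> law (n - k) B"
  using K
proof (induction K rule: dec_induct)
  case (step K)
  have S: "Suc (n - Suc K) = n - K" using step by simp
  have "t / D (n - Suc K) * law (n - Suc K) B \<le> law (n - K) B"
    using law_Suc_ge[of "n - Suc K" B t] B t step unfolding S by simp
  moreover have "(\<Prod>m\<in>{k<..K}. t / D (n - m)) \<ge> 0"
    using t step by (intro prod_nonneg) (auto intro!: divide_nonneg_pos D_pos)
  ultimately have "(\<Prod>m\<in>{k<..K}. t / D (n - m)) * (t / D (n - Suc K) * law (n - Suc K) B)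
     \<le> (\<Prod>m\<in>{k<..K}. t / D (n - m)) * law (n - K) B"
    by (rule mult_left_mono)
  moreover have "{k<..Suc K} = insert (Suc K) {k<..K}" using step by auto
  ultimately show ?case using step by (simp add: mult_ac)
qed simp

text \<open>A union bound, with each tail shifted \<open>\<theta>\<close> steps up. By monotonicity of \<open>D\<close> the top index is the
worst.\<close>

lemma max_upper_tail_le:
  assumes n: "n \<ge> 1" and t: "t > 0" and mono: "\<And>i j. 1 \<le> i \<Longrightarrow> i \<le> j \<Longrightarrow> D i \<le> D j"
  shows "1 - (\<Prod>j\<in>{1..n}. law j {..<t}) \<le> real n * (\<Prod>i<\<theta>. D (n + i) / t)"
proof -
  have C: "- {..<t} = {t..}" by auto
  have "1 - (\<Prod>j\<in>{1..n}. law j {..<t}) \<le> (\<Sum>j\<in>{1..n}. law j {t..})"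
  proof -
    have "1 - (\<Prod>j\<in>{1..n}. law j {..<t}) \<le> (\<Sum>j\<in>{1..n}. 1 - law j {..<t})"
      by (rule one_minus_prod_le_sum) (auto simp: law_nonneg law_le_1)
    also have "\<dots> = (\<Sum>j\<in>{1..n}. law j {t..})"
      using law_Compl[of _ "{..<t}"] unfolding C by (intro sum.cong) auto
    finally show ?thesis .
  qed
  also have "\<dots> \<le> (\<Sum>j\<in>{1..n}. \<Prod>i<\<theta>. D (n + i) / t)"
  proof (rule sum_mono)
    fix j assume j: "j \<in> {1..n}"
    have pos: "D (j + i) > 0" for i using j by (intro D_pos) auto
    have "law j {t..} \<le> (\<Prod>i<\<theta>. D (j + i) / t) * law (j + \<theta>) {t..}"
      using j t by (intro law_shift_ge) auto
    also have "\<dots> \<le> (\<Prod>i<\<theta>. D (j + i) / t)"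
      using law_le_1[of "j + \<theta>" "{t..}"] j t pos
      by (intro mult_left_le prod_nonneg) (auto intro!: divide_nonneg_pos less_imp_le[OF pos])
    also have "\<dots> \<le> (\<Prod>i<\<theta>. D (n + i) / t)"
      using j t pos by (intro prod_mono conjI divide_right_mono mono divide_nonneg_pos less_imp_le[OF pos]) auto
    finally show "law j {t..} \<le> (\<Prod>i<\<theta>. D (n + i) / t)" .
  qed
  finally show ?thesis by simp
qed

text \<open>It suffices that the top variable is large. The window \<open>[t, t']\<close> bounds \<open>u\<close> from above, which bounds
the cost of the \<open>\<theta>\<close> shifts, and it should contain the mean of the shifted law.\<close>

lemma max_upper_tail_ge:
  assumes n: "n \<ge> 1" and t: "t > 0" "t \<le> t'" and half: "law (n + \<theta>) {t..t'} \<ge> 1 / 2"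
  shows "1 - (\<Prod>j\<in>{1..n}. law j {..<t}) \<ge> 1 / 2 * (\<Prod>i<\<theta>. D (n + i) / t')"
proof -
  have C: "- {..<t} = {t..}" by auto
  have pos: "D (n + i) > 0" for i using n by (intro D_pos) auto
  have "(\<Prod>i<\<theta>. D (n + i) / t') * (1 / 2) \<le> (\<Prod>i<\<theta>. D (n + i) / t') * law (n + \<theta>) {t..t'}"
    using t pos by (intro mult_left_mono half prod_nonneg) (auto intro!: divide_nonneg_pos less_imp_le[OF pos])
  also have "\<dots> \<le> law n {t..t'}" using n t by (intro law_shift_le) auto
  also have "\<dots> \<le> law n {t..}" using n by (intro law_mono) auto
  also have "\<dots> = 1 - law n {..<t}" using law_Compl[OF n, of "{..<t}"] unfolding C by simp
  also have "\<dots> \<le> 1 - (\<Prod>j\<in>{1..n}. law j {..<t})"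
  proof -
    have "(\<Prod>j\<in>{1..n}. law j {..<t}) = law n {..<t} * (\<Prod>j\<in>{1..n} - {n}. law j {..<t})"
      using n by (intro prod.remove) auto
    also have "\<dots> \<le> law n {..<t}"
      by (intro mult_left_le prod_le_1) (auto simp: law_nonneg law_le_1)
    finally show ?thesis by simp
  qed
  finally show ?thesis by simp
qed

end

text \<open>The factor at distance \<open>m\<close> from the top is used by each of the \<open>m\<close> variables above it.\<close>

lemma prod_triangle:
  fixes f :: "nat \<Rightarrow> 'b :: comm_monoid_mult"
  shows "(\<Prod>k<K. \<Prod>m\<in>{k<..K}. f m) = (\<Prod>m\<in>{1..K}. f m ^ m)"
proof (induction K)
  case (Suc K)
  have "{k<..Suc K} = insert (Suc K) {k<..K}" if "k < Suc K" for k using that by auto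
  then have "(\<Prod>k<Suc K. \<Prod>m\<in>{k<..Suc K}. f m) = (\<Prod>k<Suc K. f (Suc K) * (\<Prod>m\<in>{k<..K}. f m))"
    by (intro prod.cong) auto
  also have "\<dots> = f (Suc K) ^ Suc K * (\<Prod>k<K. \<Prod>m\<in>{k<..K}. f m)"
    by (simp add: prod.distrib mult_ac)
  finally show ?case using Suc.IH by (simp add: mult_ac)
qed simp

lemma prod_reverse_from_top:
  fixes f :: "nat \<Rightarrow> 'b :: comm_monoid_mult"
  shows "(\<Prod>j\<in>{1..n}. f j) = (\<Prod>k<n. f (n - k))"
  by (rule prod.reindex_bij_witness[of _ "\<lambda>k. n - k" "\<lambda>j. n - j"]) auto

context size_biased_chain
begin

text \<open>Every one of the top \<open>K\<close> variables is shifted down to index \<open>n - K\<close>, and the other factors are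
bounded by \<open>1\<close>.\<close>

lemma max_lower_tail_le:
  assumes K: "K < n" and t: "t > 0"
  shows "(\<Prod>j\<in>{1..n}. law j {..t}) \<le> (\<Prod>m\<in>{1..K}. (t / D (n - m)) ^ m)"
proof -
  have split: "{..<n} = {..<K} \<union> {K..<n}" using K by auto
  have "(\<Prod>j\<in>{1..n}. law j {..t}) = (\<Prod>k<K. law (n - k) {..t}) * (\<Prod>k\<in>{K..<n}. law (n - k) {..t})"
    unfolding prod_reverse_from_top[of _ n] unfolding split by (rule prod.union_disjoint) auto
  also have "\<dots> \<le> (\<Prod>k<K. law (n - k) {..t})"
    by (intro mult_left_le prod_le_1 prod_nonneg) (auto simp: law_nonneg law_le_1)
  also have "\<dots> \<le> (\<Prod>k<K. \<Prod>m\<in>{k<..K}. t / D (n - m))"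
  proof (intro prod_mono conjI law_nonneg)
    fix k assume k: "k \<in> {..<K}"
    have "law (n - k) {..t} \<le> (\<Prod>m\<in>{k<..K}. t / D (n - m)) * law (n - K) {..t}"
      using k K t by (intro law_descend_le) auto
    also have "\<dots> \<le> (\<Prod>m\<in>{k<..K}. t / D (n - m))"
      using law_le_1[of "n - K" "{..t}"] K t
      by (intro mult_left_le prod_nonneg) (auto intro!: divide_nonneg_pos D_pos)
    finally show "law (n - k) {..t} \<le> (\<Prod>m\<in>{k<..K}. t / D (n - m))" .
  qed
  finally show ?thesis unfolding prod_triangle .
qed

text \<open>The top \<open>K\<close> variables are shifted down to a law that already concentrates below \<open>t\<close>; the others
concentrate there without being shifted.\<close>

lemma max_lower_tail_ge:
  assumes K: "K < n" and t: "t' > 0" "t' \<le> t"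
    and half: "law (n - K) {t'..t} \<ge> 1 / 2"
    and half': "\<And>j. 1 \<le> j \<Longrightarrow> j \<le> n - K \<Longrightarrow> law j {..t} \<ge> 1 / 2"
  shows "(\<Prod>j\<in>{1..n}. law j {..t}) \<ge> (1 / 2) ^ n * (\<Prod>m\<in>{1..K}. (t' / D (n - m)) ^ m)"
proof -
  have split: "{..<n} = {..<K} \<union> {K..<n}" using K by auto
  have "(1 / 2) ^ n * (\<Prod>m\<in>{1..K}. (t' / D (n - m)) ^ m)
      = (\<Prod>k<K. (\<Prod>m\<in>{k<..K}. t' / D (n - m)) * (1 / 2)) * (\<Prod>k\<in>{K..<n}. 1 / 2)"
    using K unfolding prod.distrib prod_triangle
    by (simp add: power_add[symmetric] del: power_one_over)
  also have "\<dots> \<le> (\<Prod>k<K. law (n - k) {..t}) * (\<Prod>k\<in>{K..<n}. law (n - k) {..t})"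
  proof (rule mult_mono)
    show "(\<Prod>k<K. (\<Prod>m\<in>{k<..K}. t' / D (n - m)) * (1 / 2)) \<le> (\<Prod>k<K. law (n - k) {..t})"
    proof (intro prod_mono conjI)
      fix k assume k: "k \<in> {..<K}"
      have nn: "0 \<le> (\<Prod>m\<in>{k<..K}. t' / D (n - m))"
        using K t by (intro prod_nonneg) (auto intro!: divide_nonneg_pos D_pos)
      then show "0 \<le> (\<Prod>m\<in>{k<..K}. t' / D (n - m)) * (1 / 2)" by simp
      have "(\<Prod>m\<in>{k<..K}. t' / D (n - m)) * (1 / 2)
          \<le> (\<Prod>m\<in>{k<..K}. t' / D (n - m)) * law (n - K) {t'..t}"
        by (rule mult_left_mono[OF half nn])
      also have "\<dots> \<le> law (n - k) {t'..t}" using K k t by (intro law_descend_ge) auto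
      also have "\<dots> \<le> law (n - k) {..t}" using K k by (intro law_mono) auto
      finally show "(\<Prod>m\<in>{k<..K}. t' / D (n - m)) * (1 / 2) \<le> law (n - k) {..t}" .
    qed
    show "(\<Prod>k\<in>{K..<n}. 1 / 2) \<le> (\<Prod>k\<in>{K..<n}. law (n - k) {..t})"
      using half' by (intro prod_mono) auto
  qed (auto intro!: prod_nonneg law_nonneg)
  also have "\<dots> = (\<Prod>j\<in>{1..n}. law j {..t})"
    unfolding prod_reverse_from_top[of _ n] unfolding split by (rule prod.union_disjoint[symmetric]) auto
  finally show ?thesis .
qed

end

section \<open>The radial laws as a size-biased chain\<close>

definition radial_law :: "nat \<Rightarrow> nat \<Rightarrow> nat \<Rightarrow> real measure" where
  "radial_law n v j = density lborel (\<lambda>s. ennreal (indicator {0<..} s *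
     (s ^ (2 * (j - 1)) * radial_weight n v s) / radial_mass n v (2 * (j - 1)) UNIV))"

text \<open>The mean of a product of independent Gamma variables with shapes \<open>j\<close> and \<open>j + v\<close>. Such a product
has the law of \<open>(n s)\<^sup>2\<close> under \<open>radial_law n v j\<close>.\<close>

definition gamma_mean :: "nat \<Rightarrow> nat \<Rightarrow> real" where
  "gamma_mean v j = real j * real (j + v)"

abbreviation Law :: "nat \<Rightarrow> nat \<Rightarrow> nat \<Rightarrow> real set \<Rightarrow> real" where
  "Law n v \<equiv> size_biased_chain.law (radial_law n v) (\<lambda>s. (real n * s)\<^sup>2)"

lemma emeasure_radial_law:
  assumes n: "n \<ge> 1" and [measurable]: "B \<in> sets borel"
  shows "emeasure (radial_law n v j) B
     = ennreal (radial_mass n v (2 * (j - 1)) B / radial_mass n v (2 * (j - 1)) UNIV)"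
proof -
  let ?k = "2 * (j - 1)" and ?w = "radial_weight n v"
  let ?m = "radial_mass n v ?k UNIV"
  have m: "?m > 0" by (rule radial_mass_UNIV_pos[OF n])
  have "emeasure (radial_law n v j) B = (\<integral>\<^sup>+s. ennreal (indicator {0<..} s * (s ^ ?k * ?w s) / ?m) * indicator B s \<partial>lborel)"
    unfolding radial_law_def by (rule emeasure_density) measurable
  also have "\<dots> = (\<integral>\<^sup>+s. ennreal (1 / ?m) * (ennreal (indicator B s * (s ^ ?k * ?w s)) * indicator {0<..} s) \<partial>lborel)"
    using m by (intro nn_integral_cong) (auto simp: indicator_def radial_weight_nonneg ennreal_mult'[symmetric])
  also have "\<dots> = ennreal (1 / ?m) * ennreal (radial_mass n v ?k B)"
    by (subst nn_integral_cmult) (simp_all add: nn_integral_radial_mass[OF n])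
  also have "\<dots> = ennreal (radial_mass n v ?k B / ?m)"
    using m by (simp add: ennreal_mult'[symmetric])
  finally show ?thesis .
qed

lemma size_biased_radial_law:
  assumes n: "n \<ge> 1"
  shows "size_biased_chain (radial_law n v) (\<lambda>s. (real n * s)\<^sup>2) (gamma_mean v)"
proof (rule size_biased_chain.intro)
  fix j :: nat assume j: "j \<ge> 1"
  show "prob_space (radial_law n v j)"
  proof (rule prob_spaceI)
    show "emeasure (radial_law n v j) (space (radial_law n v j)) = 1"
      using emeasure_radial_law[OF n, of UNIV v j] radial_mass_UNIV_pos[OF n, of v "2 * (j - 1)"]
      by (simp add: radial_law_def)
  qed
  show "(\<lambda>s. (real n * s)\<^sup>2) \<in> borel_measurable (radial_law n v j)"
    unfolding radial_law_def by measurable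
  show D: "gamma_mean v j > 0" using j by (simp add: gamma_mean_def)
  define a where "a = radial_mass n v (2 * (j - 1)) UNIV"
  define b where "b = radial_mass n v (2 * j) UNIV"
  have ab: "a > 0" "b > 0" unfolding a_def b_def by (rule radial_mass_UNIV_pos[OF n])+
  have rec: "(real n)\<^sup>2 * b = gamma_mean v j * a"
    unfolding a_def b_def gamma_mean_def by (rule radial_mass_UNIV_rec[OF n j])
  have "ennreal (indicator {0<..} s * (s ^ (2 * (Suc j - 1)) * radial_weight n v s) / b)
      = ennreal (indicator {0<..} s * (s ^ (2 * (j - 1)) * radial_weight n v s) / a) *
        ennreal ((real n * s)\<^sup>2 / gamma_mean v j)" for s
  proof -
    have p: "s ^ (2 * j) = s ^ (2 * (j - 1)) * s\<^sup>2"
      using j by (cases j) (simp_all add: power2_eq_square)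
    have "(real n * s)\<^sup>2 / gamma_mean v j / a = s\<^sup>2 / b"
      using rec ab D by (simp add: field_simps power_mult_distrib)
    note bias = this
    let ?X = "indicator {0<..} s * (s ^ (2 * (j - 1)) * radial_weight n v s)"
    have "indicator {0<..} s * (s ^ (2 * (Suc j - 1)) * radial_weight n v s) / b = ?X * (s\<^sup>2 / b)"
      by (simp add: p)
    also have "\<dots> = ?X / a * ((real n * s)\<^sup>2 / gamma_mean v j)"
      unfolding bias[symmetric] by simp
    finally have "indicator {0<..} s * (s ^ (2 * (Suc j - 1)) * radial_weight n v s) / b
      = ?X / a * ((real n * s)\<^sup>2 / gamma_mean v j)" .
    then show ?thesis using D by (simp only: ennreal_mult'' zero_le_power2 divide_nonneg_pos)
  qed
  then show "radial_law n v (Suc j) = density (radial_law n v j) (\<lambda>x. ennreal ((real n * x)\<^sup>2 / gamma_mean v j))"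
    unfolding radial_law_def
    by (subst density_density_eq) (auto simp: a_def b_def)
qed simp

lemma Law_eq:
  assumes n: "n \<ge> 1" and [measurable]: "B \<in> sets borel"
  shows "Law n v j B = radial_mass n v (2 * (j - 1)) {s. (real n * s)\<^sup>2 \<in> B} / radial_mass n v (2 * (j - 1)) UNIV"
proof -
  interpret size_biased_chain "radial_law n v" "\<lambda>s. (real n * s)\<^sup>2" "gamma_mean v"
    by (rule size_biased_radial_law[OF n])
  have "{s. (real n * s)\<^sup>2 \<in> B} \<in> sets borel" by measurable
  from emeasure_radial_law[OF n this, of v j] show ?thesis
    unfolding law_def measure_def
    using radial_mass_UNIV_pos[OF n] by (simp add: radial_law_def radial_mass_nonneg less_imp_le)
qed

lemma scaled_le_iff:
  fixes m c :: real
  assumes n: "n \<ge> 1" and m: "m \<ge> 0" "c \<ge> 0"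
  shows "sqrt (real n / real (n + v)) * m \<le> c \<longleftrightarrow> (real n * m)\<^sup>2 \<le> gamma_mean v n * c\<^sup>2"
    and "sqrt (real n / real (n + v)) * m < c \<longleftrightarrow> (real n * m)\<^sup>2 < gamma_mean v n * c\<^sup>2"
proof -
  define a where "a = sqrt (real n / real (n + v)) * m"
  have a: "a \<ge> 0" using m by (simp add: a_def)
  have D: "gamma_mean v n > 0" using n by (simp add: gamma_mean_def)
  have "a\<^sup>2 = real n / real (n + v) * m\<^sup>2" by (simp add: a_def power_mult_distrib)
  then have e: "(real n * m)\<^sup>2 = gamma_mean v n * a\<^sup>2"
    using n by (simp add: gamma_mean_def power_mult_distrib power2_eq_square)
  have "a \<le> c \<longleftrightarrow> a\<^sup>2 \<le> c\<^sup>2" using a m by (simp add: power_mono_iff)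
  then show "a \<le> c \<longleftrightarrow> (real n * m)\<^sup>2 \<le> gamma_mean v n * c\<^sup>2"
    unfolding e using D by simp
  have "a < c \<longleftrightarrow> a\<^sup>2 < c\<^sup>2" using a m by (meson power_mono_iff not_le pos2)
  then show "a < c \<longleftrightarrow> (real n * m)\<^sup>2 < gamma_mean v n * c\<^sup>2"
    unfolding e using D by simp
qed

text \<open>The maximum is below a level exactly when all moduli are. The threshold in the variable
\<open>(n s)\<^sup>2\<close> is \<open>D(n) c\<^sup>2\<close>, because \<open>D(n) n / (n + v) = n\<^sup>2\<close>.\<close>

lemma prob_max_modulus:
  fixes c :: real
  assumes n: "n \<ge> 1" and c: "c \<ge> 0" and prob: "prob_space M"
    and dist: "distributed M (lebesgue_Cn n) (\<lambda>\<omega>. \<lambda>i\<in>{1..n}. \<zeta> i \<omega>) (\<lambda>z. ennreal (joint_density n v z))"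
  defines "X \<equiv> \<lambda>\<omega>. sqrt (real n / real (n + v)) * Max ((\<lambda>i. (cmod (\<zeta> i \<omega>))\<^sup>2) ` {1..n})"
  shows "measure M {\<omega> \<in> space M. X \<omega> \<le> c} = (\<Prod>j\<in>{1..n}. Law n v j {..gamma_mean v n * c\<^sup>2})"
    and "measure M {\<omega> \<in> space M. X \<omega> \<ge> c} = 1 - (\<Prod>j\<in>{1..n}. Law n v j {..<gamma_mean v n * c\<^sup>2})"
proof -
  interpret prob_space M by (rule prob)
  let ?r = "sqrt (real n / real (n + v))"
  have r: "?r > 0" using n by simp
  have law: "measure M {\<omega> \<in> space M. \<forall>i\<in>{1..n}. (cmod (\<zeta> i \<omega>))\<^sup>2 \<in> {s. (real n * s)\<^sup>2 \<in> B}} = (\<Prod>j\<in>{1..n}. Law n v j B)"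
    "{\<omega> \<in> space M. \<forall>i\<in>{1..n}. (cmod (\<zeta> i \<omega>))\<^sup>2 \<in> {s. (real n * s)\<^sup>2 \<in> B}} \<in> events"
    if [measurable]: "B \<in> sets borel" for B
  proof -
    have "{s. (real n * s)\<^sup>2 \<in> B} \<in> sets borel" by measurable
    from prob_all_moduli[OF n dist this]
    show "measure M {\<omega> \<in> space M. \<forall>i\<in>{1..n}. (cmod (\<zeta> i \<omega>))\<^sup>2 \<in> {s. (real n * s)\<^sup>2 \<in> B}} = (\<Prod>j\<in>{1..n}. Law n v j B)"
    "{\<omega> \<in> space M. \<forall>i\<in>{1..n}. (cmod (\<zeta> i \<omega>))\<^sup>2 \<in> {s. (real n * s)\<^sup>2 \<in> B}} \<in> events"
      by (simp_all only: Law_eq[OF n that])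
  qed
  have "X \<omega> \<le> c \<longleftrightarrow> (\<forall>i\<in>{1..n}. ?r * (cmod (\<zeta> i \<omega>))\<^sup>2 \<le> c)" for \<omega>
  proof -
    have "X \<omega> \<le> c \<longleftrightarrow> Max ((\<lambda>i. (cmod (\<zeta> i \<omega>))\<^sup>2) ` {1..n}) \<le> c / ?r"
      using r by (simp add: X_def pos_le_divide_eq mult.commute)
    also have "\<dots> \<longleftrightarrow> (\<forall>i\<in>{1..n}. (cmod (\<zeta> i \<omega>))\<^sup>2 \<le> c / ?r)" using n by (subst Max_le_iff) auto
    finally show ?thesis using r by (simp add: pos_le_divide_eq mult.commute)
  qed
  then have "{\<omega> \<in> space M. X \<omega> \<le> c}
      = {\<omega> \<in> space M. \<forall>i\<in>{1..n}. (cmod (\<zeta> i \<omega>))\<^sup>2 \<in> {s. (real n * s)\<^sup>2 \<in> {..gamma_mean v n * c\<^sup>2}}}"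
    by (simp only: scaled_le_iff(1)[OF n zero_le_power2 c] mem_Collect_eq atMost_iff)
  then show "measure M {\<omega> \<in> space M. X \<omega> \<le> c} = (\<Prod>j\<in>{1..n}. Law n v j {..gamma_mean v n * c\<^sup>2})"
    by (simp only: law(1)[OF atMost_borel])
  have "X \<omega> < c \<longleftrightarrow> (\<forall>i\<in>{1..n}. ?r * (cmod (\<zeta> i \<omega>))\<^sup>2 < c)" for \<omega>
  proof -
    have "X \<omega> < c \<longleftrightarrow> Max ((\<lambda>i. (cmod (\<zeta> i \<omega>))\<^sup>2) ` {1..n}) < c / ?r"
      using r by (simp add: X_def pos_less_divide_eq mult.commute)
    also have "\<dots> \<longleftrightarrow> (\<forall>i\<in>{1..n}. (cmod (\<zeta> i \<omega>))\<^sup>2 < c / ?r)" using n by (subst Max_less_iff) auto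
    finally show ?thesis using r by (simp add: pos_less_divide_eq mult.commute)
  qed
  then have e: "{\<omega> \<in> space M. X \<omega> < c}
      = {\<omega> \<in> space M. \<forall>i\<in>{1..n}. (cmod (\<zeta> i \<omega>))\<^sup>2 \<in> {s. (real n * s)\<^sup>2 \<in> {..<gamma_mean v n * c\<^sup>2}}}"
    by (simp only: scaled_le_iff(2)[OF n zero_le_power2 c] mem_Collect_eq lessThan_iff)
  have "{\<omega> \<in> space M. X \<omega> \<ge> c} = space M - {\<omega> \<in> space M. X \<omega> < c}" by auto
  then show "measure M {\<omega> \<in> space M. X \<omega> \<ge> c} = 1 - (\<Prod>j\<in>{1..n}. Law n v j {..<gamma_mean v n * c\<^sup>2})"
    using prob_compl[OF law(2)[OF lessThan_borel]] law(1)[OF lessThan_borel] by (simp only: e)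
qed

section \<open>Logarithmic tail estimates for fixed size\<close>

text \<open>The derivative of \<open>ln (D(j))\<close> at \<open>j = n\<close>, where \<open>D = gamma_mean v\<close>, and also the approximate
variance of \<open>ln ((n s)\<^sup>2)\<close> under the \<open>n\<close>-th law.\<close>

definition inv_scale :: "nat \<Rightarrow> nat \<Rightarrow> real" where
  "inv_scale n v = 1 / real n + 1 / real (n + v)"

lemma gamma_mean_pos: "j \<ge> 1 \<Longrightarrow> gamma_mean v j > 0"
  by (simp add: gamma_mean_def)

lemma gamma_mean_mono: "i \<le> j \<Longrightarrow> gamma_mean v i \<le> gamma_mean v j"
  unfolding gamma_mean_def by (intro mult_mono) auto

lemma gamma_mean_add:
  assumes n: "n \<ge> 1"
  shows "gamma_mean v (n + i) / gamma_mean v n = (1 + real i / real n) * (1 + real i / real (n + v))"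
  using n by (simp add: gamma_mean_def field_simps)

lemma gamma_mean_diff:
  assumes n: "n \<ge> 1" "m \<le> n"
  shows "gamma_mean v (n - m) / gamma_mean v n = (1 - real m / real n) * (1 - real m / real (n + v))"
  using n by (simp add: gamma_mean_def field_simps of_nat_diff)

lemma ln_gamma_mean_add_le:
  assumes n: "n \<ge> 1"
  shows "ln (gamma_mean v (n + i) / gamma_mean v n) \<le> real i * inv_scale n v"
proof -
  have "ln (gamma_mean v (n + i) / gamma_mean v n) = ln (1 + real i / real n) + ln (1 + real i / real (n + v))"
    unfolding gamma_mean_add[OF n] by (rule ln_mult_pos) (auto intro: add_pos_nonneg)
  also have "\<dots> \<le> real i / real n + real i / real (n + v)"
    by (intro add_mono ln_add_one_self_le_self) auto
  finally show ?thesis by (simp add: inv_scale_def field_simps)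
qed

lemma ln_gamma_mean_add_ge:
  assumes n: "n \<ge> 1" "i \<le> n"
  shows "ln (gamma_mean v (n + i) / gamma_mean v n) \<ge> real i * inv_scale n v - 2 * (real i)\<^sup>2 / (real n)\<^sup>2"
proof -
  have le: "real i / real (n + v) \<le> real i / real n" using n by (intro divide_left_mono) auto
  have 1: "ln (1 + y) \<ge> y - (real i)\<^sup>2 / (real n)\<^sup>2" if y: "0 \<le> y" "y \<le> real i / real n" for y
  proof -
    have "y \<le> 1" using y n by (auto intro: order_trans)
    then have "y - y\<^sup>2 \<le> ln (1 + y)" using y by (intro ln_one_plus_pos_lower_bound) auto
    moreover have "y\<^sup>2 \<le> (real i / real n)\<^sup>2" using y by (intro power_mono) auto
    ultimately show ?thesis by (simp add: power_divide)
  qed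
  have "ln (gamma_mean v (n + i) / gamma_mean v n) = ln (1 + real i / real n) + ln (1 + real i / real (n + v))"
    unfolding gamma_mean_add[OF n(1)] by (rule ln_mult_pos) (auto intro: add_pos_nonneg)
  with 1[of "real i / real n"] 1[of "real i / real (n + v)"] le show ?thesis
    by (simp add: inv_scale_def distrib_left)
qed

lemma ln_gamma_mean_diff_le:
  assumes n: "n \<ge> 1" "m < n"
  shows "ln (gamma_mean v (n - m) / gamma_mean v n) \<le> - real m * inv_scale n v"
proof -
  have pos: "1 - real m / real n > 0" "1 - real m / real (n + v) > 0" using n by (auto simp: field_simps)
  have "ln (gamma_mean v (n - m) / gamma_mean v n) = ln (1 - real m / real n) + ln (1 - real m / real (n + v))"
    unfolding gamma_mean_diff[OF n(1) less_imp_le[OF n(2)]] by (rule ln_mult_pos[OF pos])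
  also have "\<dots> \<le> (1 - real m / real n - 1) + (1 - real m / real (n + v) - 1)"
    by (intro add_mono ln_le_minus_one pos)
  finally show ?thesis by (simp add: inv_scale_def distrib_left)
qed

lemma ln_gamma_mean_diff_ge:
  assumes n: "n \<ge> 1" "2 * m \<le> n"
  shows "ln (gamma_mean v (n - m) / gamma_mean v n) \<ge> - real m * inv_scale n v - 4 * (real m)\<^sup>2 / (real n)\<^sup>2"
proof -
  have mn: "m < n" "m \<le> n" using n by auto
  have le: "real m / real (n + v) \<le> real m / real n" using n by (intro divide_left_mono) auto
  have pos: "1 - real m / real n > 0" "1 - real m / real (n + v) > 0" using mn by (auto simp: field_simps)
  have 1: "ln (1 - y) \<ge> - y - 2 * (real m)\<^sup>2 / (real n)\<^sup>2" if y: "0 \<le> y" "y \<le> real m / real n" for y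
  proof -
    have "real m / real n \<le> 1 / 2" using n by (simp add: field_simps)
    then have "y \<le> 1 / 2" using y by linarith
    then have "- y - 2 * y\<^sup>2 \<le> ln (1 - y)" using y by (intro ln_one_minus_pos_lower_bound) auto
    moreover have "y\<^sup>2 \<le> (real m / real n)\<^sup>2" using y by (intro power_mono) auto
    ultimately show ?thesis by (simp add: power_divide)
  qed
  have "ln (gamma_mean v (n - m) / gamma_mean v n) = ln (1 - real m / real n) + ln (1 - real m / real (n + v))"
    unfolding gamma_mean_diff[OF n(1) mn(2)] by (rule ln_mult_pos[OF pos])
  with 1[of "real m / real n"] 1[of "real m / real (n + v)"] le show ?thesis
    by (simp add: inv_scale_def distrib_left)
qed

text \<open>Here \<open>\<theta>\<close> is a free tilting parameter. The quadratic term sums the growth \<open>i s\<close> of \<open>ln (D(n + i))\<close>.\<close>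

lemma ln_upper_tail_le:
  fixes c :: real
  assumes n: "n \<ge> 1" and c: "c > 0"
    and p: "p = 1 - (\<Prod>j\<in>{1..n}. Law n v j {..<gamma_mean v n * c\<^sup>2})" "p > 0"
  shows "ln p \<le> ln (real n) + inv_scale n v * (real \<theta>)\<^sup>2 / 2 - 2 * real \<theta> * ln c"
proof -
  interpret size_biased_chain "radial_law n v" "\<lambda>s. (real n * s)\<^sup>2" "gamma_mean v"
    by (rule size_biased_radial_law[OF n])
  let ?D = "gamma_mean v" and ?s = "inv_scale n v"
  have pos: "?D (n + i) > 0" for i using n by (intro gamma_mean_pos) auto
  note D = pos[of 0, simplified]
  have f: "?D (n + i) / (?D n * c\<^sup>2) > 0" for i using pos[of i] D c by simp
  have s: "?s \<ge> 0" by (simp add: inv_scale_def)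
  have "p \<le> real n * (\<Prod>i<\<theta>. ?D (n + i) / (?D n * c\<^sup>2))"
    unfolding p(1) using n D c by (intro max_upper_tail_le) (auto intro: gamma_mean_mono)
  then have "ln p \<le> ln (real n * (\<Prod>i<\<theta>. ?D (n + i) / (?D n * c\<^sup>2)))"
    using p(2) by (intro ln_mono) auto
  also have "\<dots> = ln (real n) + (\<Sum>i<\<theta>. ln (?D (n + i) / (?D n * c\<^sup>2)))"
  proof -
    have "ln (\<Prod>i<\<theta>. ?D (n + i) / (?D n * c\<^sup>2)) = (\<Sum>i<\<theta>. ln (?D (n + i) / (?D n * c\<^sup>2)))"
      by (rule ln_prod) (simp, rule less_imp_neq[OF f, symmetric])
    moreover have "(\<Prod>i<\<theta>. ?D (n + i) / (?D n * c\<^sup>2)) > 0" by (rule prod_pos) (rule f)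
    ultimately show ?thesis using n by (subst ln_mult_pos) simp_all
  qed
  also have "(\<Sum>i<\<theta>. ln (?D (n + i) / (?D n * c\<^sup>2))) \<le> (\<Sum>i<\<theta>. real i * ?s - 2 * ln c)"
  proof (rule sum_mono)
    fix i
    have "ln (?D (n + i) / (?D n * c\<^sup>2)) = ln (?D (n + i) / ?D n) - 2 * ln c"
      using pos[of i] D c by (simp add: ln_div ln_mult ln_realpow)
    then show "ln (?D (n + i) / (?D n * c\<^sup>2)) \<le> real i * ?s - 2 * ln c"
      using ln_gamma_mean_add_le[OF n, of v i] by simp
  qed
  also have "\<dots> = (\<Sum>i<\<theta>. real i) * ?s - 2 * real \<theta> * ln c"
    by (simp add: sum_subtractf sum_distrib_right)
  also have "(\<Sum>i<\<theta>. real i) * ?s \<le> (real \<theta>)\<^sup>2 / 2 * ?s"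
  proof (rule mult_right_mono[OF _ s])
    show "(\<Sum>i<\<theta>. real i) \<le> (real \<theta>)\<^sup>2 / 2"
      by (induction \<theta>) (auto simp: power2_eq_square field_simps)
  qed
  finally show ?thesis by (simp add: mult_ac)
qed

text \<open>The assumptions on \<open>\<delta>\<close> say that the mean \<open>D(n + \<theta>)\<close> of the shifted law lies in the window with
margin \<open>\<delta>\<close>, and that Chebyshev's inequality then gives the window probability at least one half.\<close>

lemma ln_upper_tail_ge:
  fixes c c' :: real
  assumes n: "n \<ge> 1" "\<theta> \<le> n" and c: "0 < c" "c \<le> c'"
    and p: "p = 1 - (\<Prod>j\<in>{1..n}. Law n v j {..<gamma_mean v n * c\<^sup>2})"
    and \<delta>: "\<delta> > 0" "gamma_mean v n * c\<^sup>2 \<le> gamma_mean v (n + \<theta>) - \<delta>"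
      "gamma_mean v (n + \<theta>) + \<delta> \<le> gamma_mean v n * c'\<^sup>2"
      "gamma_mean v (n + \<theta>) * (2 * real (n + \<theta>) + 1 + real v) / \<delta>\<^sup>2 \<le> 1 / 2"
  shows "p > 0"
    and "ln p \<ge> - ln 2 + inv_scale n v * (real \<theta> * (real \<theta> - 1)) / 2
       - 2 * (real \<theta>) ^ 3 / (real n)\<^sup>2 - 2 * real \<theta> * ln c'"
proof -
  interpret size_biased_chain "radial_law n v" "\<lambda>s. (real n * s)\<^sup>2" "gamma_mean v"
    by (rule size_biased_radial_law[OF n(1)])
  let ?D = "gamma_mean v" and ?s = "inv_scale n v"
  have pos: "?D (n + i) > 0" for i using n by (intro gamma_mean_pos) auto
  note D = pos[of 0, simplified]
  have c': "c' > 0" using c by simp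
  have f: "?D (n + i) / (?D n * c'\<^sup>2) > 0" for i using pos[of i] D c' by simp
  have diff: "?D (Suc j) - ?D j = 2 * real j + 1 + real v" for j
    by (simp add: gamma_mean_def algebra_simps)
  have "law (n + \<theta>) {?D n * c\<^sup>2..?D n * c'\<^sup>2} \<ge> 1 - ?D (n + \<theta>) * (?D (Suc (n + \<theta>)) - ?D (n + \<theta>)) / \<delta>\<^sup>2"
    using n \<delta>(1-3) by (intro concentration) auto
  then have half: "law (n + \<theta>) {?D n * c\<^sup>2..?D n * c'\<^sup>2} \<ge> 1 / 2"
    using \<delta>(4) unfolding diff by linarith
  have "c\<^sup>2 \<le> c'\<^sup>2" using c by (intro power_mono) auto
  then have ge: "1 / 2 * (\<Prod>i<\<theta>. ?D (n + i) / (?D n * c'\<^sup>2)) \<le> p"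
    unfolding p using n D c half by (intro max_upper_tail_ge) auto
  have pp: "1 / 2 * (\<Prod>i<\<theta>. ?D (n + i) / (?D n * c'\<^sup>2)) > 0" using f by (simp add: prod_pos)
  with ge show "p > 0" by linarith
  have "ln (1 / 2 * (\<Prod>i<\<theta>. ?D (n + i) / (?D n * c'\<^sup>2))) \<le> ln p"
    using ge pp by (intro ln_mono) auto
  moreover have "ln (1 / 2 * (\<Prod>i<\<theta>. ?D (n + i) / (?D n * c'\<^sup>2))) = - ln 2 + (\<Sum>i<\<theta>. ln (?D (n + i) / (?D n * c'\<^sup>2)))"
  proof -
    have "ln (\<Prod>i<\<theta>. ?D (n + i) / (?D n * c'\<^sup>2)) = (\<Sum>i<\<theta>. ln (?D (n + i) / (?D n * c'\<^sup>2)))"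
      by (rule ln_prod) (simp, rule less_imp_neq[OF f, symmetric])
    moreover have "(\<Prod>i<\<theta>. ?D (n + i) / (?D n * c'\<^sup>2)) > 0" by (rule prod_pos) (rule f)
    moreover have "ln (1 / 2 :: real) = - ln 2" by (simp add: ln_div)
    ultimately show ?thesis by (subst ln_mult_pos) simp_all
  qed
  moreover have "(\<Sum>i<\<theta>. ln (?D (n + i) / (?D n * c'\<^sup>2))) \<ge> (\<Sum>i<\<theta>. real i * ?s - 2 * (real \<theta>)\<^sup>2 / (real n)\<^sup>2 - 2 * ln c')"
  proof (rule sum_mono)
    fix i assume i: "i \<in> {..<\<theta>}"
    have "ln (?D (n + i) / (?D n * c'\<^sup>2)) = ln (?D (n + i) / ?D n) - 2 * ln c'"
      using pos[of i] D c' by (simp add: ln_div ln_mult ln_realpow)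
    moreover have "2 * (real i)\<^sup>2 / (real n)\<^sup>2 \<le> 2 * (real \<theta>)\<^sup>2 / (real n)\<^sup>2"
      using i by (intro divide_right_mono mult_left_mono power_mono) auto
    ultimately show "ln (?D (n + i) / (?D n * c'\<^sup>2)) \<ge> real i * ?s - 2 * (real \<theta>)\<^sup>2 / (real n)\<^sup>2 - 2 * ln c'"
      using ln_gamma_mean_add_ge[OF n(1), of i v] i n(2) by simp
  qed
  moreover have "(\<Sum>i<\<theta>. real i * ?s - 2 * (real \<theta>)\<^sup>2 / (real n)\<^sup>2 - 2 * ln c')
      = (\<Sum>i<\<theta>. real i) * ?s - 2 * (real \<theta>) ^ 3 / (real n)\<^sup>2 - 2 * real \<theta> * ln c'"
    by (simp add: sum_subtractf sum_distrib_right power2_eq_square power3_eq_cube)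
  moreover have "(\<Sum>i<\<theta>. real i) = real \<theta> * (real \<theta> - 1) / 2"
    by (induction \<theta>) (auto simp: field_simps)
  ultimately show "ln p \<ge> - ln 2 + ?s * (real \<theta> * (real \<theta> - 1)) / 2
       - 2 * (real \<theta>) ^ 3 / (real n)\<^sup>2 - 2 * real \<theta> * ln c'"
    by (simp add: mult_ac)
qed

lemma sum_index: "(\<Sum>m\<in>{1..K}. real m) = real K * (real K + 1) / 2"
  by (induction K) (auto simp: field_simps)

lemma sum_index_square: "(\<Sum>m\<in>{1..K}. (real m)\<^sup>2) = real K * (real K + 1) * (2 * real K + 1) / 6"
  by (induction K) (auto simp: field_simps power2_eq_square)

lemma ln_lower_tail_le:
  fixes c :: real
  assumes n: "n \<ge> 1" "2 * K \<le> n" and c: "c > 0"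
    and p: "p = (\<Prod>j\<in>{1..n}. Law n v j {..gamma_mean v n * c\<^sup>2})" "p > 0"
  shows "ln p \<le> ln c * (real K * (real K + 1))
      + inv_scale n v * (real K * (real K + 1) * (2 * real K + 1)) / 6 + 4 * (real K) ^ 4 / (real n)\<^sup>2"
proof -
  interpret size_biased_chain "radial_law n v" "\<lambda>s. (real n * s)\<^sup>2" "gamma_mean v"
    by (rule size_biased_radial_law[OF n(1)])
  let ?D = "gamma_mean v" and ?s = "inv_scale n v"
  have K: "K < n" using n by simp
  have pos: "?D (n - m) > 0" if "m \<le> K" for m using K that by (intro gamma_mean_pos) auto
  note D = pos[of 0, simplified]
  have f: "?D n * c\<^sup>2 / ?D (n - m) > 0" if "m \<le> K" for m using pos[OF that] D c by simp
  have "p \<le> (\<Prod>m\<in>{1..K}. (?D n * c\<^sup>2 / ?D (n - m)) ^ m)"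
    unfolding p(1) using K D c by (intro max_lower_tail_le) auto
  then have "ln p \<le> ln (\<Prod>m\<in>{1..K}. (?D n * c\<^sup>2 / ?D (n - m)) ^ m)"
    using p(2) by (intro ln_mono) auto
  also have "\<dots> = (\<Sum>m\<in>{1..K}. ln ((?D n * c\<^sup>2 / ?D (n - m)) ^ m))"
    by (rule ln_prod) (simp, rule less_imp_neq[OF zero_less_power[OF f], symmetric], simp)
  also have "\<dots> \<le> (\<Sum>m\<in>{1..K}. 2 * ln c * real m + ?s * (real m)\<^sup>2 + 4 * (real K) ^ 3 / (real n)\<^sup>2)"
  proof (rule sum_mono)
    fix m assume m: "m \<in> {1..K}"
    have "ln ((?D n * c\<^sup>2 / ?D (n - m)) ^ m) = real m * (2 * ln c - ln (?D (n - m) / ?D n))"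
      using pos[of m] D c m f[of m] by (simp add: ln_realpow ln_div ln_mult)
    also have "\<dots> \<le> real m * (2 * ln c + real m * ?s + 4 * (real m)\<^sup>2 / (real n)\<^sup>2)"
      using ln_gamma_mean_diff_ge[OF n(1), of m v] m n(2) by (intro mult_left_mono) auto
    also have "\<dots> = 2 * ln c * real m + ?s * (real m)\<^sup>2 + 4 * (real m) ^ 3 / (real n)\<^sup>2"
      by (simp add: algebra_simps power2_eq_square power3_eq_cube)
    also have "4 * (real m) ^ 3 / (real n)\<^sup>2 \<le> 4 * (real K) ^ 3 / (real n)\<^sup>2"
      using m by (intro divide_right_mono mult_left_mono power_mono) auto
    finally show "ln ((?D n * c\<^sup>2 / ?D (n - m)) ^ m) \<le> 2 * ln c * real m + ?s * (real m)\<^sup>2 + 4 * (real K) ^ 3 / (real n)\<^sup>2"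
      by simp
  qed
  also have "\<dots> = 2 * ln c * (\<Sum>m\<in>{1..K}. real m) + ?s * (\<Sum>m\<in>{1..K}. (real m)\<^sup>2) + 4 * (real K) ^ 4 / (real n)\<^sup>2"
    by (simp add: sum.distrib sum_distrib_left power4_eq_xxxx power3_eq_cube)
  also have "2 * ln c * (\<Sum>m\<in>{1..K}. real m) = ln c * (real K * (real K + 1))"
    unfolding sum_index by simp
  finally show ?thesis unfolding sum_index_square by (simp only: times_divide_eq_right)
qed

lemma ln_lower_tail_ge:
  fixes c c' :: real
  assumes n: "n \<ge> 1" "K < n" and c: "0 < c'" "c' \<le> c"
    and p: "p = (\<Prod>j\<in>{1..n}. Law n v j {..gamma_mean v n * c\<^sup>2})"
    and \<delta>: "\<delta> > 0" "gamma_mean v n * c'\<^sup>2 \<le> gamma_mean v (n - K) - \<delta>"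
      "gamma_mean v (n - K) + \<delta> \<le> gamma_mean v n * c\<^sup>2"
      "gamma_mean v n * (2 * real n + 1 + real v) / \<delta>\<^sup>2 \<le> 1 / 2"
  shows "p > 0"
    and "ln p \<ge> - real n * ln 2 + ln c' * (real K * (real K + 1))
      + inv_scale n v * (real K * (real K + 1) * (2 * real K + 1)) / 6"
proof -
  interpret size_biased_chain "radial_law n v" "\<lambda>s. (real n * s)\<^sup>2" "gamma_mean v"
    by (rule size_biased_radial_law[OF n(1)])
  let ?D = "gamma_mean v" and ?s = "inv_scale n v"
  have pos: "?D (n - m) > 0" if "m \<le> K" for m using n that by (intro gamma_mean_pos) auto
  note D = pos[of 0, simplified]
  have f: "?D n * c'\<^sup>2 / ?D (n - m) > 0" if "m \<le> K" for m using pos[OF that] D c by simp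
  have diff: "?D (Suc j) - ?D j = 2 * real j + 1 + real v" for j
    by (simp add: gamma_mean_def algebra_simps)
  \<comment> \<open>The variance grows with the index, so the margin chosen for \<open>n\<close> serves all smaller indices.\<close>
  have half: "law j B \<ge> 1 / 2" if j: "1 \<le> j" "j \<le> n" and B: "B \<in> sets borel" "{?D j - \<delta><..<?D j + \<delta>} \<subseteq> B" for j B
  proof -
    have "?D j * (2 * real j + 1 + real v) / \<delta>\<^sup>2 \<le> ?D n * (2 * real n + 1 + real v) / \<delta>\<^sup>2"
      using j D by (intro divide_right_mono mult_mono gamma_mean_mono) auto
    with \<delta>(4) concentration[OF j(1) \<delta>(1) B] show ?thesis unfolding diff by linarith
  qed
  have h1: "law (n - K) {?D n * c'\<^sup>2..?D n * c\<^sup>2} \<ge> 1 / 2" using n \<delta> by (intro half) auto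
  have h2: "law j {..?D n * c\<^sup>2} \<ge> 1 / 2" if j: "1 \<le> j" "j \<le> n - K" for j
    using n \<delta> j gamma_mean_mono[of j "n - K" v] by (intro half) auto
  have "c'\<^sup>2 \<le> c\<^sup>2" using c by (intro power_mono) auto
  then have ge: "(1 / 2) ^ n * (\<Prod>m\<in>{1..K}. (?D n * c'\<^sup>2 / ?D (n - m)) ^ m) \<le> p"
    unfolding p using n D c h1 h2 by (intro max_lower_tail_ge) auto
  have pp: "(1 / 2) ^ n * (\<Prod>m\<in>{1..K}. (?D n * c'\<^sup>2 / ?D (n - m)) ^ m) > 0"
    using f by (intro mult_pos_pos prod_pos) auto
  with ge show "p > 0" by linarith
  have "ln ((1 / 2) ^ n * (\<Prod>m\<in>{1..K}. (?D n * c'\<^sup>2 / ?D (n - m)) ^ m)) \<le> ln p"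
    using ge pp by (intro ln_mono) auto
  moreover have "ln ((1 / 2) ^ n * (\<Prod>m\<in>{1..K}. (?D n * c'\<^sup>2 / ?D (n - m)) ^ m))
      = - real n * ln 2 + (\<Sum>m\<in>{1..K}. ln ((?D n * c'\<^sup>2 / ?D (n - m)) ^ m))"
  proof -
    have "ln ((1 / 2 :: real) ^ n) = - real n * ln 2" by (simp add: ln_realpow ln_div)
    moreover have "ln (\<Prod>m\<in>{1..K}. (?D n * c'\<^sup>2 / ?D (n - m)) ^ m) = (\<Sum>m\<in>{1..K}. ln ((?D n * c'\<^sup>2 / ?D (n - m)) ^ m))"
      by (rule ln_prod) (simp, rule less_imp_neq[OF zero_less_power[OF f], symmetric], simp)
    ultimately show ?thesis
      using f by (subst ln_mult_pos) (auto intro!: prod_pos)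
  qed
  moreover have "(\<Sum>m\<in>{1..K}. ln ((?D n * c'\<^sup>2 / ?D (n - m)) ^ m)) \<ge> (\<Sum>m\<in>{1..K}. 2 * ln c' * real m + ?s * (real m)\<^sup>2)"
  proof (rule sum_mono)
    fix m assume m: "m \<in> {1..K}"
    have "2 * ln c' * real m + ?s * (real m)\<^sup>2 = real m * (2 * ln c' + real m * ?s)"
      by (simp add: algebra_simps power2_eq_square)
    also have "\<dots> \<le> real m * (2 * ln c' - ln (?D (n - m) / ?D n))"
      using ln_gamma_mean_diff_le[OF n(1), of m v] m n(2) by (intro mult_left_mono) auto
    also have "\<dots> = ln ((?D n * c'\<^sup>2 / ?D (n - m)) ^ m)"
      using pos[of m] D c m f[of m] by (simp add: ln_realpow ln_div ln_mult)
    finally show "2 * ln c' * real m + ?s * (real m)\<^sup>2 \<le> ln ((?D n * c'\<^sup>2 / ?D (n - m)) ^ m)" .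
  qed
  moreover have "(\<Sum>m\<in>{1..K}. 2 * ln c' * real m + ?s * (real m)\<^sup>2)
      = 2 * ln c' * (\<Sum>m\<in>{1..K}. real m) + ?s * (\<Sum>m\<in>{1..K}. (real m)\<^sup>2)"
    by (simp add: sum.distrib sum_distrib_left)
  moreover have "2 * ln c' * (\<Sum>m\<in>{1..K}. real m) = ln c' * (real K * (real K + 1))"
    unfolding sum_index by simp
  moreover have "?s * (\<Sum>m\<in>{1..K}. (real m)\<^sup>2) = ?s * (real K * (real K + 1) * (2 * real K + 1)) / 6"
    unfolding sum_index_square by (simp only: times_divide_eq_right)
  ultimately show "ln p \<ge> - real n * ln 2 + ln c' * (real K * (real K + 1))
      + ?s * (real K * (real K + 1) * (2 * real K + 1)) / 6"
    by linarith
qed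

section \<open>Passage to the limit\<close>

text \<open>The upper bounds below are sharp in the limit, whereas the lower bounds lose a margin \<open>\<epsilon>\<close> that can
be made arbitrarily small only after \<open>n\<close> has tended to infinity.\<close>

lemma tendsto_squeeze_family:
  fixes f h :: "nat \<Rightarrow> real" and G :: "real \<Rightarrow> real"
  assumes upper: "eventually (\<lambda>n. f n \<le> h n) sequentially" and h: "h \<longlonglongrightarrow> L"
    and lower: "\<And>\<epsilon>. \<epsilon> > 0 \<Longrightarrow> \<exists>g. g \<longlonglongrightarrow> G \<epsilon> \<and> eventually (\<lambda>n. g n \<le> f n) sequentially"
    and G: "(G \<longlongrightarrow> L) (at_right 0)"
  shows "f \<longlonglongrightarrow> L"
proof (rule order_tendstoI)
  fix a assume "a < L"
  with G have "eventually (\<lambda>\<epsilon>. a < G \<epsilon>) (at_right 0)" by (rule order_tendstoD)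
  moreover have "eventually (\<lambda>\<epsilon>. \<epsilon> > (0::real)) (at_right 0)" by (rule eventually_at_right_less)
  ultimately have "eventually (\<lambda>\<epsilon>. a < G \<epsilon> \<and> \<epsilon> > 0) (at_right 0)" by eventually_elim simp
  then obtain \<epsilon> where \<epsilon>: "a < G \<epsilon>" "\<epsilon> > 0"
    using eventually_happens'[OF trivial_limit_at_right_real] by blast
  then obtain g where g: "g \<longlonglongrightarrow> G \<epsilon>" "eventually (\<lambda>n. g n \<le> f n) sequentially" using lower by blast
  from order_tendstoD(1)[OF g(1) \<epsilon>(1)] g(2) show "eventually (\<lambda>n. a < f n) sequentially"
    by eventually_elim simp
next
  fix a assume "L < a"
  from order_tendstoD(2)[OF h this] upper show "eventually (\<lambda>n. f n < a) sequentially"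
    by eventually_elim simp
qed

text \<open>If \<open>v n / n\<close> tends to \<open>\<alpha>\<close>, then \<open>\<sigma>\<close> is \<open>(2 + \<alpha>) / (1 + \<alpha>)\<close>, or \<open>1\<close> if \<open>\<alpha>\<close> is infinite. The last assumption lets the
deviations \<open>l\<close> exceed the typical fluctuations, which have order \<open>1 / sqrt n\<close>.\<close>

locale scaling =
  fixes v :: "nat \<Rightarrow> nat" and l :: "nat \<Rightarrow> real" and \<sigma> :: real
  assumes \<sigma>: "(\<lambda>n. real n * inv_scale n (v n)) \<longlonglongrightarrow> \<sigma>" and \<sigma>_pos: "\<sigma> > 0"
    and l_pos: "n \<ge> 1 \<Longrightarrow> l n > 0" and l_0: "l \<longlonglongrightarrow> 0"
    and nl2: "(\<lambda>n. 1 / (real n * (l n)\<^sup>2)) \<longlonglongrightarrow> 0"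
begin

lemma nl: "(\<lambda>n. 1 / (real n * l n)) \<longlonglongrightarrow> 0"
proof -
  have "(\<lambda>n. l n * (1 / (real n * (l n)\<^sup>2))) \<longlonglongrightarrow> 0 * 0" by (rule tendsto_mult[OF l_0 nl2])
  moreover have "eventually (\<lambda>n. l n * (1 / (real n * (l n)\<^sup>2)) = 1 / (real n * l n)) sequentially"
    using eventually_ge_at_top[of 1] by eventually_elim (use l_pos in \<open>simp add: power2_eq_square\<close>)
  ultimately show ?thesis by (simp add: filterlim_cong)
qed

text \<open>The minimiser of \<open>s \<theta>\<^sup>2 / 2 - 2 l y \<theta>\<close>, rounded down. Shifting the top law by this amount, up or
down, moves its mean to about \<open>D(n) (1 \<plusminus> l y)\<^sup>2\<close>.\<close>

definition shift :: "real \<Rightarrow> nat \<Rightarrow> nat" where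
  "shift y n = nat \<lfloor>2 * l n * y / inv_scale n (v n)\<rfloor>"

text \<open>The shift in its natural unit \<open>n l\<close>, in which it has a limit; all bounds become polynomials in \<open>q\<close>
with convergent coefficients.\<close>

definition q :: "real \<Rightarrow> nat \<Rightarrow> real" where
  "q y n = real (shift y n) / (real n * l n)"

lemma shift_q: "n \<ge> 1 \<Longrightarrow> real (shift y n) = q y n * (real n * l n)"
  using l_pos[of n] by (simp add: q_def)

lemma inv_scale_pos: "n \<ge> 1 \<Longrightarrow> inv_scale n (v n) > 0"
  by (simp add: inv_scale_def add_pos_nonneg)

lemma q_lim:
  assumes y: "y > 0"
  shows "q y \<longlonglongrightarrow> 2 * y / \<sigma>"
proof (rule tendsto_sandwich)
  let ?a = "\<lambda>n. 2 * y / (real n * inv_scale n (v n))"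
  have a: "?a \<longlonglongrightarrow> 2 * y / \<sigma>" using \<sigma>_pos by (intro tendsto_intros \<sigma>) simp
  have bounds: "?a n - 1 / (real n * l n) \<le> q y n \<and> q y n \<le> ?a n" if n: "n \<ge> 1" for n
  proof -
    define b where "b = 2 * l n * y / inv_scale n (v n)"
    have pos: "l n > 0" "inv_scale n (v n) > 0" using n l_pos inv_scale_pos by auto
    have "b \<ge> 0" using pos y by (simp add: b_def)
    then have "b - 1 \<le> real (shift y n)" "real (shift y n) \<le> b"
      unfolding shift_def b_def[symmetric] by linarith+
    then have "(b - 1) / (real n * l n) \<le> q y n" "q y n \<le> b / (real n * l n)"
      unfolding q_def using pos n by (auto intro!: divide_right_mono)
    moreover have "b / (real n * l n) = ?a n" unfolding b_def using pos n by (simp add: field_simps)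
    ultimately show ?thesis by (simp add: diff_divide_distrib)
  qed
  show "eventually (\<lambda>n. ?a n - 1 / (real n * l n) \<le> q y n) sequentially"
    using eventually_ge_at_top[of 1] by (rule eventually_mono) (use bounds in blast)
  show "eventually (\<lambda>n. q y n \<le> ?a n) sequentially"
    using eventually_ge_at_top[of 1] by (rule eventually_mono) (use bounds in blast)
  show "(\<lambda>n. ?a n - 1 / (real n * l n)) \<longlonglongrightarrow> 2 * y / \<sigma>"
    using tendsto_diff[OF a nl] by simp
  show "?a \<longlonglongrightarrow> 2 * y / \<sigma>" by (rule a)
qed

lemma q_nonneg: "n \<ge> 1 \<Longrightarrow> q y n \<ge> 0"
  using l_pos[of n] by (simp add: q_def)

lemma shift_small:
  assumes y: "y > 0"
  shows "eventually (\<lambda>n. 2 * shift y n < n) sequentially"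
proof -
  have "(\<lambda>n. q y n * l n) \<longlonglongrightarrow> 2 * y / \<sigma> * 0" by (intro tendsto_mult q_lim y l_0)
  then have "eventually (\<lambda>n. q y n * l n < 1 / 2) sequentially" by (rule order_tendstoD) simp
  then show ?thesis using eventually_ge_at_top[of 1]
  proof eventually_elim
    case (elim n)
    have "real (shift y n) = (q y n * l n) * real n" using shift_q[of n y] elim by simp
    also have "\<dots> < 1 / 2 * real n" using elim by (intro mult_strict_right_mono) auto
    finally have "real (2 * shift y n) < real n" by simp
    then show ?case by (simp only: of_nat_less_iff)
  qed
qed

text \<open>The contribution of the product \<open>(\<theta> / n) (\<theta> / (n + v))\<close> to the relative change of the mean, divided
by \<open>l\<close>. It is of second order.\<close>

definition cross :: "real \<Rightarrow> nat \<Rightarrow> real" where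
  "cross y n = (q y n)\<^sup>2 * l n * (real n / real (n + v n))"

lemma cross_0:
  assumes y: "y > 0"
  shows "cross y \<longlonglongrightarrow> 0"
proof (rule Lim_null_comparison)
  show "(\<lambda>n. (q y n)\<^sup>2 * l n) \<longlonglongrightarrow> 0"
    using tendsto_mult[OF tendsto_power[OF q_lim[OF y], of 2] l_0] by simp
  show "eventually (\<lambda>n. norm (cross y n) \<le> (q y n)\<^sup>2 * l n) sequentially"
    using eventually_ge_at_top[of 1]
  proof eventually_elim
    case (elim n)
    have l: "l n > 0" using l_pos elim by simp
    have "(q y n)\<^sup>2 * l n * (real n / real (n + v n)) \<le> (q y n)\<^sup>2 * l n * 1"
      using l elim by (intro mult_left_mono) auto
    then show ?case using l by (simp add: cross_def abs_mult)
  qed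
qed

lemma shift_ratios:
  assumes n: "n \<ge> 1"
  shows "real (shift y n) / real n = q y n * l n"
    and "real (shift y n) / real (n + v n) = q y n * l n * (real n / real (n + v n))"
    and "real n * inv_scale n (v n) = 1 + real n / real (n + v n)"
  unfolding shift_q[OF n] inv_scale_def using n by (simp_all add: distrib_left)

lemma gamma_mean_shift_up:
  assumes n: "n \<ge> 1"
  shows "gamma_mean (v n) (n + shift y n)
     = gamma_mean (v n) n * (1 + l n * (q y n * (real n * inv_scale n (v n)) + cross y n))"
proof -
  let ?D = "gamma_mean (v n)"
  have D: "?D n > 0" using n by (rule gamma_mean_pos)
  define \<rho> where "\<rho> = real n / real (n + v n)"
  have "?D (n + shift y n) / ?D n
      = 1 + l n * (q y n * (real n * inv_scale n (v n)) + cross y n)"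
    unfolding gamma_mean_add[OF n] shift_ratios[OF n] cross_def \<rho>_def[symmetric]
    by (simp add: algebra_simps power2_eq_square)
  then show ?thesis using D by (simp add: field_simps)
qed

lemma gamma_mean_shift_down:
  assumes n: "n \<ge> 1" "shift y n \<le> n"
  shows "gamma_mean (v n) (n - shift y n)
     = gamma_mean (v n) n * (1 + l n * (cross y n - q y n * (real n * inv_scale n (v n))))"
proof -
  let ?D = "gamma_mean (v n)"
  have D: "?D n > 0" using n by (intro gamma_mean_pos)
  define \<rho> where "\<rho> = real n / real (n + v n)"
  have "?D (n - shift y n) / ?D n
      = 1 + l n * (cross y n - q y n * (real n * inv_scale n (v n)))"
    unfolding gamma_mean_diff[OF n] shift_ratios[OF n(1)] cross_def \<rho>_def[symmetric]
    by (simp add: algebra_simps power2_eq_square)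
  then show ?thesis using D by (simp add: field_simps)
qed

lemma square_increment: "(1 + l n * x)\<^sup>2 = 1 + l n * (2 * x + l n * x\<^sup>2)"
  by (simp add: power2_eq_square algebra_simps)

lemma square_increment_lim: "(\<lambda>n. 2 * x + l n * x\<^sup>2) \<longlonglongrightarrow> 2 * x"
  using tendsto_add[OF tendsto_const tendsto_mult_right[OF l_0, of "x\<^sup>2"], of "2 * x"] by simp

text \<open>The variance condition of the finite estimates, with margin \<open>\<delta> = \<epsilon> l D(n)\<close>. The relative variance
is about \<open>s\<close>, and \<open>s / l\<^sup>2\<close> tends to \<open>0\<close>. The ratio \<open>R\<close> and the increment \<open>m\<close> make the statement
applicable to an index slightly above \<open>n\<close>.\<close>

lemma variance_bound_lim:
  assumes \<epsilon>: "\<epsilon> > 0" and r: "r \<longlonglongrightarrow> 0" and m: "eventually (\<lambda>n. 0 \<le> m n \<and> m n \<le> real n * r n) sequentially"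
    and R: "R \<longlonglongrightarrow> 1"
  shows "eventually (\<lambda>n. gamma_mean (v n) n * R n * (2 * real n + m n + 1 + real (v n))
       / (\<epsilon> * l n * gamma_mean (v n) n)\<^sup>2 \<le> 1 / 2) sequentially"
proof -
  let ?h = "\<lambda>n. R n * (real n * inv_scale n (v n) + r n + 1 / real n) / \<epsilon>\<^sup>2 * (1 / (real n * (l n)\<^sup>2))"
  have "?h \<longlonglongrightarrow> 1 * (\<sigma> + 0 + 0) / \<epsilon>\<^sup>2 * 0"
    using \<epsilon> by (intro tendsto_intros R \<sigma> r nl2 lim_1_over_n) auto
  then have "eventually (\<lambda>n. ?h n < 1 / 2) sequentially" by (rule order_tendstoD) simp
  moreover have "eventually (\<lambda>n. R n > 0) sequentially" using R by (rule order_tendstoD) simp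
  ultimately show ?thesis using m eventually_ge_at_top[of 1]
  proof eventually_elim
    case (elim n)
    let ?N = "real n + real (v n)"
    have l: "l n > 0" using elim l_pos by simp
    have N: "?N > 0" "real n \<le> ?N" using elim by auto
    have D: "gamma_mean (v n) n = real n * ?N" by (simp add: gamma_mean_def)
    have s: "real n * inv_scale n (v n) = (2 * real n + real (v n)) / ?N"
    proof -
      have "(2 * real n + real (v n)) / ?N = (?N + real n) / ?N" by simp
      also have "\<dots> = ?N / ?N + real n / ?N" by (rule add_divide_distrib)
      also have "?N / ?N = 1" using N by simp
      finally show ?thesis using shift_ratios(3)[OF elim(4)] by (simp only: of_nat_add)
    qed
    have "(m n + 1) / ?N \<le> (m n + 1) / real n" using elim N by (intro divide_left_mono) auto
    also have "\<dots> \<le> r n + 1 / real n" using elim by (simp add: field_simps)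
    finally have mr: "(m n + 1) / ?N \<le> r n + 1 / real n" .
    have "gamma_mean (v n) n * R n * (2 * real n + m n + 1 + real (v n)) / (\<epsilon> * l n * gamma_mean (v n) n)\<^sup>2
        = R n * ((2 * real n + real (v n)) / ?N + (m n + 1) / ?N) / \<epsilon>\<^sup>2 * (1 / (real n * (l n)\<^sup>2))"
      unfolding D using elim N l \<epsilon> by (simp add: power2_eq_square divide_simps)
    also have "\<dots> \<le> ?h n"
      unfolding s using mr elim l \<epsilon> by (intro mult_right_mono divide_right_mono mult_left_mono) auto
    finally show ?case using elim by linarith
  qed
qed

lemma ln_increment_lim:
  "(\<lambda>n. ln (1 + l n * x) / l n) \<longlonglongrightarrow> x"
proof -
  have "((\<lambda>h::real. ln (1 + h * x) / h) \<longlongrightarrow> x) (at_right 0)"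
  proof (cases "x = 0")
    case False
    then show ?thesis by real_asymp
  qed simp
  moreover have "filterlim l (at_right 0) sequentially"
    using l_0 eventually_mono[OF eventually_ge_at_top[of 1] l_pos] by (rule tendsto_imp_filterlim_at_right)
  ultimately show ?thesis by (rule filterlim_compose)
qed

text \<open>For the lower bound the window runs from \<open>x\<close> to \<open>x + 2 \<epsilon>\<close> and the law is shifted to its midpoint
\<open>x + \<epsilon>\<close>.\<close>

lemma upper_tail_limit:
  assumes x: "x > 0" and ln: "(\<lambda>n. ln (real n) / (real n * (l n)\<^sup>2)) \<longlonglongrightarrow> 0"
    and p: "\<And>n. n \<ge> 1 \<Longrightarrow> p n = 1 - (\<Prod>j\<in>{1..n}. Law n (v n) j {..<gamma_mean (v n) n * (1 + l n * x)\<^sup>2})"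
  shows "(\<lambda>n. 1 / (real n * (l n)\<^sup>2) * ln (p n)) \<longlonglongrightarrow> - 2 * x\<^sup>2 / \<sigma>"
proof -
  let ?s = "\<lambda>n. inv_scale n (v n)"
  let ?f = "\<lambda>n. 1 / (real n * (l n)\<^sup>2) * ln (p n)"
  let ?g = "\<lambda>\<epsilon> n. - ln 2 * (1 / (real n * (l n)\<^sup>2))
      + real n * ?s n * (q (x + \<epsilon>) n * (q (x + \<epsilon>) n - 1 / (real n * l n))) / 2
      - 2 * (q (x + \<epsilon>) n) ^ 3 * l n - 2 * q (x + \<epsilon>) n * (ln (1 + l n * (x + 2 * \<epsilon>)) / l n)"
  let ?G = "\<lambda>\<epsilon>. - ln 2 * 0 + \<sigma> * (2 * (x + \<epsilon>) / \<sigma> * (2 * (x + \<epsilon>) / \<sigma> - 0)) / 2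
      - 2 * (2 * (x + \<epsilon>) / \<sigma>) ^ 3 * 0 - 2 * (2 * (x + \<epsilon>) / \<sigma>) * (x + 2 * \<epsilon>)"
  have lower: "eventually (\<lambda>n. p n > 0 \<and> ?g \<epsilon> n \<le> ?f n) sequentially" if \<epsilon>: "\<epsilon> > 0" for \<epsilon>
  proof -
    let ?y = "x + \<epsilon>" and ?x' = "x + 2 * \<epsilon>"
    have y: "?y > 0" using x \<epsilon> by simp
    \<comment> \<open>The displacement of the shifted mean relative to \<open>D(n)\<close>, in units of \<open>l\<close>. Its limit \<open>2 y\<close> lies
strictly between the displacements \<open>2 x\<close> and \<open>2 x'\<close> of the two thresholds.\<close>
    let ?E = "\<lambda>n. q ?y n * (real n * ?s n) + cross ?y n"
    have E: "?E \<longlonglongrightarrow> 2 * ?y"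
    proof -
      have "?E \<longlonglongrightarrow> 2 * ?y / \<sigma> * \<sigma> + 0" by (intro tendsto_intros q_lim y \<sigma> cross_0)
      then show ?thesis using \<sigma>_pos by simp
    qed
    have "(\<lambda>n. ?E n - (2 * x + l n * x\<^sup>2)) \<longlonglongrightarrow> 2 * ?y - 2 * x"
      by (intro tendsto_diff E square_increment_lim)
    then have e1: "eventually (\<lambda>n. \<epsilon> < ?E n - (2 * x + l n * x\<^sup>2)) sequentially"
      by (rule order_tendstoD) (use \<epsilon> in simp)
    have "(\<lambda>n. (2 * ?x' + l n * ?x'\<^sup>2) - ?E n) \<longlonglongrightarrow> 2 * ?x' - 2 * ?y"
      by (intro tendsto_diff E square_increment_lim)
    then have e2: "eventually (\<lambda>n. \<epsilon> < (2 * ?x' + l n * ?x'\<^sup>2) - ?E n) sequentially"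
      by (rule order_tendstoD) (use \<epsilon> in simp)
    have R: "(\<lambda>n. 1 + l n * ?E n) \<longlonglongrightarrow> 1"
      using tendsto_add[OF tendsto_const tendsto_mult[OF l_0 E], of 1] by simp
    have r: "(\<lambda>n. 2 * q ?y n * l n) \<longlonglongrightarrow> 0"
      using tendsto_mult[OF tendsto_mult[OF tendsto_const q_lim[OF y], of 2] l_0] by simp
    have m: "eventually (\<lambda>n. 0 \<le> 2 * real (shift ?y n) \<and> 2 * real (shift ?y n) \<le> real n * (2 * q ?y n * l n)) sequentially"
      using eventually_ge_at_top[of 1] by eventually_elim (simp add: shift_q q_nonneg l_pos less_imp_le)
    note var = variance_bound_lim[OF \<epsilon> r m R]
    from e1 e2 var shift_small[OF y] eventually_ge_at_top[of 1] show ?thesis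
    proof eventually_elim
      case (elim n)
      have n: "n \<ge> 1" "shift ?y n \<le> n" using elim by auto
      have l: "l n > 0" using l_pos n by simp
      have D: "gamma_mean (v n) n > 0" using n by (intro gamma_mean_pos)
      let ?\<delta> = "\<epsilon> * l n * gamma_mean (v n) n"
      have up: "gamma_mean (v n) (n + shift ?y n) = gamma_mean (v n) n * (1 + l n * ?E n)"
        by (rule gamma_mean_shift_up[OF n(1)])
      have c: "0 < 1 + l n * x" "1 + l n * x \<le> 1 + l n * ?x'"
        using l x \<epsilon> by (auto intro: add_pos_pos)
      have \<delta>: "?\<delta> > 0" using \<epsilon> l D by simp
      have d1: "gamma_mean (v n) n * (1 + l n * x)\<^sup>2 \<le> gamma_mean (v n) (n + shift ?y n) - ?\<delta>"
      proof -
        have "l n * (\<epsilon> + (2 * x + l n * x\<^sup>2)) \<le> l n * ?E n" using elim l by (intro mult_left_mono) auto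
        then have "gamma_mean (v n) n * (1 + l n * (\<epsilon> + (2 * x + l n * x\<^sup>2))) \<le> gamma_mean (v n) n * (1 + l n * ?E n)"
          using D by (intro mult_left_mono) auto
        then show ?thesis unfolding up square_increment by (simp add: algebra_simps)
      qed
      have d2: "gamma_mean (v n) (n + shift ?y n) + ?\<delta> \<le> gamma_mean (v n) n * (1 + l n * ?x')\<^sup>2"
      proof -
        have "l n * (\<epsilon> + ?E n) \<le> l n * (2 * ?x' + l n * ?x'\<^sup>2)" using elim l by (intro mult_left_mono) auto
        then have "gamma_mean (v n) n * (1 + l n * (\<epsilon> + ?E n)) \<le> gamma_mean (v n) n * (1 + l n * (2 * ?x' + l n * ?x'\<^sup>2))"
          using D by (intro mult_left_mono) auto
        then show ?thesis unfolding up square_increment[of n ?x'] by (simp add: algebra_simps)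
      qed
      have d3: "gamma_mean (v n) (n + shift ?y n) * (2 * real (n + shift ?y n) + 1 + real (v n)) / ?\<delta>\<^sup>2 \<le> 1 / 2"
        using elim unfolding up by (simp add: algebra_simps)
      note * = ln_upper_tail_ge[OF n c p[OF n(1)] \<delta> d1 d2 d3]
      have "?g \<epsilon> n = 1 / (real n * (l n)\<^sup>2) * (- ln 2 + ?s n * (real (shift ?y n) * (real (shift ?y n) - 1)) / 2
       - 2 * (real (shift ?y n)) ^ 3 / (real n)\<^sup>2 - 2 * real (shift ?y n) * ln (1 + l n * ?x'))"
        unfolding shift_q[OF n(1)] using n l by (simp add: field_simps power2_eq_square power3_eq_cube)
      also have "\<dots> \<le> ?f n" using *(2) l n by (intro mult_left_mono) auto
      finally show ?case using *(1) by simp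
    qed
  qed
  let ?h = "\<lambda>n. ln (real n) / (real n * (l n)\<^sup>2) + real n * ?s n * (q x n)\<^sup>2 / 2 - 2 * q x n * (ln (1 + l n * x) / l n)"
  show ?thesis
  proof (rule tendsto_squeeze_family)
    have "?h \<longlonglongrightarrow> 0 + \<sigma> * (2 * x / \<sigma>)\<^sup>2 / 2 - 2 * (2 * x / \<sigma>) * x"
      by (intro tendsto_intros ln \<sigma> q_lim x ln_increment_lim) simp
    also have "0 + \<sigma> * (2 * x / \<sigma>)\<^sup>2 / 2 - 2 * (2 * x / \<sigma>) * x = - 2 * x\<^sup>2 / \<sigma>"
      using \<sigma>_pos by (simp add: field_simps power2_eq_square)
    finally show "?h \<longlonglongrightarrow> - 2 * x\<^sup>2 / \<sigma>" .
    show "eventually (\<lambda>n. ?f n \<le> ?h n) sequentially"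
      using lower[OF zero_less_one] eventually_ge_at_top[of 1]
    proof eventually_elim
      case (elim n)
      have l: "l n > 0" using elim l_pos by simp
      have c: "1 + l n * x > 0" using l x by (simp add: add_pos_pos)
      have "ln (p n) \<le> ln (real n) + ?s n * (real (shift x n))\<^sup>2 / 2 - 2 * real (shift x n) * ln (1 + l n * x)"
        using elim by (intro ln_upper_tail_le c p) auto
      then have "?f n \<le> 1 / (real n * (l n)\<^sup>2) *
          (ln (real n) + ?s n * (real (shift x n))\<^sup>2 / 2 - 2 * real (shift x n) * ln (1 + l n * x))"
        using l by (intro mult_left_mono) auto
      also have "\<dots> = ?h n"
        unfolding shift_q[OF elim(2)] using elim l by (simp add: field_simps power2_eq_square)
      finally show ?case .
    qed
    show "\<exists>g. g \<longlonglongrightarrow> ?G \<epsilon> \<and> eventually (\<lambda>n. g n \<le> ?f n) sequentially" if \<epsilon>: "\<epsilon> > 0" for \<epsilon>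
    proof (intro exI conjI)
      show "?g \<epsilon> \<longlonglongrightarrow> ?G \<epsilon>"
        using x \<epsilon> by (intro tendsto_intros nl2 \<sigma> q_lim nl l_0 ln_increment_lim) simp_all
      show "eventually (\<lambda>n. ?g \<epsilon> n \<le> ?f n) sequentially"
        using lower[OF \<epsilon>] by eventually_elim simp
    qed
    have "(?G \<longlongrightarrow> ?G 0) (at_right 0)" using \<sigma>_pos by (intro tendsto_intros) auto
    also have "?G 0 = - 2 * x\<^sup>2 / \<sigma>" using \<sigma>_pos by (simp add: field_simps power2_eq_square)
    finally show "(?G \<longlongrightarrow> - 2 * x\<^sup>2 / \<sigma>) (at_right 0)" .
  qed
qed

text \<open>Again the window runs from \<open>x\<close> to \<open>x + 2 \<epsilon>\<close>, now below the edge. The number of shifted variables is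
the same \<open>shift\<close> as before. The term with \<open>ln 2\<close> accounts for the \<open>n\<close> factors that are only
known to be at least one half; it vanishes in the limit by the assumption on \<open>n l\<^sup>3\<close>.\<close>

lemma lower_tail_limit:
  assumes x: "x > 0" and nl3: "(\<lambda>n. 1 / (real n * (l n) ^ 3)) \<longlonglongrightarrow> 0"
    and p: "\<And>n. n \<ge> 1 \<Longrightarrow> 1 - l n * x \<ge> 0 \<Longrightarrow>
      p n = (\<Prod>j\<in>{1..n}. Law n (v n) j {..gamma_mean (v n) n * (1 - l n * x)\<^sup>2})"
  shows "(\<lambda>n. 1 / ((real n)\<^sup>2 * (l n) ^ 3) * ln (p n)) \<longlonglongrightarrow> - 4 * x ^ 3 / (3 * \<sigma>\<^sup>2)"
proof -
  let ?s = "\<lambda>n. inv_scale n (v n)"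
  let ?f = "\<lambda>n. 1 / ((real n)\<^sup>2 * (l n) ^ 3) * ln (p n)"
  let ?o = "\<lambda>n. 1 / (real n * l n)"
  let ?b = "\<lambda>x y n. ln (1 + l n * (- x)) / l n * (q y n * (q y n + ?o n))
      + real n * ?s n * (q y n * (q y n + ?o n) * (2 * q y n + ?o n)) / 6"
  let ?B = "\<lambda>x y. - x * (2 * y / \<sigma> * (2 * y / \<sigma> + 0))
      + \<sigma> * (2 * y / \<sigma> * (2 * y / \<sigma> + 0) * (2 * (2 * y / \<sigma>) + 0)) / 6"
  have b_lim: "?b x y \<longlonglongrightarrow> ?B x y" if "y > 0" for x y
    using that by (intro tendsto_intros ln_increment_lim q_lim nl \<sigma>) simp_all
  have scale: "1 / ((real n)\<^sup>2 * (l n) ^ 3) * (ln (1 - l n * x) * (real (shift y n) * (real (shift y n) + 1))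
        + ?s n * (real (shift y n) * (real (shift y n) + 1) * (2 * real (shift y n) + 1)) / 6) = ?b x y n"
    if n: "n \<ge> 1" for x y n
    unfolding shift_q[OF n] using n l_pos[OF n]
    by (simp add: field_simps power2_eq_square power3_eq_cube)
  have lpos: "eventually (\<lambda>n. 1 - l n * z > 0) sequentially" for z
  proof -
    have "(\<lambda>n. 1 - l n * z) \<longlonglongrightarrow> 1 - 0 * z" by (intro tendsto_intros l_0)
    then show ?thesis by (rule order_tendstoD) simp
  qed
  let ?g = "\<lambda>\<epsilon> n. - ln 2 * (1 / (real n * (l n) ^ 3)) + ?b (x + 2 * \<epsilon>) (x + \<epsilon>) n"
  let ?G = "\<lambda>\<epsilon>. - ln 2 * 0 + ?B (x + 2 * \<epsilon>) (x + \<epsilon>)"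
  have lower: "eventually (\<lambda>n. p n > 0 \<and> ?g \<epsilon> n \<le> ?f n) sequentially" if \<epsilon>: "\<epsilon> > 0" for \<epsilon>
  proof -
    let ?y = "x + \<epsilon>" and ?x' = "x + 2 * \<epsilon>"
    have y: "?y > 0" using x \<epsilon> by simp
    \<comment> \<open>As for the upper tail, with all displacements negative.\<close>
    let ?E = "\<lambda>n. cross ?y n - q ?y n * (real n * ?s n)"
    have E: "?E \<longlonglongrightarrow> - 2 * ?y"
    proof -
      have "?E \<longlonglongrightarrow> 0 - 2 * ?y / \<sigma> * \<sigma>" by (intro tendsto_intros q_lim y \<sigma> cross_0)
      then show ?thesis using \<sigma>_pos by simp
    qed
    have "(\<lambda>n. (2 * (- x) + l n * (- x)\<^sup>2) - ?E n) \<longlonglongrightarrow> 2 * (- x) - (- 2 * ?y)"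
      by (intro tendsto_diff E square_increment_lim)
    then have e1: "eventually (\<lambda>n. \<epsilon> < (2 * (- x) + l n * (- x)\<^sup>2) - ?E n) sequentially"
      by (rule order_tendstoD) (use \<epsilon> in simp)
    have "(\<lambda>n. ?E n - (2 * (- ?x') + l n * (- ?x')\<^sup>2)) \<longlonglongrightarrow> - 2 * ?y - 2 * (- ?x')"
      by (intro tendsto_diff E square_increment_lim)
    then have e2: "eventually (\<lambda>n. \<epsilon> < ?E n - (2 * (- ?x') + l n * (- ?x')\<^sup>2)) sequentially"
      by (rule order_tendstoD) (use \<epsilon> in simp)
    have "eventually (\<lambda>n. 0 \<le> (0::real) \<and> (0::real) \<le> real n * 0) sequentially" by simp
    note var = variance_bound_lim[OF \<epsilon> tendsto_const this tendsto_const]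
    from e1 e2 var shift_small[OF y] eventually_ge_at_top[of 1] lpos[of ?x'] show ?thesis
    proof eventually_elim
      case (elim n)
      have n: "n \<ge> 1" "shift ?y n < n" "shift ?y n \<le> n" using elim by auto
      have l: "l n > 0" using l_pos n by simp
      have D: "gamma_mean (v n) n > 0" using n by (intro gamma_mean_pos)
      let ?\<delta> = "\<epsilon> * l n * gamma_mean (v n) n"
      have down: "gamma_mean (v n) (n - shift ?y n) = gamma_mean (v n) n * (1 + l n * ?E n)"
        by (rule gamma_mean_shift_down[OF n(1,3)])
      have c: "0 < 1 - l n * ?x'" "1 - l n * ?x' \<le> 1 - l n * x"
        using elim l \<epsilon> by auto
      have \<delta>: "?\<delta> > 0" using \<epsilon> l D by simp
      have sq: "(1 - l n * z)\<^sup>2 = 1 + l n * (2 * (- z) + l n * (- z)\<^sup>2)" for z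
        using square_increment[of n "- z"] by simp
      have d1: "gamma_mean (v n) n * (1 - l n * ?x')\<^sup>2 \<le> gamma_mean (v n) (n - shift ?y n) - ?\<delta>"
      proof -
        have "l n * (\<epsilon> + (2 * (- ?x') + l n * (- ?x')\<^sup>2)) \<le> l n * ?E n" using elim l by (intro mult_left_mono) auto
        then have "gamma_mean (v n) n * (1 + l n * (\<epsilon> + (2 * (- ?x') + l n * (- ?x')\<^sup>2))) \<le> gamma_mean (v n) n * (1 + l n * ?E n)"
          using D by (intro mult_left_mono) auto
        then show ?thesis unfolding down sq by (simp add: algebra_simps)
      qed
      have d2: "gamma_mean (v n) (n - shift ?y n) + ?\<delta> \<le> gamma_mean (v n) n * (1 - l n * x)\<^sup>2"
      proof -
        have "l n * (\<epsilon> + ?E n) \<le> l n * (2 * (- x) + l n * (- x)\<^sup>2)" using elim l by (intro mult_left_mono) auto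
        then have "gamma_mean (v n) n * (1 + l n * (\<epsilon> + ?E n)) \<le> gamma_mean (v n) n * (1 + l n * (2 * (- x) + l n * (- x)\<^sup>2))"
          using D by (intro mult_left_mono) auto
        then show ?thesis unfolding down sq by (simp add: algebra_simps)
      qed
      have d3: "gamma_mean (v n) n * (2 * real n + 1 + real (v n)) / ?\<delta>\<^sup>2 \<le> 1 / 2"
        using elim by simp
      have c0: "1 - l n * x \<ge> 0" using c by simp
      note * = ln_lower_tail_ge[OF n(1,2) c p[OF n(1) c0] \<delta> d1 d2 d3]
      have "?g \<epsilon> n = 1 / ((real n)\<^sup>2 * (l n) ^ 3) * (- real n * ln 2) + ?b ?x' ?y n"
        using n l by (simp add: field_simps power2_eq_square)
      also have "\<dots> = 1 / ((real n)\<^sup>2 * (l n) ^ 3) * (- real n * ln 2 +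
         (ln (1 - l n * ?x') * (real (shift ?y n) * (real (shift ?y n) + 1))
        + ?s n * (real (shift ?y n) * (real (shift ?y n) + 1) * (2 * real (shift ?y n) + 1)) / 6))"
        unfolding scale[OF n(1), symmetric] by (simp only: distrib_left)
      also have "\<dots> \<le> ?f n" using *(2) l n by (intro mult_left_mono) auto
      finally show ?case using *(1) by simp
    qed
  qed
  let ?h = "\<lambda>n. ?b x x n + 4 * (q x n) ^ 4 * l n"
  show ?thesis
  proof (rule tendsto_squeeze_family)
    have "?h \<longlonglongrightarrow> ?B x x + 4 * (2 * x / \<sigma>) ^ 4 * 0"
      by (intro tendsto_add b_lim x tendsto_mult tendsto_const tendsto_power q_lim l_0)
    also have "?B x x + 4 * (2 * x / \<sigma>) ^ 4 * 0 = - 4 * x ^ 3 / (3 * \<sigma>\<^sup>2)"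
      using \<sigma>_pos by (simp add: field_simps power2_eq_square power3_eq_cube)
    finally show "?h \<longlonglongrightarrow> - 4 * x ^ 3 / (3 * \<sigma>\<^sup>2)" .
    show "eventually (\<lambda>n. ?f n \<le> ?h n) sequentially"
      using lower[OF zero_less_one] eventually_ge_at_top[of 1] lpos[of x] shift_small[OF x]
    proof eventually_elim
      case (elim n)
      have l: "l n > 0" using elim l_pos by simp
      have "ln (p n) \<le> ln (1 - l n * x) * (real (shift x n) * (real (shift x n) + 1))
        + ?s n * (real (shift x n) * (real (shift x n) + 1) * (2 * real (shift x n) + 1)) / 6
        + 4 * (real (shift x n)) ^ 4 / (real n)\<^sup>2"
        using elim by (intro ln_lower_tail_le p) auto
      then have "?f n \<le> 1 / ((real n)\<^sup>2 * (l n) ^ 3) * (ln (1 - l n * x) * (real (shift x n) * (real (shift x n) + 1))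
        + ?s n * (real (shift x n) * (real (shift x n) + 1) * (2 * real (shift x n) + 1)) / 6
        + 4 * (real (shift x n)) ^ 4 / (real n)\<^sup>2)"
        using l by (intro mult_left_mono) auto
      also have "\<dots> = ?b x x n + 1 / ((real n)\<^sup>2 * (l n) ^ 3) * (4 * (real (shift x n)) ^ 4 / (real n)\<^sup>2)"
        unfolding scale[OF elim(2), symmetric] by (simp only: distrib_left)
      also have "1 / ((real n)\<^sup>2 * (l n) ^ 3) * (4 * (real (shift x n)) ^ 4 / (real n)\<^sup>2) = 4 * (q x n) ^ 4 * l n"
        unfolding shift_q[OF elim(2)] using elim l
        by (simp add: field_simps power2_eq_square power3_eq_cube power4_eq_xxxx)
      finally show ?case .
    qed
    show "\<exists>g. g \<longlonglongrightarrow> ?G \<epsilon> \<and> eventually (\<lambda>n. g n \<le> ?f n) sequentially" if \<epsilon>: "\<epsilon> > 0" for \<epsilon>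
    proof (intro exI conjI)
      show "?g \<epsilon> \<longlonglongrightarrow> ?G \<epsilon>"
        using x \<epsilon> by (intro tendsto_add tendsto_mult[OF tendsto_const nl3] b_lim) simp
      show "eventually (\<lambda>n. ?g \<epsilon> n \<le> ?f n) sequentially"
        using lower[OF \<epsilon>] by eventually_elim simp
    qed
    have "(?G \<longlongrightarrow> ?G 0) (at_right 0)" using \<sigma>_pos by (intro tendsto_intros) auto
    also have "?G 0 = - 4 * x ^ 3 / (3 * \<sigma>\<^sup>2)"
      using \<sigma>_pos by (simp add: field_simps power2_eq_square power3_eq_cube)
    finally show "(?G \<longlongrightarrow> - 4 * x ^ 3 / (3 * \<sigma>\<^sup>2)) (at_right 0)" .
  qed
qed

end

lemma inv_scale_eq:
  "eventually (\<lambda>n. 1 + 1 / (1 + real (v n) / real n) = real n * inv_scale n (v n)) sequentially"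
  using eventually_ge_at_top[of 1]
proof eventually_elim
  case (elim n)
  have "1 + real (v n) / real n = (real n + real (v n)) / real n"
    using elim by (simp add: add_divide_distrib)
  then show ?case using elim by (simp add: inv_scale_def distrib_left)
qed

text \<open>Both cases of \<open>\<alpha>\<close> enter the rates only through \<open>\<sigma>\<close>.\<close>

lemma limit_inv_scale:
  fixes v :: "nat \<Rightarrow> nat" and \<alpha> :: ennreal and x :: real
  assumes \<alpha>: "(\<lambda>n. ennreal (real (v n) / real n)) \<longlonglongrightarrow> \<alpha>"
  obtains \<sigma> where "\<sigma> > 0" "(\<lambda>n. real n * inv_scale n (v n)) \<longlonglongrightarrow> \<sigma>"
    "eval_ext (\<lambda>a. - (2 * (1 + a) / (2 + a)) * x\<^sup>2) \<alpha> = - 2 * x\<^sup>2 / \<sigma>"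
    "eval_ext (\<lambda>a. - (4 * (1 + a)\<^sup>2 / (3 * (2 + a)\<^sup>2)) * x ^ 3) \<alpha> = - 4 * x ^ 3 / (3 * \<sigma>\<^sup>2)"
proof (cases "\<alpha> = \<infinity>")
  case True
  have e: "eventually (\<lambda>n. 1 + 1 / (1 + real (v n) / real n) = real n * inv_scale n (v n)) sequentially"
    by (rule inv_scale_eq)
  have "filterlim (\<lambda>n. real (v n) / real n) at_top sequentially"
    using \<alpha> True by (simp add: ennreal_tendsto_top_eq_at_top)
  moreover have "((\<lambda>a::real. 1 + 1 / (1 + a)) \<longlongrightarrow> 1) at_top" by real_asymp
  ultimately have "(\<lambda>n. 1 + 1 / (1 + real (v n) / real n)) \<longlonglongrightarrow> 1"
    by (rule filterlim_compose[rotated])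
  then have 1: "(\<lambda>n. real n * inv_scale n (v n)) \<longlonglongrightarrow> 1" by (rule Lim_transform_eventually[OF _ e])
  have "eval_ext (\<lambda>a. - (2 * (1 + a) / (2 + a)) * x\<^sup>2) \<alpha> = - 2 * x\<^sup>2 / 1" for x
  proof -
    have "((\<lambda>a::real. 2 * (1 + a) / (2 + a)) \<longlongrightarrow> 2) at_top" by real_asymp
    then have "((\<lambda>a. - (2 * (1 + a) / (2 + a)) * x\<^sup>2) \<longlongrightarrow> - 2 * x\<^sup>2) at_top"
      by (intro tendsto_intros)
    then show ?thesis using True by (simp add: eval_ext_def tendsto_Lim)
  qed
  moreover have "eval_ext (\<lambda>a. - (4 * (1 + a)\<^sup>2 / (3 * (2 + a)\<^sup>2)) * x ^ 3) \<alpha> = - 4 * x ^ 3 / (3 * 1\<^sup>2)" for x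
  proof -
    have "((\<lambda>a::real. 4 * (1 + a)\<^sup>2 / (3 * (2 + a)\<^sup>2)) \<longlongrightarrow> 4 / 3) at_top" by real_asymp
    then have "((\<lambda>a. - (4 * (1 + a)\<^sup>2 / (3 * (2 + a)\<^sup>2)) * x ^ 3) \<longlongrightarrow> - (4 / 3) * x ^ 3) at_top"
      by (intro tendsto_mult_right tendsto_minus)
    then show ?thesis using True by (simp add: eval_ext_def tendsto_Lim)
  qed
  ultimately show ?thesis using that[OF zero_less_one 1] by blast
next
  case False
  define a where "a = enn2real \<alpha>"
  have a: "a \<ge> 0" "\<alpha> = ennreal a" using False by (auto simp: a_def less_top)
  have e: "eventually (\<lambda>n. 1 + 1 / (1 + real (v n) / real n) = real n * inv_scale n (v n)) sequentially"
    by (rule inv_scale_eq)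
  have "(\<lambda>n. real (v n) / real n) \<longlonglongrightarrow> a"
    by (rule tendsto_ennrealD) (use \<alpha> a in auto)
  then have "(\<lambda>n. 1 + 1 / (1 + real (v n) / real n)) \<longlonglongrightarrow> 1 + 1 / (1 + a)"
    using a by (intro tendsto_intros) auto
  then have 1: "(\<lambda>n. real n * inv_scale n (v n)) \<longlonglongrightarrow> 1 + 1 / (1 + a)" by (rule Lim_transform_eventually[OF _ e])
  have \<sigma>: "1 + 1 / (1 + a) > 0" "1 + 1 / (1 + a) = (2 + a) / (1 + a)" using a by (auto simp: field_simps add_pos_nonneg)
  have "eval_ext (\<lambda>a. - (2 * (1 + a) / (2 + a)) * x\<^sup>2) \<alpha> = - 2 * x\<^sup>2 / (1 + 1 / (1 + a))" for x
    unfolding \<sigma>(2) using False a by (simp add: eval_ext_def a_def[symmetric])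
  moreover have "eval_ext (\<lambda>a. - (4 * (1 + a)\<^sup>2 / (3 * (2 + a)\<^sup>2)) * x ^ 3) \<alpha> = - 4 * x ^ 3 / (3 * (1 + 1 / (1 + a))\<^sup>2)" for x
    unfolding \<sigma>(2) using False a by (simp add: eval_ext_def a_def[symmetric] power_divide)
  ultimately show ?thesis using that[OF \<sigma>(1) 1] by blast
qed

text \<open>Dividing by the diverging \<open>ln n\<close> removes the logarithm.\<close>

lemma inverse_from_log_scale:
  fixes w :: "nat \<Rightarrow> real"
  assumes "(\<lambda>n. ln (real n) / real n) \<lless> w"
  shows "(\<lambda>n. ln (real n) / (real n * w n)) \<longlonglongrightarrow> 0" and "(\<lambda>n. 1 / (real n * w n)) \<longlonglongrightarrow> 0"
proof -
  show 1: "(\<lambda>n. ln (real n) / (real n * w n)) \<longlonglongrightarrow> 0"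
    using assms unfolding much_smaller_def by (simp add: divide_divide_eq_left)
  have "(\<lambda>n. 1 / ln (real n)) \<longlonglongrightarrow> 0" by real_asymp
  from tendsto_mult[OF 1 this] have "(\<lambda>n. ln (real n) / (real n * w n) * (1 / ln (real n))) \<longlonglongrightarrow> 0" by simp
  moreover have "eventually (\<lambda>n. ln (real n) / (real n * w n) * (1 / ln (real n)) = 1 / (real n * w n)) sequentially"
    using eventually_ge_at_top[of 2]
  proof eventually_elim
    case (elim n)
    then have "ln (real n) > 0" by simp
    then show ?case by simp
  qed
  ultimately show "(\<lambda>n. 1 / (real n * w n)) \<longlonglongrightarrow> 0" by (rule Lim_transform_eventually)
qed

section \<open>The large deviation limits\<close>

theorem theorem3:
  fixes v :: "nat \<Rightarrow> nat"
    and \<alpha> :: ennreal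
    and M :: "nat \<Rightarrow> 'a measure"
    and \<zeta> :: "nat \<Rightarrow> nat \<Rightarrow> 'a \<Rightarrow> complex"
    and x :: real
  assumes "(\<lambda>n. ennreal (real (v n) / real n)) \<longlonglongrightarrow> \<alpha>"
    and "\<And>n. n \<ge> 1 \<Longrightarrow> prob_space (M n)"
    and "\<And>n. n \<ge> 1 \<Longrightarrow>
           distributed (M n) (lebesgue_Cn n) (\<lambda>\<omega>. \<lambda>i\<in>{1..n}. \<zeta> n i \<omega>)
             (\<lambda>z. ennreal (joint_density n (v n) z))"
    and "x > 0"
  shows "(\<forall>l :: nat \<Rightarrow> real.
            (\<forall>n\<ge>1. l n > 0) \<and>
            (\<lambda>n. ln (real n) / real n) \<lless> (\<lambda>n. (l n)\<^sup>2) \<and> (\<lambda>n. (l n)\<^sup>2) \<lless> (\<lambda>n. 1) \<longrightarrow>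
            (\<lambda>n. 1 / (real n * (l n)\<^sup>2) *
                  ln (measure (M n) {\<omega> \<in> space (M n).
                        sqrt (real n / real (n + v n)) * Max ((\<lambda>i. (cmod (\<zeta> n i \<omega>))\<^sup>2) ` {1..n})
                          \<ge> 1 + l n * x}))
              \<longlonglongrightarrow> eval_ext (\<lambda>a. - (2 * (1 + a) / (2 + a)) * x\<^sup>2) \<alpha>) \<and>
         (\<forall>l :: nat \<Rightarrow> real.
            (\<forall>n\<ge>1. l n > 0) \<and>
            (\<lambda>n. ln (real n) / real n) \<lless> (\<lambda>n. (l n) ^ 3) \<and> (\<lambda>n. (l n) ^ 3) \<lless> (\<lambda>n. 1) \<longrightarrow>
            (\<lambda>n. 1 / ((real n)\<^sup>2 * (l n) ^ 3) *
                  ln (measure (M n) {\<omega> \<in> space (M n).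
                        sqrt (real n / real (n + v n)) * Max ((\<lambda>i. (cmod (\<zeta> n i \<omega>))\<^sup>2) ` {1..n})
                          \<le> 1 - l n * x}))
              \<longlonglongrightarrow> eval_ext (\<lambda>a. - (4 * (1 + a)\<^sup>2 / (3 * (2 + a)\<^sup>2)) * x ^ 3) \<alpha>)"
proof -
  obtain \<sigma> where \<sigma>: "\<sigma> > 0" "(\<lambda>n. real n * inv_scale n (v n)) \<longlonglongrightarrow> \<sigma>"
    and rates: "eval_ext (\<lambda>a. - (2 * (1 + a) / (2 + a)) * x\<^sup>2) \<alpha> = - 2 * x\<^sup>2 / \<sigma>"
      "eval_ext (\<lambda>a. - (4 * (1 + a)\<^sup>2 / (3 * (2 + a)\<^sup>2)) * x ^ 3) \<alpha> = - 4 * x ^ 3 / (3 * \<sigma>\<^sup>2)"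
    by (rule limit_inv_scale[OF assms(1)])
  show ?thesis unfolding rates
  proof (intro conjI allI impI; elim conjE)
    fix l :: "nat \<Rightarrow> real"
    assume l: "\<forall>n\<ge>1. l n > 0" and 1: "(\<lambda>n. ln (real n) / real n) \<lless> (\<lambda>n. (l n)\<^sup>2)"
      and 2: "(\<lambda>n. (l n)\<^sup>2) \<lless> (\<lambda>n. 1)"
    note logs = inverse_from_log_scale[OF 1]
    have "(\<lambda>n. sqrt ((l n)\<^sup>2)) \<longlonglongrightarrow> sqrt 0"
      using 2 unfolding much_smaller_def by (intro tendsto_real_sqrt) simp
    then have l0: "l \<longlonglongrightarrow> 0" by (simp add: tendsto_rabs_zero_iff)
    interpret scaling v l \<sigma>
      by unfold_locales (use \<sigma> l l0 logs in auto)
    show "(\<lambda>n. 1 / (real n * (l n)\<^sup>2) *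
                  ln (measure (M n) {\<omega> \<in> space (M n).
                        sqrt (real n / real (n + v n)) * Max ((\<lambda>i. (cmod (\<zeta> n i \<omega>))\<^sup>2) ` {1..n})
                          \<ge> 1 + l n * x})) \<longlonglongrightarrow> - 2 * x\<^sup>2 / \<sigma>"
    proof (rule upper_tail_limit[OF assms(4) logs(1)])
      fix n :: nat assume n: "n \<ge> 1"
      have "1 + l n * x \<ge> 0" using l n assms(4) by (simp add: less_imp_le add_pos_pos)
      from prob_max_modulus(2)[OF n this assms(2)[OF n] assms(3)[OF n]]
      show "measure (M n) {\<omega> \<in> space (M n).
                        sqrt (real n / real (n + v n)) * Max ((\<lambda>i. (cmod (\<zeta> n i \<omega>))\<^sup>2) ` {1..n})
                          \<ge> 1 + l n * x}
        = 1 - (\<Prod>j\<in>{1..n}. Law n (v n) j {..<gamma_mean (v n) n * (1 + l n * x)\<^sup>2})" .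
    qed
  next
    fix l :: "nat \<Rightarrow> real"
    assume l: "\<forall>n\<ge>1. l n > 0" and 1: "(\<lambda>n. ln (real n) / real n) \<lless> (\<lambda>n. (l n) ^ 3)"
      and 2: "(\<lambda>n. (l n) ^ 3) \<lless> (\<lambda>n. 1)"
    note logs = inverse_from_log_scale[OF 1]
    have "(\<lambda>n. root 3 ((l n) ^ 3)) \<longlonglongrightarrow> root 3 0"
      using 2 unfolding much_smaller_def by (intro tendsto_real_root) simp
    then have l0: "l \<longlonglongrightarrow> 0" by (simp add: odd_real_root_power_cancel)
    have "(\<lambda>n. l n * (1 / (real n * (l n) ^ 3))) \<longlonglongrightarrow> 0 * 0" by (rule tendsto_mult[OF l0 logs(2)])
    moreover have "eventually (\<lambda>n. l n * (1 / (real n * (l n) ^ 3)) = 1 / (real n * (l n)\<^sup>2)) sequentially"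
      using eventually_ge_at_top[of 1]
      by eventually_elim (use l in \<open>simp add: power2_eq_square power3_eq_cube\<close>)
    ultimately have nl2: "(\<lambda>n. 1 / (real n * (l n)\<^sup>2)) \<longlonglongrightarrow> 0"
      using Lim_transform_eventually by fastforce
    interpret scaling v l \<sigma>
      by unfold_locales (use \<sigma> l l0 nl2 in auto)
    show "(\<lambda>n. 1 / ((real n)\<^sup>2 * (l n) ^ 3) *
                  ln (measure (M n) {\<omega> \<in> space (M n).
                        sqrt (real n / real (n + v n)) * Max ((\<lambda>i. (cmod (\<zeta> n i \<omega>))\<^sup>2) ` {1..n})
                          \<le> 1 - l n * x})) \<longlonglongrightarrow> - 4 * x ^ 3 / (3 * \<sigma>\<^sup>2)"
    proof (rule lower_tail_limit[OF assms(4) logs(2)])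
      fix n :: nat assume n: "n \<ge> 1" and c: "1 - l n * x \<ge> 0"
      from prob_max_modulus(1)[OF n c assms(2)[OF n] assms(3)[OF n]]
      show "measure (M n) {\<omega> \<in> space (M n).
                        sqrt (real n / real (n + v n)) * Max ((\<lambda>i. (cmod (\<zeta> n i \<omega>))\<^sup>2) ` {1..n})
                          \<le> 1 - l n * x}
        = (\<Prod>j\<in>{1..n}. Law n (v n) j {..gamma_mean (v n) n * (1 - l n * x)\<^sup>2})" .
    qed
  qed
qed

end
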